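(* Let $\varrho_1,\varrho_2$ be proximate orders with orders $\rho_1=\lim_{r\to\infty}\varrho_1(r)>0$ and $\rho_2=\lim_{r\to\infty}\varrho_2(r)>0$, such that $r^{\varrho_1(r)}=O(r^{\varrho_2(r)})$ as $r\to\infty$. Let $\hat\varrho_1$ be a normalized proximate order with $\hat\varrho_1(r)=\varrho_1(r)$ for all sufficiently large $r$, and let $G_{\hat\varrho_1,\ell}$ be the associated numbers. Then: (a) If $\{u_\ell\}_{\ell\in\mathbb{N}_0}\subseteq\mathcal{SM}_L(\mathbb{R}^{n+1})$ satisfies $$\forall\varepsilon>0\ \exists\sigma,C>0\ \forall\ell\in\mathbb{N}_0:\quad \|u_\ell\|_{\varrho_2,\sigma}\le C\frac{G_{\hat\varrho_1,\ell}}{\ell!}\varepsilon^\ell,$$ then for every $f\in A_{\varrho_1}$ the series $Tf:=\sum_{\ell=0}^\infty u_\ell\star_L\partial_{x_0}^\ell f$ converges in $A_{\varrho_2}$, and $T:A_{\varrho_1}\to A_{\varrho_2}$ is a continuous operator. (b) Conversely, every continuous right $\mathbb{R}_n$-linear operator $T:A_{\varrho_1}\to A_{\varrho_2}$ is of the form $Tf=\sum_{\ell=0}^\infty u_\ell\star_L\partial_{x_0}^\ell f$ for some sequence $\{u_\ell\}_{\ell\in\mathbb{N}_0}\subseteq\mathcal{SM}_L(\mathbb{R}^{n+1})$ satisfying the condition in (a).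
   Context: $\mathbb{R}_n$ is the real Clifford algebra generated by $e_1,\dots,e_n$ with $e_ie_j=-e_je_i$ ($i\neq j$), $e_i^2=-1$; each $a\in\mathbb{R}_n$ is $a=\sum_Aa_Ae_A$ (sum over ordered subsets $A\subseteq\{1,\dots,n\}$, $e_A=e_{i_1}\cdots e_{i_r}$, $e_\emptyset=1$), with norm $|a|^2=\sum_A a_A^2$. Paravectors $x=x_0+\sum_{\ell=1}^nx_\ell e_\ell$ are identified with $\mathbb{R}^{n+1}$, and $\mathbb{S}=\{\sum_{\ell=1}^n x_\ell e_\ell:\sum x_\ell^2=1\}$. A function $f:\mathbb{R}^{n+1}\to\mathbb{R}_n$ is (entire) left slice monogenic, $f\in\mathcal{SM}_L(\mathbb{R}^{n+1})$, if $f(u+jv)=f_0(u,v)+jf_1(u,v)$ for all $u,v\in\mathbb{R}$, $j\in\mathbb{S}$, where $f_0,f_1:\mathbb{R}^2\to\mathbb{R}_n$ are continuously differentiable, $f_0(u,-v)=f_0(u,v)$, $f_1(u,-v)=-f_1(u,v)$, $\partial_uf_0=\partial_vf_1$ and $\partial_vf_0=-\partial_uf_1$. The star product is $f\star_Lg=f_0g_0-f_1g_1+j(f_1g_0+f_0g_1)$; for power series $\sum x^ka_k$, $\sum x^kb_k$ it equals $\sum_\ell x^\ell\sum_{k\le\ell}a_kb_{\ell-k}$. $\partial_{x_0}$ is the partial derivative in $x_0$ (the slice derivative). A proximate order is a differentiable $\varrho:[0,\infty)\to[0,\infty)$ with $\lim_{r\to\infty}\varrho(r)=\rho>0$ (its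 order) and $\lim_{r\to\infty}\varrho'(r)r\ln r=0$. It is normalized if $r\mapsto r^{\varrho(r)}$ is strictly increasing on $(0,\infty)$ and tends to $0$ as $r\to0^+$; then $\varphi:(0,\infty)\to(0,\infty)$ denotes the inverse of $r\mapsto r^{\varrho(r)}$, and $G_{\varrho,0}=1$, $G_{\varrho,\ell}=\varphi(\ell)^\ell/(e\rho)^{\ell/\rho}$ for $\ell\in\mathbb{N}$. For $\sigma>0$, $A_{\varrho,\sigma}=\{f\in\mathcal{SM}_L(\mathbb{R}^{n+1}):\|f\|_{\varrho,\sigma}:=\sup_x|f(x)|e^{-\sigma|x|^{\varrho(|x|)}}<\infty\}$ (a Banach space). $A_\varrho=\bigcup_{\sigma>0}A_{\varrho,\sigma}$ with the inductive limit locally convex topology (a sequence converges iff it lies in some $A_{\varrho,\sigma}$ together with its limit and converges in $\|\cdot\|_{\varrho,\sigma}$). *)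

theory Defs
  imports "HOL-Analysis.Analysis" "HOL-Library.Landau_Symbols"
begin

text \<open>The generators e_1,...,e_n are indexed by a finite linearly ordered type 'n
  (so n = CARD('n)).  An element a = sum_A a_A e_A of R_n is represented by its
  coefficient vector in real^('n set); the Euclidean norm of this vector is |a|.\<close>

type_synonym 'n clif = "real ^ ('n set)"

definition sdiff :: "'a set \<Rightarrow> 'a set \<Rightarrow> 'a set" where
  "sdiff A B = (A - B) \<union> (B - A)"

text \<open>e_A e_B = csign A B e_(A symmetric difference B)\<close>
definition csign :: "'n::{finite,linorder} set \<Rightarrow> 'n set \<Rightarrow> real" where
  "csign A B = (-1) ^ (card {(a, b). a \<in> A \<and> b \<in> B \<and> b < a} + card (A \<inter> B))"

definition cmult :: "'n::{finite,linorder} clif \<Rightarrow> 'n clif \<Rightarrow> 'n clif" (infixl "\<odot>" 70) where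
  "a \<odot> b = (\<chi> C. \<Sum>A\<in>UNIV. csign A (sdiff A C) * a $ A * b $ (sdiff A C))"

text \<open>Paravector x_0 + sum_l x_l e_l, with a point of R^(n+1) represented as (x_0, x').\<close>
definition para :: "real \<times> (real ^ ('n::{finite,linorder})) \<Rightarrow> 'n clif" where
  "para x = (\<chi> A. if A = {} then fst x else if card A = 1 then snd x $ (the_elem A) else 0)"

definition C1_with :: "(real \<times> real \<Rightarrow> 'a::real_normed_vector) \<Rightarrow> (real \<times> real \<Rightarrow> ((real \<times> real) \<Rightarrow>\<^sub>L 'a)) \<Rightarrow> bool" where
  "C1_with g D \<longleftrightarrow> (\<forall>p. (g has_derivative blinfun_apply (D p)) (at p)) \<and> continuous_on UNIV D"

definition slice_decomp ::
  "(real \<times> (real ^ ('n::{finite,linorder})) \<Rightarrow> 'n clif) \<Rightarrow> (real \<times> real \<Rightarrow> 'n clif) \<Rightarrow> (real \<times> real \<Rightarrow> 'n clif) \<Rightarrow> bool" where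
  "slice_decomp f f0 f1 \<longleftrightarrow>
     (\<exists>D0 D1. C1_with f0 D0 \<and> C1_with f1 D1 \<and>
        (\<forall>p. blinfun_apply (D0 p) (1, 0) = blinfun_apply (D1 p) (0, 1) \<and>
             blinfun_apply (D0 p) (0, 1) = - blinfun_apply (D1 p) (1, 0))) \<and>
     (\<forall>u v. f0 (u, - v) = f0 (u, v) \<and> f1 (u, - v) = - f1 (u, v)) \<and>
     (\<forall>u v j. norm j = 1 \<longrightarrow>
        f (u, v *\<^sub>R j) = f0 (u, v) + para (0, j) \<odot> f1 (u, v))"

definition slice_monogenic :: "(real \<times> (real ^ ('n::{finite,linorder})) \<Rightarrow> 'n clif) \<Rightarrow> bool" where
  "slice_monogenic f \<longleftrightarrow> (\<exists>f0 f1. slice_decomp f f0 f1)"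

definition star :: "(real \<times> (real ^ ('n::{finite,linorder})) \<Rightarrow> 'n clif) \<Rightarrow> (real \<times> (real ^ ('n::{finite,linorder})) \<Rightarrow> 'n clif) \<Rightarrow> real \<times> (real ^ ('n::{finite,linorder})) \<Rightarrow> 'n clif" where
  "star f g x =
    (let F = (SOME p. slice_decomp f (fst p) (snd p));
         G = (SOME p. slice_decomp g (fst p) (snd p));
         u = fst x; v = norm (snd x);
         j = (if snd x = 0 then (SOME j. norm j = 1) else sgn (snd x));
         J = para (0, j)
     in fst F (u, v) \<odot> fst G (u, v) - snd F (u, v) \<odot> snd G (u, v)
        + J \<odot> (snd F (u, v) \<odot> fst G (u, v) + fst F (u, v) \<odot> snd G (u, v)))"

definition dx0 :: "(real \<times> (real ^ ('n::{finite,linorder})) \<Rightarrow> 'n clif) \<Rightarrow> real \<times> (real ^ ('n::{finite,linorder})) \<Rightarrow> 'n clif" where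
  "dx0 f x = vector_derivative (\<lambda>t. f (t, snd x)) (at (fst x))"

definition proximate_order :: "(real \<Rightarrow> real) \<Rightarrow> real \<Rightarrow> bool" where
  "proximate_order \<rho>' \<rho> \<longleftrightarrow>
     (\<forall>r\<ge>0. \<rho>' r \<ge> 0) \<and> \<rho>' differentiable_on {0..} \<and> \<rho> > 0 \<and>
     (\<rho>' \<longlongrightarrow> \<rho>) at_top \<and>
     ((\<lambda>r. deriv \<rho>' r * r * ln r) \<longlongrightarrow> 0) at_top"

definition normalized :: "(real \<Rightarrow> real) \<Rightarrow> bool" where
  "normalized \<rho>' \<longleftrightarrow> strict_mono_on {0<..} (\<lambda>r. r powr \<rho>' r) \<and>
     ((\<lambda>r. r powr \<rho>' r) \<longlongrightarrow> 0) (at_right 0)"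

definition Gnum :: "(real \<Rightarrow> real) \<Rightarrow> real \<Rightarrow> nat \<Rightarrow> real" where
  "Gnum \<rho>' \<rho> l = (if l = 0 then 1 else
     (the_inv_into {0<..} (\<lambda>r. r powr \<rho>' r) (real l)) ^ l / (exp 1 * \<rho>) powr (real l / \<rho>))"

definition weight_bdd :: "(real \<Rightarrow> real) \<Rightarrow> real \<Rightarrow> (real \<times> (real ^ ('n::{finite,linorder})) \<Rightarrow> 'n clif) \<Rightarrow> bool" where
  "weight_bdd \<rho>' \<sigma> f \<longleftrightarrow> bdd_above (range (\<lambda>x. norm (f x) * exp (- \<sigma> * norm x powr \<rho>' (norm x))))"

definition wnorm :: "(real \<Rightarrow> real) \<Rightarrow> real \<Rightarrow> (real \<times> (real ^ ('n::{finite,linorder})) \<Rightarrow> 'n clif) \<Rightarrow> real" where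
  "wnorm \<rho>' \<sigma> f = (SUP x. norm (f x) * exp (- \<sigma> * norm x powr \<rho>' (norm x)))"

definition A_sig :: "(real \<Rightarrow> real) \<Rightarrow> real \<Rightarrow> (real \<times> (real ^ ('n::{finite,linorder})) \<Rightarrow> 'n clif) set" where
  "A_sig \<rho>' \<sigma> = {f. slice_monogenic f \<and> weight_bdd \<rho>' \<sigma> f}"

definition A_sp :: "(real \<Rightarrow> real) \<Rightarrow> (real \<times> (real ^ ('n::{finite,linorder})) \<Rightarrow> 'n clif) set" where
  "A_sp \<rho>' = (\<Union>\<sigma>\<in>{0<..}. A_sig \<rho>' \<sigma>)"

definition conv_in :: "(real \<Rightarrow> real) \<Rightarrow> (nat \<Rightarrow> real \<times> (real ^ ('n::{finite,linorder})) \<Rightarrow> 'n clif) \<Rightarrow> (real \<times> (real ^ ('n::{finite,linorder})) \<Rightarrow> 'n clif) \<Rightarrow> bool" where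
  "conv_in \<rho>' s g \<longleftrightarrow> (\<exists>\<sigma>>0. g \<in> A_sig \<rho>' \<sigma> \<and> (\<forall>N. s N \<in> A_sig \<rho>' \<sigma>) \<and>
      ((\<lambda>N. wnorm \<rho>' \<sigma> (\<lambda>x. s N x - g x)) \<longlonglongrightarrow> 0))"

text \<open>The locally convex inductive limit topology on A_rho: a base of 0-neighbourhoods
  consists of the absolutely convex subsets V of A_rho such that V meets every
  A_{rho,sigma} in a 0-neighbourhood of the Banach space A_{rho,sigma}.\<close>
definition lc_zero_nbhd :: "(real \<Rightarrow> real) \<Rightarrow> (real \<times> (real ^ ('n::{finite,linorder})) \<Rightarrow> 'n clif) set \<Rightarrow> bool" where
  "lc_zero_nbhd \<rho>' V \<longleftrightarrow> V \<subseteq> A_sp \<rho>' \<and>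
     (\<forall>f\<in>V. \<forall>g\<in>V. \<forall>a b::real. \<bar>a\<bar> + \<bar>b\<bar> \<le> 1 \<longrightarrow> (\<lambda>x. a *\<^sub>R f x + b *\<^sub>R g x) \<in> V) \<and>
     (\<forall>\<sigma>>0. \<exists>\<epsilon>>0. {g \<in> A_sig \<rho>' \<sigma>. wnorm \<rho>' \<sigma> g < \<epsilon>} \<subseteq> V)"

definition A_top :: "(real \<Rightarrow> real) \<Rightarrow> (real \<times> (real ^ ('n::{finite,linorder})) \<Rightarrow> 'n clif) topology" where
  "A_top \<rho>' = topology (\<lambda>U. U \<subseteq> A_sp \<rho>' \<and>
      (\<forall>f\<in>U. \<exists>V. lc_zero_nbhd \<rho>' V \<and> (\<lambda>g x. f x + g x) ` V \<subseteq> U))"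

definition right_linear_on ::
  "(real \<times> (real ^ ('n::{finite,linorder})) \<Rightarrow> 'n clif) set \<Rightarrow> ((real \<times> (real ^ ('n::{finite,linorder})) \<Rightarrow> 'n clif) \<Rightarrow> (real \<times> (real ^ ('n::{finite,linorder})) \<Rightarrow> 'n clif)) \<Rightarrow> bool" where
  "right_linear_on S T \<longleftrightarrow> (\<forall>f\<in>S. \<forall>g\<in>S. \<forall>a b.
      T (\<lambda>x. f x \<odot> a + g x \<odot> b) = (\<lambda>x. T f x \<odot> a + T g x \<odot> b))"

definition coeff_cond :: "(real \<Rightarrow> real) \<Rightarrow> real \<Rightarrow> (real \<Rightarrow> real) \<Rightarrow> (nat \<Rightarrow> real \<times> (real ^ ('n::{finite,linorder})) \<Rightarrow> 'n clif) \<Rightarrow> bool" where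
  "coeff_cond \<rho>1h \<rho>1 \<rho>2' u \<longleftrightarrow> (\<forall>\<epsilon>>0. \<exists>\<sigma>>0. \<exists>C>0. \<forall>l.
      u l \<in> A_sig \<rho>2' \<sigma> \<and> wnorm \<rho>2' \<sigma> (u l) \<le> C * Gnum \<rho>1h \<rho>1 l / fact l * \<epsilon> ^ l)"

definition op_series :: "(nat \<Rightarrow> real \<times> (real ^ ('n::{finite,linorder})) \<Rightarrow> 'n clif) \<Rightarrow> (real \<times> (real ^ ('n::{finite,linorder})) \<Rightarrow> 'n clif) \<Rightarrow> nat \<Rightarrow> real \<times> (real ^ ('n::{finite,linorder})) \<Rightarrow> 'n clif" where
  "op_series u f N = (\<lambda>x. \<Sum>l<N. star (u l) ((dx0 ^^ l) f) x)"

end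

theory Submission
  imports Defs "HOL-Complex_Analysis.Complex_Analysis"
begin

text \<open>
  Collecting \<open>f\<^sub>0 + \<i> f\<^sub>1\<close> identifies slice monogenic functions with entire functions \<open>H\<close> with
  values in the complexified Clifford algebra satisfying \<open>H (cnj z) = cnj (H z)\<close>. Under this
  identification, the star product is the pointwise product, the slice derivative is the complex
  derivative, and the growth conditions agree up to constants.

  For (a), Cauchy's estimate for the \<open>l\<close>-th derivative on the circle of radius \<open>\<phi>(l)\<close>, together
  with \<open>w(r + s) \<le> K (w(r) + w(s)) + c\<close> for \<open>w(r) = r powr \<rho>(r)\<close>, bounds it by a constant times
  \<open>l! B\<^sup>l / \<phi>(l)\<^sup>l\<close>, so the series is dominated by a geometric one. Linear maps that are bounded from
  steps to steps are continuous for the inductive limit topology.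

  For (b), a continuous linear map is bounded from steps to steps. The coefficients \<open>u\<^sub>l\<close> are obtained
  from the images of the monomials by binomial inversion; their growth follows from
  \<open>r\<^sup>j \<le> C (\<delta> \<phi>(l))\<^sup>j exp (\<tau> w(r))\<close> for \<open>j \<le> l\<close>, where \<open>\<delta>\<close> is arbitrarily small. Both sides of the
  claimed identity agree on monomials, and Taylor polynomials converge in some step.
\<close>

section \<open>Clifford multiplication\<close>

text \<open>In the complexification the imaginary unit is central, unlike the units of the slices,
  so holomorphy, Cauchy estimates and power series can be used coordinate by coordinate. The
  quantifier over \<open>\<epsilon>\<close> in the coefficient condition is shaped by the inductive
  limit. The radius \<open>phi l\<close> solves \<open>wt (phi l) = l\<close>, so the weight on the
  circle contributes a geometric factor \<open>B ^ l\<close>, but \<open>B\<close> grows with the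
  exponent of the step containing \<open>f\<close>. No fixed rate would serve all steps; hence every
  \<open>\<epsilon>\<close> is called for in (a). In (b) the same freedom reappears: allowing a
  larger exponent shrinks the factor \<open>\<delta>\<close> in the bound on powers, so each
  \<open>\<epsilon>\<close> is reached in a step depending on it. An arbitrary proximate order need
  not have an invertible weight, so estimates involving \<open>phi\<close> are made with the
  normalized order. The two weights differ by a bounded amount, since they agree near infinity and
  are bounded on compact intervals; this changes norms by constant factors only, within the same
  step.\<close>

lemma sdiff_assoc: "sdiff (sdiff A B) C = sdiff A (sdiff B C)"
  by (auto simp: sdiff_def)

lemma sdiff_commute: "sdiff A B = sdiff B A"
  by (auto simp: sdiff_def)

lemma sdiff_left_cancel [simp]: "sdiff A (sdiff A B) = B"
  by (auto simp: sdiff_def)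

lemma sdiff_empty [simp]: "sdiff A {} = A" "sdiff {} A = A"
  by (auto simp: sdiff_def)

lemma sdiff_self [simp]: "sdiff A A = {}"
  by (auto simp: sdiff_def)

lemma bij_sdiff: "bij (sdiff A)"
  by (rule o_bij[of "sdiff A"]) (auto simp: fun_eq_iff)

text \<open>Elements of \<open>A \<inter> B\<close> occur in both products and drop out because
  \<open>f x * f x = 1\<close>. Such an \<open>f\<close> thus induces a character of the group of
  finite sets under \<open>sdiff\<close>.\<close>

lemma prod_sdiff:
  fixes f :: "'a \<Rightarrow> real"
  assumes "finite A" "finite B" "\<And>x. f x * f x = 1"
  shows "prod f (sdiff A B) = prod f A * prod f B"
proof -
  have "prod f A = prod f (A - B) * prod f (A \<inter> B)"
    using prod.Int_Diff[of A f B] assms by (simp add: mult.commute)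
  moreover have "prod f B = prod f (B - A) * prod f (A \<inter> B)"
    using prod.Int_Diff[of B f A] assms by (simp add: mult.commute Int_commute)
  moreover have "prod f (A \<inter> B) * prod f (A \<inter> B) = 1"
    using assms(3) by (simp flip: prod.distrib)
  moreover have "prod f (sdiff A B) = prod f (A - B) * prod f (B - A)"
    unfolding sdiff_def by (rule prod.union_disjoint) (use assms in auto)
  ultimately show ?thesis
    by (metis (no_types, lifting) mult.assoc mult.commute mult_1)
qed

text \<open>A pair \<open>b < a\<close> is a transposition needed to sort the product of the two
  basis elements, a common index is a generator with square -1. Both cost a factor -1, so the two
  counts merge into the condition \<open>b \<le> a\<close>, and in product form the sign is visibly
  multiplicative.\<close>

lemma csign_eq_prod:
  "csign A B = (\<Prod>a\<in>A. \<Prod>b\<in>B. if b \<le> a then - 1 else 1)"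
proof -
  let ?R = "{p \<in> A \<times> B. snd p \<le> fst p}"
  have split: "?R = {(a, b). a \<in> A \<and> b \<in> B \<and> b < a} \<union> (\<lambda>a. (a, a)) ` (A \<inter> B)"
    by (auto simp: image_iff)
  have "card ?R = card {(a, b). a \<in> A \<and> b \<in> B \<and> b < a} + card ((\<lambda>a. (a, a)) ` (A \<inter> B))"
    unfolding split by (rule card_Un_disjoint) auto
  also have "card ((\<lambda>a. (a, a)) ` (A \<inter> B)) = card (A \<inter> B)"
    by (rule card_image) (auto simp: inj_on_def)
  finally have c: "csign A B = (- 1) ^ card ?R"
    by (simp add: csign_def)
  have "(\<Prod>a\<in>A. \<Prod>b\<in>B. if b \<le> a then - 1 else 1 :: real)
      = (\<Prod>p\<in>A \<times> B. if snd p \<le> fst p then - 1 else 1)"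
    by (simp add: prod.cartesian_product case_prod_beta)
  also have "\<dots> = (- 1) ^ card ?R"
    by (simp add: prod.If_cases Collect_conj_eq)
  finally show ?thesis using c by simp
qed

lemma csign_square: "csign A B * csign A B = 1"
  by (simp add: csign_def flip: power_mult_distrib)

text \<open>Together with the version for the right argument this makes \<open>csign\<close> a
  bicharacter for \<open>sdiff\<close>; with \<open>csign_square\<close>, associativity rests on
  it.\<close>

lemma csign_sdiff_left: "csign (sdiff A B) C = csign A C * csign B C"
  unfolding csign_eq_prod by (rule prod_sdiff) (auto simp flip: prod.distrib intro!: prod.neutral)

lemma csign_sdiff_right: "csign A (sdiff B C) = csign A B * csign A C"
  unfolding csign_eq_prod prod.distrib[symmetric]
  by (intro prod.cong refl prod_sdiff) auto

lemma csign_empty [simp]: "csign {} A = 1" "csign A {} = 1"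
  by (simp_all add: csign_eq_prod)

lemma csign_singleton: "csign {i} {k} = (if k \<le> i then - 1 else 1)"
  by (simp add: csign_eq_prod)

text \<open>Comparing coefficients at \<open>D\<close> reduces associativity to a cocycle identity
  for the signs, which a bicharacter with values 1 and -1 satisfies.\<close>

lemma cmult_assoc: "(a \<odot> b) \<odot> c = a \<odot> (b \<odot> c)"
proof (rule vec_eq_iff[THEN iffD2, rule_format])
  fix D :: "'a set"
  have sgn: "csign A (sdiff A D) * csign B (sdiff B A)
      = csign B (sdiff B D) * csign (sdiff B A) (sdiff A D)" for A B
  proof -
    have "csign B (sdiff B D) * csign (sdiff B A) (sdiff A D)
      = (csign B B * csign B D) * ((csign B A * csign B D) * csign A (sdiff A D))"
      by (simp only: csign_sdiff_left csign_sdiff_right mult_ac)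
    also have "\<dots> = (csign B D * csign B D) * (csign A (sdiff A D) * (csign B B * csign B A))"
      by (simp only: mult_ac)
    also have "\<dots> = csign A (sdiff A D) * csign B (sdiff B A)"
      by (simp add: csign_square csign_sdiff_right mult_ac)
    finally show ?thesis by simp
  qed
  have "((a \<odot> b) \<odot> c) $ D = (\<Sum>A\<in>UNIV. \<Sum>B\<in>UNIV.
      csign A (sdiff A D) * csign B (sdiff B A) * a $ B * b $ sdiff B A * c $ sdiff A D)"
    by (simp add: cmult_def sum_distrib_left sum_distrib_right mult_ac)
  also have "\<dots> = (\<Sum>B\<in>UNIV. \<Sum>A\<in>UNIV.
      csign B (sdiff B D) * csign (sdiff B A) (sdiff A D) * a $ B * b $ sdiff B A * c $ sdiff A D)"
    by (subst sum.swap) (simp only: sgn)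
  \<comment> \<open>Substitution \<open>E = sdiff B A\<close>, a bijection in \<open>A\<close> for
    fixed \<open>B\<close>.\<close>
  also have "\<dots> = (\<Sum>B\<in>UNIV. \<Sum>E\<in>UNIV.
      csign B (sdiff B D) * csign E (sdiff E (sdiff B D)) * a $ B * b $ E * c $ sdiff E (sdiff B D))"
  proof (rule sum.cong[OF refl])
    fix B :: "'a set"
    have eq: "sdiff (sdiff B A) (sdiff B D) = sdiff A D" for A
      by (metis sdiff_assoc sdiff_commute sdiff_left_cancel)
    show "(\<Sum>A\<in>UNIV. csign B (sdiff B D) * csign (sdiff B A) (sdiff A D) * a $ B * b $ sdiff B A * c $ sdiff A D)
      = (\<Sum>E\<in>UNIV. csign B (sdiff B D) * csign E (sdiff E (sdiff B D)) * a $ B * b $ E * c $ sdiff E (sdiff B D))"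
      using sum.reindex_bij_betw[OF bij_sdiff[of B], where g = "\<lambda>E. csign B (sdiff B D) * csign E (sdiff E (sdiff B D)) * a $ B * b $ E * c $ sdiff E (sdiff B D)"]
      by (simp add: eq)
  qed
  also have "\<dots> = (a \<odot> (b \<odot> c)) $ D"
    by (simp add: cmult_def sum_distrib_left mult_ac)
  finally show "((a \<odot> b) \<odot> c) $ D = (a \<odot> (b \<odot> c)) $ D" .
qed

lemma bilinear_cmult: "bilinear (\<odot>)"
  unfolding bilinear_def
  by (auto intro!: linearI simp: cmult_def vec_eq_iff algebra_simps sum.distrib sum_distrib_left)

interpretation cmult: bounded_bilinear "(\<odot>)"
  using bilinear_cmult by (simp add: bilinear_conv_bounded_bilinear)

definition clif_one :: "'n::{finite,linorder} clif" where
  "clif_one = axis {} 1"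

lemma clif_one_cmult [simp]: "clif_one \<odot> a = a"
proof -
  have "(\<Sum>A\<in>UNIV. csign A (sdiff A C) * clif_one $ A * a $ sdiff A C) = a $ C" for C
    by (subst sum.remove[of _ "{}"]) (auto simp: clif_one_def axis_def)
  then show ?thesis by (simp add: cmult_def vec_eq_iff)
qed

lemma cmult_clif_one [simp]: "a \<odot> clif_one = a"
proof -
  have *: "sdiff A C = {} \<longleftrightarrow> A = C" for A C :: "'a set"
    by (auto simp: sdiff_def)
  have "(\<Sum>A\<in>UNIV. csign A (sdiff A C) * a $ A * clif_one $ sdiff A C) = a $ C" for C
    by (subst sum.remove[of _ C]) (auto simp: clif_one_def axis_def *)
  then show ?thesis by (simp add: cmult_def vec_eq_iff)
qed

lemma axis_cmult_axis: "axis A 1 \<odot> axis B 1 = csign A B *\<^sub>R axis (sdiff A B) 1"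
proof -
  have *: "sdiff A C = B \<longleftrightarrow> C = sdiff A B" for C by auto
  have "(\<Sum>D\<in>UNIV. csign D (sdiff D C) * axis A 1 $ D * axis B 1 $ sdiff D C)
      = csign A B * (axis (sdiff A B) 1 $ C)" for C
    by (subst sum.remove[of _ A]) (auto simp: axis_def *)
  then show ?thesis by (simp add: cmult_def vec_eq_iff)
qed

section \<open>Imaginary units among the paravectors\<close>

lemma linear_para: "linear (\<lambda>j. para (0, j))"
  by (rule linearI) (auto simp: para_def vec_eq_iff)

lemma para_minus: "para (0, - j) = - para (0, j)"
  by (rule linear_neg[OF linear_para])

lemma para_zero [simp]: "para (0, 0) = 0"
  by (rule linear_0[OF linear_para])

lemma para_eq_sum: "para (0, j) = (\<Sum>i\<in>UNIV. (j $ i) *\<^sub>R axis {i} 1)"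
proof (rule vec_eq_iff[THEN iffD2, rule_format])
  fix A :: "'a set"
  show "para (0, j) $ A = (\<Sum>i\<in>UNIV. (j $ i) *\<^sub>R axis {i} 1) $ A"
  proof (cases "\<exists>k. A = {k}")
    case True
    then obtain k where A: "A = {k}" by blast
    have "(\<Sum>i\<in>UNIV. (j $ i) *\<^sub>R axis {i} (1::real)) $ {k} = j $ k"
      unfolding sum_component by (subst sum.remove[of _ k]) (auto simp: axis_def)
    with A show ?thesis by (simp add: para_def)
  next
    case False
    then have "card A \<noteq> 1" by (auto simp: card_1_singleton_iff)
    moreover have "axis {i} (1::real) $ A = 0" for i using False by (auto simp: axis_def)
    ultimately show ?thesis by (simp add: para_def)
  qed
qed

text \<open>Symmetrizing the double sum over the generators leaves only anticommutators, and these
  vanish off the diagonal.\<close>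

lemma para_square: "para (0, j) \<odot> para (0, j) = - (norm j)\<^sup>2 *\<^sub>R clif_one"
proof -
  let ?e = "\<lambda>i :: 'a. axis {i} 1 :: 'a clif"
  have anti: "?e i \<odot> ?e k + ?e k \<odot> ?e i = (if k = i then - 2 *\<^sub>R clif_one else 0)" for i k
    by (auto simp: axis_cmult_axis csign_singleton sdiff_commute[of "{i}"] clif_one_def
        simp flip: scaleR_add_left)
  have J: "para (0, j) \<odot> para (0, j) = (\<Sum>i\<in>UNIV. \<Sum>k\<in>UNIV. (j $ i * j $ k) *\<^sub>R (?e i \<odot> ?e k))"
    unfolding para_eq_sum cmult.sum_left
    by (simp add: cmult.sum_right cmult.scaleR_left cmult.scaleR_right scaleR_sum_right mult.commute)
  also have "\<dots> = (\<Sum>k\<in>UNIV. \<Sum>i\<in>UNIV. (j $ i * j $ k) *\<^sub>R (?e i \<odot> ?e k))"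
    by (rule sum.swap)
  finally have J': "para (0, j) \<odot> para (0, j) = (\<Sum>i\<in>UNIV. \<Sum>k\<in>UNIV. (j $ i * j $ k) *\<^sub>R (?e k \<odot> ?e i))"
    by (simp only: mult.commute)
  have "2 *\<^sub>R (para (0, j) \<odot> para (0, j))
      = (\<Sum>i\<in>UNIV. \<Sum>k\<in>UNIV. (j $ i * j $ k) *\<^sub>R (?e i \<odot> ?e k + ?e k \<odot> ?e i))"
    by (subst scaleR_2, subst J, subst J') (simp add: sum.distrib scaleR_add_right)
  also have "\<dots> = (\<Sum>i\<in>UNIV. - 2 *\<^sub>R ((j $ i * j $ i) *\<^sub>R clif_one))"
    by (simp add: anti if_distrib[of "scaleR _"] sum.delta mult_ac cong: if_cong)
  also have "\<dots> = 2 *\<^sub>R (- (norm j)\<^sup>2 *\<^sub>R clif_one)"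
  proof -
    have "(norm j)\<^sup>2 = (\<Sum>i\<in>UNIV. j $ i * j $ i)"
      by (simp add: norm_vec_def L2_set_def sum_nonneg power2_eq_square)
    then show ?thesis
      by (simp add: scaleR_sum_left scaleR_sum_right sum_negf)
  qed
  finally show ?thesis unfolding scaleR_cancel_left by simp
qed

lemma para_para_cmult: "norm j = 1 \<Longrightarrow> para (0, j) \<odot> (para (0, j) \<odot> b) = - b"
  by (simp add: cmult_assoc[symmetric] para_square cmult.minus_left)

section \<open>Stem functions\<close>

definition vre :: "complex ^ 'm \<Rightarrow> real ^ 'm" where
  "vre c = (\<chi> A. Re (c $ A))"

definition vim :: "complex ^ 'm \<Rightarrow> real ^ 'm" where
  "vim c = (\<chi> A. Im (c $ A))"

definition vcomplex :: "real ^ 'm \<Rightarrow> real ^ 'm \<Rightarrow> complex ^ 'm" where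
  "vcomplex a b = (\<chi> A. Complex (a $ A) (b $ A))"

lemma vre_nth [simp]: "vre c $ A = Re (c $ A)"
  by (simp add: vre_def)

lemma vim_nth [simp]: "vim c $ A = Im (c $ A)"
  by (simp add: vim_def)

lemma vcomplex_nth [simp]: "vcomplex a b $ A = Complex (a $ A) (b $ A)"
  by (simp add: vcomplex_def)

lemma vre_vcomplex [simp]: "vre (vcomplex a b) = a"
  and vim_vcomplex [simp]: "vim (vcomplex a b) = b"
  by (simp_all add: vec_eq_iff)

lemma vcomplex_vre_vim [simp]: "vcomplex (vre c) (vim c) = c"
  by (simp add: vec_eq_iff)

lemma bounded_linear_vre: "bounded_linear (vre :: complex ^ 'm \<Rightarrow> _)"
  by (intro linear_conv_bounded_linear[THEN iffD1] linearI) (auto simp: vec_eq_iff)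

lemma bounded_linear_vim: "bounded_linear (vim :: complex ^ 'm \<Rightarrow> _)"
  by (intro linear_conv_bounded_linear[THEN iffD1] linearI) (auto simp: vec_eq_iff)

lemma vre_add: "vre (a + b) = vre a + vre b" and vim_add: "vim (a + b) = vim a + vim b"
  and vre_scaleR: "vre (r *\<^sub>R a) = r *\<^sub>R vre a" and vim_scaleR: "vim (r *\<^sub>R a) = r *\<^sub>R vim a"
  by (simp_all add: vec_eq_iff)

lemma norm_vcomplex_le:
  "\<exists>K>0. \<forall>a b :: real ^ 'm. norm (vcomplex a b) \<le> K * (norm a + norm b)"
proof -
  have lin: "linear (\<lambda>p. vcomplex (fst p) (snd p :: real ^ 'm))"
    by (intro linearI) (auto simp: vec_eq_iff complex_eq_iff)
  obtain K where K: "K > 0" "\<And>p. norm (vcomplex (fst p) (snd p :: real ^ 'm)) \<le> K * norm p"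
    by (rule linear_bounded_pos[OF lin]) blast
  have "norm (vcomplex a b) \<le> K * (norm a + norm b)" for a b :: "real ^ 'm"
    using order_trans[OF K(2)[of "(a, b)"] mult_left_mono[OF norm_Pair_le[of a b]]] K(1) by simp
  with K(1) show ?thesis by blast
qed

text \<open>The product of the complexification, with central imaginary unit; its two parts are the
  two brackets of the star product formula.\<close>

definition cxmult :: "complex ^ ('n::{finite,linorder} set) \<Rightarrow> complex ^ ('n set) \<Rightarrow> complex ^ ('n set)"
  where "cxmult a b = vcomplex (vre a \<odot> vre b - vim a \<odot> vim b) (vim a \<odot> vre b + vre a \<odot> vim b)"

text \<open>The structure constants are those of \<open>cmult\<close>, now with complex
  coefficients. The product is therefore complex bilinear and preserves holomorphy of the
  coordinates.\<close>

lemma cxmult_nth: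
  "cxmult a b $ C = (\<Sum>A\<in>UNIV. of_real (csign A (sdiff A C)) * a $ A * b $ sdiff A C)"
  unfolding complex_eq_iff cxmult_def cmult_def
  by (auto simp flip: sum.distrib sum_subtractf intro!: sum.cong)

lemma bounded_bilinear_cxmult: "bounded_bilinear cxmult"
proof -
  have "bilinear cxmult"
    unfolding bilinear_def
    by (auto intro!: linearI simp: cxmult_def vre_add vim_add vre_scaleR vim_scaleR cmult.add_left
        cmult.add_right cmult.scaleR_left cmult.scaleR_right vec_eq_iff complex_eq_iff algebra_simps)
  then show ?thesis by (simp add: bilinear_conv_bounded_bilinear)
qed

interpretation cxmult: bounded_bilinear cxmult
  by (rule bounded_bilinear_cxmult)

text \<open>Replaces the central imaginary unit by left multiplication with
  \<open>para (0, j)\<close>, whose square is -1 when \<open>norm j = 1\<close>.\<close>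

definition slice_val :: "(real, 'n::{finite,linorder}) vec \<Rightarrow> complex ^ ('n set) \<Rightarrow> 'n clif" where
  "slice_val j c = vre c + para (0, j) \<odot> vim c"

lemma linear_slice_val: "linear (slice_val j)"
  by (rule linearI) (simp_all add: slice_val_def vre_add vim_add vre_scaleR vim_scaleR
      cmult.add_right cmult.scaleR_right scaleR_add_right)

lemma bounded_linear_slice_val: "bounded_linear (slice_val j)"
  using linear_slice_val linear_conv_bounded_linear by blast

lemma norm_slice_val_le:
  "\<exists>K>0. \<forall>j (c :: complex ^ ('n::{finite,linorder} set)). norm j \<le> 1 \<longrightarrow> norm (slice_val j c) \<le> K * norm c"
proof -
  obtain K1 where K1: "K1 \<ge> 0" "\<And>a b. norm (a \<odot> b :: 'n clif) \<le> norm a * norm b * K1"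
    using cmult.nonneg_bounded by blast
  obtain K2 where K2: "K2 > 0" "\<And>j :: (real, 'n) vec. norm (para (0, j)) \<le> K2 * norm j"
    by (rule linear_bounded_pos[OF linear_para]) blast
  obtain K3 where K3: "K3 > 0" "\<And>c :: complex ^ ('n set). norm (vre c) \<le> norm c * K3"
    using bounded_linear.pos_bounded[OF bounded_linear_vre] by blast
  obtain K4 where K4: "K4 > 0" "\<And>c :: complex ^ ('n set). norm (vim c) \<le> norm c * K4"
    using bounded_linear.pos_bounded[OF bounded_linear_vim] by blast
  have "norm (slice_val j c) \<le> (K3 + K2 * K4 * K1) * norm c" if "norm j \<le> 1"
    for j and c :: "complex ^ ('n set)"
  proof -
    have "norm (para (0, j)) \<le> K2"
      using order_trans[OF K2(2)[of j] mult_left_le] that K2(1) by simp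
    then have "norm (para (0, j)) * norm (vim c) * K1 \<le> K2 * (norm c * K4) * K1"
      using K4(2)[of c] K1(1) K2(1) K4(1) by (intro mult_right_mono mult_mono) auto
    then show ?thesis
      using norm_triangle_ineq[of "vre c" "para (0, j) \<odot> vim c"] K3(2)[of c] K1(2)[of "para (0, j)" "vim c"]
      by (simp add: slice_val_def algebra_simps)
  qed
  moreover have "K3 + K2 * K4 * K1 > 0"
    using K1(1) K2(1) K3(1) K4(1) by (simp add: add_pos_nonneg)
  ultimately show ?thesis by blast
qed

section \<open>Stem functions, their derivatives and the induced slice functions\<close>

definition stem :: "(complex \<Rightarrow> complex ^ 'm) \<Rightarrow> bool" where
  "stem H \<longleftrightarrow> (\<forall>A. (\<lambda>z. H z $ A) holomorphic_on UNIV) \<and> (\<forall>z A. H (cnj z) $ A = cnj (H z $ A))"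

definition stem_deriv :: "(complex \<Rightarrow> complex ^ 'm) \<Rightarrow> complex \<Rightarrow> complex ^ 'm" where
  "stem_deriv H z = (\<chi> A. deriv (\<lambda>w. H w $ A) z)"

text \<open>At a real point \<open>sgn 0 = 0\<close> discards the imaginary part; nothing is lost
  for a stem function, whose imaginary part vanishes on the real axis.\<close>

definition slice_ext :: "(complex \<Rightarrow> complex ^ ('n::{finite,linorder} set)) \<Rightarrow> real \<times> (real, 'n) vec \<Rightarrow> 'n clif"
  where "slice_ext H x = slice_val (sgn (snd x)) (H (Complex (fst x) (norm (snd x))))"

lemma stem_holomorphic: "stem H \<Longrightarrow> (\<lambda>z. H z $ A) holomorphic_on S"
  unfolding stem_def using holomorphic_on_subset by blast

lemma stem_cnj: "stem H \<Longrightarrow> H (cnj z) $ A = cnj (H z $ A)"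
  by (simp add: stem_def)

lemma stem_continuous: "stem H \<Longrightarrow> continuous_on S H"
  using continuous_on_vec_lambda[of S "\<lambda>A z. H z $ A"]
  by (simp add: holomorphic_on_imp_continuous_on[OF stem_holomorphic])

lemma stem_has_field_derivative:
  "stem H \<Longrightarrow> ((\<lambda>z. H z $ A) has_field_derivative stem_deriv H z $ A) (at z)"
  using holomorphic_derivI[OF stem_holomorphic open_UNIV] by (simp add: stem_deriv_def)

lemma vec_has_derivativeI:
  fixes f :: "'a::real_normed_vector \<Rightarrow> 'b::euclidean_space ^ 'm"
  assumes "\<And>A. ((\<lambda>x. f x $ A) has_derivative (\<lambda>h. f' h $ A)) (at x)"
  shows "(f has_derivative f') (at x)"
  unfolding has_derivative_componentwise_within[of f]
proof
  fix b :: "'b ^ 'm" assume "b \<in> Basis"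
  then obtain A u where b: "b = axis A u" by (auto simp: Basis_vec_def)
  have "((\<lambda>x. f x $ A \<bullet> u) has_derivative (\<lambda>h. f' h $ A \<bullet> u)) (at x)"
    by (intro has_derivative_inner_left assms)
  then show "((\<lambda>x. f x \<bullet> b) has_derivative (\<lambda>h. f' h \<bullet> b)) (at x)"
    by (simp add: b inner_axis)
qed

lemma stem_has_derivative:
  assumes "stem H"
  shows "(H has_derivative (\<lambda>h. \<chi> A. stem_deriv H z $ A * h)) (at z)"
  using stem_has_field_derivative[OF assms, of _ z]
  by (intro vec_has_derivativeI) (simp add: has_field_derivative_def)

lemma stem_stem_deriv:
  assumes "stem H" shows "stem (stem_deriv H)"
  unfolding stem_def
proof (intro conjI allI)
  show "(\<lambda>z. stem_deriv H z $ A) holomorphic_on UNIV" for A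
    using holomorphic_deriv[OF stem_holomorphic[OF assms, of A UNIV] open_UNIV] by (simp add: stem_deriv_def)
  show "stem_deriv H (cnj z) $ A = cnj (stem_deriv H z $ A)" for z A
  proof -
    have "((cnj \<circ> (\<lambda>z. H z $ A) \<circ> cnj) has_field_derivative cnj (stem_deriv H z $ A)) (at (cnj z))"
      using stem_has_field_derivative[OF assms, of A z] by (simp add: has_field_derivative_cnj_cnj)
    moreover have "cnj \<circ> (\<lambda>z. H z $ A) \<circ> cnj = (\<lambda>z. H z $ A)"
      using stem_cnj[OF assms] by (simp add: fun_eq_iff)
    ultimately show ?thesis
      using stem_has_field_derivative[OF assms, of A "cnj z"] DERIV_unique by metis
  qed
qed

lemma stem_iter_deriv: "stem H \<Longrightarrow> stem ((stem_deriv ^^ l) H)"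
  by (induction l) (auto intro: stem_stem_deriv)

lemma iter_stem_deriv_nth: "(stem_deriv ^^ l) H z $ A = (deriv ^^ l) (\<lambda>w. H w $ A) z"
proof (induction l arbitrary: z)
  case (Suc l)
  then have "(\<lambda>w. (stem_deriv ^^ l) H w $ A) = (deriv ^^ l) (\<lambda>w. H w $ A)" by auto
  then show ?case by (simp add: stem_deriv_def[of "(stem_deriv ^^ l) H"])
qed simp

lemma stem_vim_0: "stem H \<Longrightarrow> Im z = 0 \<Longrightarrow> vim (H z) = 0"
proof -
  assume "stem H" "Im z = 0"
  then have "cnj z = z" by (simp add: complex_eq_iff)
  then have "cnj (H z $ A) = H z $ A" for A
    using stem_cnj[OF \<open>stem H\<close>, of z A] by simp
  then show ?thesis by (simp add: vec_eq_iff complex_eq_iff)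
qed

text \<open>For \<open>v < 0\<close> the definition of \<open>slice_ext\<close> sees the unit
  \<open>- j\<close> and the height \<open>- v\<close>. Conjugation symmetry flips the imaginary
  part at the same time, and the two signs cancel.\<close>

lemma ext_slice:
  assumes "stem H" "norm j = 1"
  shows "slice_ext H (u, v *\<^sub>R j) = vre (H (Complex u v)) + para (0, j) \<odot> vim (H (Complex u v))"
proof (cases v "0 :: real" rule: linorder_cases)
  case less
  have "cnj (Complex u v) = Complex u (- v)" by (simp add: complex_eq_iff)
  then have "vre (H (Complex u (- v))) = vre (H (Complex u v))"
    "vim (H (Complex u (- v))) = - vim (H (Complex u v))"
    using stem_cnj[OF assms(1), of "Complex u v"] by (simp_all add: vec_eq_iff)
  moreover have "sgn (v *\<^sub>R j) = - j" "norm (v *\<^sub>R j) = - v"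
    using less assms(2) by (simp_all add: sgn_div_norm)
  ultimately show ?thesis by (simp add: slice_ext_def slice_val_def para_minus cmult.minus_left cmult.minus_right)
next
  case equal
  then show ?thesis using stem_vim_0[OF assms(1)] by (simp add: slice_ext_def slice_val_def cmult.zero_right)
next
  case greater
  then have "sgn (v *\<^sub>R j) = j" "norm (v *\<^sub>R j) = v"
    using assms(2) by (simp_all add: sgn_div_norm)
  then show ?thesis by (simp add: slice_ext_def slice_val_def)
qed

text \<open>A general real-linear \<open>L\<close> serves both components, with \<open>vre\<close>
  and \<open>vim\<close>. Continuity of the derivative in operator norm is checked direction by
  direction, as the domain has finite dimension.\<close>

lemma C1_with_stem:
  assumes H: "stem H" and L: "bounded_linear (L :: complex ^ 'm \<Rightarrow> real ^ 'm)"
  defines "dH \<equiv> \<lambda>p q. L (\<chi> A. stem_deriv H (Complex (fst p) (snd p)) $ A * Complex (fst q) (snd q))"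
  shows "C1_with (\<lambda>p. L (H (Complex (fst p) (snd p)))) (\<lambda>p. Blinfun (dH p))"
    and "blinfun_apply (Blinfun (dH p)) = dH p"
proof -
  have C: "bounded_linear (\<lambda>p. Complex (fst p) (snd p))"
    by (intro linear_conv_bounded_linear[THEN iffD1] linearI) (auto simp: complex_eq_iff)
  have der: "((\<lambda>p. L (H (Complex (fst p) (snd p)))) has_derivative dH p) (at p)" for p
  proof -
    have "((\<lambda>p. H (Complex (fst p) (snd p))) has_derivative
        (\<lambda>q. \<chi> A. stem_deriv H (Complex (fst p) (snd p)) $ A * Complex (fst q) (snd q))) (at p)"
      using has_derivative_compose[OF bounded_linear_imp_has_derivative[OF C] stem_has_derivative[OF H]]
      by simp
    from bounded_linear.has_derivative[OF L this] show ?thesis by (simp add: dH_def)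
  qed
  show app: "blinfun_apply (Blinfun (dH p)) = dH p" for p
    using bounded_linear_Blinfun_apply[OF has_derivative_bounded_linear[OF der]] .
  have "continuous_on UNIV (\<lambda>p. dH p q)" for q
  proof -
    have "continuous_on UNIV (\<lambda>p :: real \<times> real. stem_deriv H (Complex (fst p) (snd p)))"
      by (rule continuous_on_compose2[OF stem_continuous[OF stem_stem_deriv[OF H], of UNIV]
          bounded_linear.continuous_on[OF C continuous_on_id]]) simp
    then show ?thesis unfolding dH_def
      by (intro bounded_linear.continuous_on[OF L] continuous_intros)
  qed
  then have "continuous_on UNIV (\<lambda>p. Blinfun (dH p))"
    by (intro continuous_on_blinfun_componentwise) (simp add: app)
  with der show "C1_with (\<lambda>p. L (H (Complex (fst p) (snd p)))) (\<lambda>p. Blinfun (dH p))"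
    by (simp add: C1_with_def app)
qed

lemma slice_decomp_ext:
  assumes H: "stem H"
  shows "slice_decomp (slice_ext H) (\<lambda>p. vre (H (Complex (fst p) (snd p)))) (\<lambda>p. vim (H (Complex (fst p) (snd p))))"
proof -
  have "vre (H (Complex u (- v))) = vre (H (Complex u v))"
    "vim (H (Complex u (- v))) = - vim (H (Complex u v))" for u v
  proof -
    have "cnj (Complex u v) = Complex u (- v)" by (simp add: complex_eq_iff)
    then show "vre (H (Complex u (- v))) = vre (H (Complex u v))"
      "vim (H (Complex u (- v))) = - vim (H (Complex u v))"
      using stem_cnj[OF H, of "Complex u v"] by (simp_all add: vec_eq_iff)
  qed
  moreover note C1_with_stem[OF H bounded_linear_vre] C1_with_stem[OF H bounded_linear_vim]
  ultimately show ?thesis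
    unfolding slice_decomp_def
    by (intro conjI exI allI impI) (assumption | simp add: ext_slice[OF H] vec_eq_iff)+
qed

lemma slice_monogenic_ext: "stem H \<Longrightarrow> slice_monogenic (slice_ext H)"
  using slice_decomp_ext unfolding slice_monogenic_def by blast

section \<open>Slice monogenic functions and their stem functions determine each other\<close>

lemma exists_unit: "\<exists>j :: real ^ 'n. norm j = 1"
  using vector_choose_size[of 1] by auto

text \<open>The representation formula: two conjugate points of a single slice separate the even
  part from the odd one. It makes the choice operator in \<open>star\<close> harmless and later
  transfers growth bounds to stem functions.\<close>

lemma slice_decomp_unique:
  assumes f: "slice_decomp f f0 f1" and j: "norm j = 1"
  shows "f0 (u, v) = (1/2) *\<^sub>R (f (u, v *\<^sub>R j) + f (u, (- v) *\<^sub>R j))"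
    and "f1 (u, v) = (1/2) *\<^sub>R (para (0, j) \<odot> (f (u, (- v) *\<^sub>R j) - f (u, v *\<^sub>R j)))"
proof -
  have p: "f (u, v *\<^sub>R j) = f0 (u, v) + para (0, j) \<odot> f1 (u, v)" for v
    using f j by (simp add: slice_decomp_def)
  have e: "f0 (u, - v) = f0 (u, v)" "f1 (u, - v) = - f1 (u, v)"
    using f by (simp_all add: slice_decomp_def)
  show "f0 (u, v) = (1/2) *\<^sub>R (f (u, v *\<^sub>R j) + f (u, (- v) *\<^sub>R j))"
    unfolding p e by (simp add: cmult.minus_right flip: scaleR_2)
  have "f (u, (- v) *\<^sub>R j) - f (u, v *\<^sub>R j) = - 2 *\<^sub>R (para (0, j) \<odot> f1 (u, v))"
    unfolding p e by (simp add: cmult.minus_right flip: scaleR_2)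
  then show "f1 (u, v) = (1/2) *\<^sub>R (para (0, j) \<odot> (f (u, (- v) *\<^sub>R j) - f (u, v *\<^sub>R j)))"
    by (simp only: cmult.scaleR_right para_para_cmult[OF j]) simp
qed

lemma some_slice_decomp:
  assumes "slice_decomp f f0 f1"
  shows "(SOME p. slice_decomp f (fst p) (snd p)) = (f0, f1)"
proof (rule some_equality)
  fix p assume p: "slice_decomp f (fst p) (snd p)"
  obtain j :: "(real, 'a) vec" where j: "norm j = 1" using exists_unit by blast
  have "fst p (u, v) = f0 (u, v)" "snd p (u, v) = f1 (u, v)" for u v
    using slice_decomp_unique[OF p j] slice_decomp_unique[OF assms j] by metis+
  then show "p = (f0, f1)" by (auto simp: prod_eq_iff fun_eq_iff)
qed (use assms in simp)

text \<open>In each coordinate the two first-order equations are the Cauchy-Riemann equations; the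
  complex derivative is read off in the direction \<open>(1, 0)\<close>.\<close>

lemma slice_decomp_imp_stem:
  assumes f: "slice_decomp f f0 f1"
  defines "H \<equiv> \<lambda>z. vcomplex (f0 (Re z, Im z)) (f1 (Re z, Im z))"
  shows "stem H" and "f = slice_ext H"
proof -
  from f obtain D0 D1 where D: "C1_with f0 D0" "C1_with f1 D1"
      "\<And>p. blinfun_apply (D0 p) (1, 0) = blinfun_apply (D1 p) (0, 1)"
      "\<And>p. blinfun_apply (D0 p) (0, 1) = - blinfun_apply (D1 p) (1, 0)"
    unfolding slice_decomp_def by blast
  show stem: "stem H"
    unfolding stem_def
  proof (intro conjI allI)
    fix A
    have "((\<lambda>z. H z $ A) has_field_derivative
        Complex (D0 (Re z, Im z) (1, 0) $ A) (D1 (Re z, Im z) (1, 0) $ A)) (at z)" for z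
    proof -
      let ?p = "(Re z, Im z)"
      have RI: "((\<lambda>z. (Re z, Im z)) has_derivative (\<lambda>h. (Re h, Im h))) (at z)"
        by (intro derivative_intros)
      have d0: "((\<lambda>z. f0 (Re z, Im z) $ A) has_derivative (\<lambda>h. D0 ?p (Re h, Im h) $ A)) (at z)"
        using has_derivative_compose[OF RI, of f0 "D0 ?p"] D(1)
        by (auto simp: C1_with_def intro!: bounded_linear.has_derivative[OF bounded_linear_vec_nth])
      have d1: "((\<lambda>z. f1 (Re z, Im z) $ A) has_derivative (\<lambda>h. D1 ?p (Re h, Im h) $ A)) (at z)"
        using has_derivative_compose[OF RI, of f1 "D1 ?p"] D(2)
        by (auto simp: C1_with_def intro!: bounded_linear.has_derivative[OF bounded_linear_vec_nth])
      have "((\<lambda>z. complex_of_real (f0 (Re z, Im z) $ A) + \<i> * complex_of_real (f1 (Re z, Im z) $ A))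
          has_derivative (\<lambda>h. complex_of_real (D0 ?p (Re h, Im h) $ A) + \<i> * complex_of_real (D1 ?p (Re h, Im h) $ A))) (at z)"
        by (intro derivative_intros d0 d1)
      moreover have "complex_of_real (D0 ?p (Re h, Im h) $ A) + \<i> * complex_of_real (D1 ?p (Re h, Im h) $ A)
          = Complex (D0 ?p (1, 0) $ A) (D1 ?p (1, 0) $ A) * h" for h
      proof -
        have h: "(Re h, Im h) = Re h *\<^sub>R (1, 0) + Im h *\<^sub>R (0, 1)" by simp
        have "D0 ?p (Re h, Im h) = Re h *\<^sub>R D0 ?p (1, 0) - Im h *\<^sub>R D1 ?p (1, 0)"
          "D1 ?p (Re h, Im h) = Re h *\<^sub>R D1 ?p (1, 0) + Im h *\<^sub>R D0 ?p (1, 0)"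
          unfolding h blinfun.add_right blinfun.scaleR_right D(3,4) by simp_all
        then have "D0 ?p (Re h, Im h) $ A = Re h * D0 ?p (1, 0) $ A - Im h * D1 ?p (1, 0) $ A"
          "D1 ?p (Re h, Im h) $ A = Re h * D1 ?p (1, 0) $ A + Im h * D0 ?p (1, 0) $ A"
          by (simp_all)
        then show ?thesis by (simp add: complex_eq_iff algebra_simps)
      qed
      ultimately show ?thesis
        by (simp add: has_field_derivative_def H_def Complex_eq fun_eq_iff[symmetric])
    qed
    then show "(\<lambda>z. H z $ A) holomorphic_on UNIV"
      by (auto simp: holomorphic_on_def field_differentiable_def)
  next
    show "H (cnj z) $ A = cnj (H z $ A)" for z A
      using f by (simp add: slice_decomp_def H_def complex_eq_iff)
  qed
  show "f = slice_ext H"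
  proof
    fix x :: "real \<times> (real, 'a) vec"
    obtain u y where x: "x = (u, y)" by force
    obtain j where j: "norm j = 1" "y = norm y *\<^sub>R j"
    proof (cases "y = 0")
      case True
      then show ?thesis using that exists_unit by auto
    next
      case False
      then show ?thesis using that[of "sgn y"] by (simp add: norm_sgn sgn_div_norm)
    qed
    have "f (u, norm y *\<^sub>R j) = slice_ext H (u, norm y *\<^sub>R j)"
      using f ext_slice[OF stem j(1)] j(1) by (simp add: slice_decomp_def H_def)
    then show "f x = slice_ext H x" using x j(2) by simp
  qed
qed

lemma slice_monogenic_iff: "slice_monogenic f \<longleftrightarrow> (\<exists>H. stem H \<and> f = slice_ext H)"
  using slice_decomp_imp_stem slice_monogenic_ext unfolding slice_monogenic_def by blast

text \<open>At a real point \<open>star\<close> picks an arbitrary unit whereas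
  \<open>slice_ext\<close> uses 0. They agree because the imaginary parts of both factors vanish
  there.\<close>

lemma star_ext:
  assumes H: "stem H" and K: "stem K"
  shows "star (slice_ext H) (slice_ext K) = slice_ext (\<lambda>z. cxmult (H z) (K z))"
proof
  fix x :: "real \<times> (real, 'a) vec"
  show "star (slice_ext H) (slice_ext K) x = slice_ext (\<lambda>z. cxmult (H z) (K z)) x"
  proof (cases "snd x = 0")
    case True
    then show ?thesis
      by (simp add: star_def some_slice_decomp[OF slice_decomp_ext[OF H]] some_slice_decomp[OF slice_decomp_ext[OF K]]
          Let_def slice_ext_def slice_val_def cxmult_def stem_vim_0[OF H] stem_vim_0[OF K] cmult.zero_left cmult.zero_right)
  next
    case False
    then show ?thesis
      by (simp add: star_def some_slice_decomp[OF slice_decomp_ext[OF H]] some_slice_decomp[OF slice_decomp_ext[OF K]]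
          Let_def slice_ext_def slice_val_def cxmult_def)
  qed
qed

lemma stem_cxmult:
  assumes "stem H" "stem K" shows "stem (\<lambda>z. cxmult (H z) (K z))"
  using assms unfolding stem_def cxmult_nth by (auto intro!: holomorphic_intros)

text \<open>The slice derivative moves only the real part of the argument, and a complex derivative
  may be computed in the real direction.\<close>

lemma dx0_ext:
  assumes H: "stem H"
  shows "dx0 (slice_ext H) = slice_ext (stem_deriv H)"
proof
  fix x :: "real \<times> (real, 'a) vec"
  let ?v = "norm (snd x)"
  let ?d = "stem_deriv H (Complex (fst x) ?v)"
  have "((\<lambda>t. Complex t ?v) has_derivative (\<lambda>h. of_real h)) (at (fst x))"
    by (auto simp: Complex_eq intro!: derivative_eq_intros)
  from has_derivative_compose[OF this stem_has_derivative[OF H]]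
  have "((\<lambda>t. H (Complex t ?v)) has_derivative (\<lambda>h. \<chi> A. ?d $ A * of_real h)) (at (fst x))" .
  moreover have "(\<chi> A. ?d $ A * of_real h) = h *\<^sub>R ?d" for h :: real
    by (simp add: vec_eq_iff scaleR_conv_of_real[where 'a = complex])
  ultimately have "((\<lambda>t. H (Complex t ?v)) has_vector_derivative ?d) (at (fst x))"
    by (simp add: has_vector_derivative_def)
  from bounded_linear.has_vector_derivative[OF bounded_linear_slice_val[of "sgn (snd x)"] this]
  show "dx0 (slice_ext H) x = slice_ext (stem_deriv H) x"
    by (simp add: dx0_def slice_ext_def vector_derivative_at)
qed

lemma iter_dx0_ext: "stem H \<Longrightarrow> (dx0 ^^ l) (slice_ext H) = slice_ext ((stem_deriv ^^ l) H)"
  by (induction l) (simp_all add: dx0_ext stem_iter_deriv)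

section \<open>Comparison of growth between a function and its stem\<close>

lemma norm_prod_Complex: "norm (x :: real \<times> 'a::real_normed_vector) = norm (Complex (fst x) (norm (snd x)))"
  by (simp add: norm_prod_def complex_norm)

lemma norm_ext_le:
  "\<exists>K>0. \<forall>(H :: complex \<Rightarrow> complex ^ ('n::{finite,linorder} set)) x.
    norm (slice_ext H x) \<le> K * norm (H (Complex (fst x) (norm (snd x))))"
proof -
  have "norm (sgn y) \<le> 1" for y :: "(real, 'n) vec" by (simp add: norm_sgn)
  then show ?thesis using norm_slice_val_le[where 'n = 'n] unfolding slice_ext_def by meson
qed

text \<open>By the representation formula \<open>H z\<close> is a combination of values of
  \<open>slice_ext H\<close> at two points, both of norm \<open>norm z\<close>. A radial bound
  \<open>B\<close> therefore transfers, with a constant independent of \<open>B\<close>.\<close>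

lemma norm_stem_le:
  "\<exists>K>0. \<forall>(H :: complex \<Rightarrow> complex ^ ('n::{finite,linorder} set)) B z. stem H \<longrightarrow>
    (\<forall>x. norm (slice_ext H x) \<le> B (norm x)) \<longrightarrow> norm (H z) \<le> K * B (norm z)"
proof -
  obtain K1 where K1: "K1 > 0" "\<And>a b :: 'n clif. norm (vcomplex a b) \<le> K1 * (norm a + norm b)"
    using norm_vcomplex_le by blast
  obtain K2 where K2: "K2 > 0" "\<And>a b. norm (a \<odot> b :: 'n clif) \<le> norm a * norm b * K2"
    using cmult.pos_bounded by blast
  obtain j :: "(real, 'n) vec" where j: "norm j = 1" using exists_unit by blast
  let ?K = "K1 * (1 + norm (para (0, j)) * K2)"
  have "norm (H z) \<le> ?K * B (norm z)"
    if H: "stem H" and B: "\<And>x. norm (slice_ext H x) \<le> B (norm x)"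
    for H :: "complex \<Rightarrow> complex ^ ('n set)" and B z
  proof -
    let ?u = "Re z" and ?v = "Im z"
    let ?p = "slice_ext H (?u, ?v *\<^sub>R j)" and ?m = "slice_ext H (?u, (- ?v) *\<^sub>R j)"
    have n: "norm (?u, ?v *\<^sub>R j) = norm z" "norm (?u, (- ?v) *\<^sub>R j) = norm z"
      using j by (simp_all add: norm_prod_def cmod_def)
    then have b: "norm ?p \<le> B (norm z)" "norm ?m \<le> B (norm z)" using B by metis+
    note d = slice_decomp_unique[OF slice_decomp_ext[OF H] j, of ?u ?v]
    have re: "vre (H z) = (1/2) *\<^sub>R (?p + ?m)" and im: "vim (H z) = (1/2) *\<^sub>R (para (0, j) \<odot> (?m - ?p))"
      using d by simp_all
    have "norm (vre (H z)) \<le> B (norm z)"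
      unfolding re using b norm_triangle_ineq[of ?p ?m] by simp
    moreover have "norm (vim (H z)) \<le> norm (para (0, j)) * B (norm z) * K2"
    proof -
      have "norm (para (0, j) \<odot> (?m - ?p)) \<le> norm (para (0, j)) * norm (?m - ?p) * K2" by (rule K2(2))
      also have "\<dots> \<le> norm (para (0, j)) * (2 * B (norm z)) * K2"
        using b norm_triangle_ineq4[of ?m ?p] K2(1) by (intro mult_right_mono mult_left_mono) auto
      finally show ?thesis unfolding im by simp
    qed
    ultimately have "norm (vre (H z)) + norm (vim (H z)) \<le> (1 + norm (para (0, j)) * K2) * B (norm z)"
      by (simp add: algebra_simps)
    then have "K1 * (norm (vre (H z)) + norm (vim (H z))) \<le> ?K * B (norm z)"
      using K1(1) by (simp add: mult_le_cancel_left_pos mult.assoc)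
    then show ?thesis using K1(2)[of "vre (H z)" "vim (H z)"] by simp
  qed
  moreover have "?K > 0" using K1 K2 by (simp add: add_pos_nonneg)
  ultimately show ?thesis by blast
qed

section \<open>Proximate orders\<close>

definition wt :: "(real \<Rightarrow> real) \<Rightarrow> real \<Rightarrow> real" where
  "wt \<rho> r = r powr \<rho> r"

lemma wt_nonneg [simp]: "wt \<rho> r \<ge> 0"
  by (simp add: wt_def)

lemma wt_pos: "r > 0 \<Longrightarrow> wt \<rho> r > 0"
  by (simp add: wt_def)

lemma wt_0 [simp]: "wt \<rho> 0 = 0"
  by (simp add: wt_def)

lemma wt_exp: "r > 0 \<Longrightarrow> wt \<rho> r = exp (\<rho> r * ln r)"
  by (simp add: wt_def powr_def)

lemma proximate_order_DERIV:
  assumes "proximate_order \<rho>' \<rho>" "r > 0"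
  shows "(\<rho>' has_real_derivative deriv \<rho>' r) (at r)"
proof -
  have "\<rho>' differentiable (at r within {0..})"
    using assms by (auto simp: proximate_order_def differentiable_on_def)
  moreover have "at r within {0..} = at r"
    using assms(2) by (intro at_within_interior) auto
  ultimately show ?thesis
    using DERIV_deriv_iff_real_differentiable by simp
qed

text \<open>With respect to \<open>ln r\<close>, the function \<open>ln (wt \<rho>' r) = \<rho>' r * ln r\<close> has derivative
  \<open>deriv \<rho>' r * r * ln r + \<rho>' r\<close>, which tends to the order.\<close>
lemma proximate_order_growth:
  assumes po: "proximate_order \<rho>' \<rho>"
  obtains S where "S \<ge> 1"
    and "\<And>a b. S \<le> a \<Longrightarrow> a \<le> b \<Longrightarrow> (b / a) powr (\<rho> / 2) * wt \<rho>' a \<le> wt \<rho>' b"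
    and "\<And>a b. S \<le> a \<Longrightarrow> a \<le> b \<Longrightarrow> wt \<rho>' b \<le> (b / a) powr (\<rho> + 1) * wt \<rho>' a"
proof -
  let ?d = "\<lambda>r. deriv \<rho>' r * r * ln r + \<rho>' r"
  from po have "\<rho> > 0" "(\<rho>' \<longlongrightarrow> \<rho>) at_top" "((\<lambda>r. deriv \<rho>' r * r * ln r) \<longlongrightarrow> 0) at_top"
    by (auto simp: proximate_order_def)
  then have lim: "(?d \<longlongrightarrow> 0 + \<rho>) at_top"
    by (intro tendsto_add)
  have "eventually (\<lambda>r. ?d r > \<rho> / 2) at_top" "eventually (\<lambda>r. ?d r < \<rho> + 1) at_top"
    using \<open>\<rho> > 0\<close> by (intro order_tendstoD[OF lim]; simp)+
  then have "eventually (\<lambda>r. ?d r > \<rho> / 2 \<and> ?d r < \<rho> + 1) at_top"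
    by (rule eventually_conj)
  then obtain S0 where S0: "\<And>r. r \<ge> S0 \<Longrightarrow> ?d r > \<rho> / 2 \<and> ?d r < \<rho> + 1"
    by (auto simp: eventually_at_top_linorder)
  define S where "S = max 1 S0"
  have der: "((\<lambda>r. (\<rho>' r - c) * ln r) has_real_derivative (?d r - c) / r) (at r)" if "r > 0" for r c
    using that by (auto intro!: derivative_eq_intros proximate_order_DERIV[OF po] simp: field_simps)
  have expand: "(b / a) powr c * wt \<rho>' a = exp (\<rho>' a * ln a + c * (ln b - ln a))"
    if "a > 0" "b > 0" for a b c
    using that by (simp add: powr_def wt_exp ln_div exp_add[symmetric] algebra_simps)
  show ?thesis
  proof
    show "S \<ge> 1" by (simp add: S_def)
    fix a b assume ab: "S \<le> a" "a \<le> b"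
    then have pos: "a > 0" "b > 0" by (auto simp: S_def)
    have "(\<rho>' a - \<rho> / 2) * ln a \<le> (\<rho>' b - \<rho> / 2) * ln b"
    proof (rule DERIV_nonneg_imp_nondecreasing[OF ab(2)])
      fix x assume "a \<le> x" "x \<le> b"
      then have "x > 0" "x \<ge> S0" using pos ab by (auto simp: S_def)
      then show "\<exists>y. ((\<lambda>r. (\<rho>' r - \<rho> / 2) * ln r) has_real_derivative y) (at x) \<and> 0 \<le> y"
        using der[of x "\<rho> / 2"] S0[of x] by (intro exI conjI) (assumption, simp)
    qed
    then show "(b / a) powr (\<rho> / 2) * wt \<rho>' a \<le> wt \<rho>' b"
      unfolding expand[OF pos] wt_exp[OF pos(2)] by (simp add: algebra_simps diff_divide_distrib)
    have "(\<rho>' a - (\<rho> + 1)) * ln a \<ge> (\<rho>' b - (\<rho> + 1)) * ln b"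
    proof (rule DERIV_nonpos_imp_nonincreasing[OF ab(2)])
      fix x assume "a \<le> x" "x \<le> b"
      then have "x > 0" "x \<ge> S0" using pos ab by (auto simp: S_def)
      then show "\<exists>y. ((\<lambda>r. (\<rho>' r - (\<rho> + 1)) * ln r) has_real_derivative y) (at x) \<and> y \<le> 0"
        using der[of x "\<rho> + 1"] S0[of x] by (intro exI conjI) (assumption, simp add: divide_nonpos_pos)
    qed
    then show "wt \<rho>' b \<le> (b / a) powr (\<rho> + 1) * wt \<rho>' a"
      unfolding expand[OF pos] wt_exp[OF pos(2)] by (simp add: algebra_simps diff_divide_distrib)
  qed
qed

lemma proximate_order_wt_bounded:
  assumes "proximate_order \<rho>' \<rho>"
  obtains B where "B \<ge> 0" "\<And>r. 0 \<le> r \<Longrightarrow> r \<le> R \<Longrightarrow> wt \<rho>' r \<le> B"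
proof -
  have "continuous_on {0..} \<rho>'"
    using assms differentiable_imp_continuous_on unfolding proximate_order_def by blast
  then have "continuous_on {0..R} \<rho>'"
    by (rule continuous_on_subset) auto
  then have "bounded (\<rho>' ` {0..R})"
    by (intro compact_imp_bounded compact_continuous_image) auto
  then obtain P where "\<forall>x\<in>\<rho>' ` {0..R}. norm x \<le> P"
    unfolding bounded_iff by blast
  then have P: "\<bar>\<rho>' r\<bar> \<le> P" if "r \<in> {0..R}" for r
    using that by auto
  show ?thesis
  proof
    show "max 1 R powr P \<ge> 0" by simp
    fix r assume r: "0 \<le> r" "r \<le> R"
    then have p: "0 \<le> \<rho>' r" "\<rho>' r \<le> P"
      using assms P[of r] by (auto simp: proximate_order_def)
    have "r powr \<rho>' r \<le> max 1 R powr \<rho>' r"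
      using r p by (intro powr_mono2) auto
    also have "\<dots> \<le> max 1 R powr P"
      using p by (intro powr_mono) auto
    finally show "wt \<rho>' r \<le> max 1 R powr P" by (simp add: wt_def)
  qed
qed

text \<open>A comparison near infinity becomes global at the price of an additive constant, because
  \<open>wt \<rho>1\<close> is bounded on compact intervals. In the weighted norms such a constant
  is only a factor.\<close>

lemma wt_compare:
  assumes "proximate_order \<rho>1 p1"
    and "eventually (\<lambda>r. wt \<rho>1 r \<le> M * wt \<rho>2 r) at_top" "M \<ge> 0"
  obtains c where "c \<ge> 0" "\<And>r. r \<ge> 0 \<Longrightarrow> wt \<rho>1 r \<le> M * wt \<rho>2 r + c"
proof -
  obtain R where R: "\<And>r. r \<ge> R \<Longrightarrow> wt \<rho>1 r \<le> M * wt \<rho>2 r"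
    using assms(2) by (auto simp: eventually_at_top_linorder)
  obtain B where B: "B \<ge> 0" "\<And>r. 0 \<le> r \<Longrightarrow> r \<le> R \<Longrightarrow> wt \<rho>1 r \<le> B"
    by (rule proximate_order_wt_bounded[OF assms(1), where R = R]) blast
  show ?thesis
  proof
    fix r :: real assume "r \<ge> 0"
    then show "wt \<rho>1 r \<le> M * wt \<rho>2 r + B"
      using R[of r] B(1) B(2)[of r] mult_nonneg_nonneg[OF assms(3) wt_nonneg[of \<rho>2 r]]
      by (cases "r \<ge> R") auto
  qed (rule B(1))
qed

text \<open>At \<open>l = 0\<close> the value is unspecified, since the weight has no zero on the
  positive axis. The bounds below only raise it to the power 0 in that case.\<close>

definition phi :: "(real \<Rightarrow> real) \<Rightarrow> nat \<Rightarrow> real" where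
  "phi \<rho> l = the_inv_into {0<..} (wt \<rho>) (real l)"

section \<open>The inverse of a normalized weight and the growth of powers\<close>

locale normalized_order =
  fixes \<rho>h :: "real \<Rightarrow> real" and \<rho> :: real
  assumes po: "proximate_order \<rho>h \<rho>" and nrm: "normalized \<rho>h"
begin

lemma order_pos: "\<rho> > 0"
  using po by (simp add: proximate_order_def)

lemma wt_less: "0 < r \<Longrightarrow> r < s \<Longrightarrow> wt \<rho>h r < wt \<rho>h s"
  using nrm strict_mono_onD[of "{0<..}" "\<lambda>r. r powr \<rho>h r" r s] by (simp add: normalized_def wt_def)

lemma wt_mono: "0 \<le> r \<Longrightarrow> r \<le> s \<Longrightarrow> wt \<rho>h r \<le> wt \<rho>h s"
  using wt_less[of r s] by (cases "r = 0"; cases "r = s") auto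

lemma wt_le_cancel: "0 < r \<Longrightarrow> 0 < s \<Longrightarrow> wt \<rho>h r \<le> wt \<rho>h s \<longleftrightarrow> r \<le> s"
  using wt_less[of s r] wt_mono[of r s] by force

lemma wt_unbounded: "\<exists>r>0. wt \<rho>h r \<ge> B"
proof -
  obtain S where S: "S \<ge> 1"
    "\<And>a b. S \<le> a \<Longrightarrow> a \<le> b \<Longrightarrow> (b / a) powr (\<rho> / 2) * wt \<rho>h a \<le> wt \<rho>h b"
    "\<And>a b. S \<le> a \<Longrightarrow> a \<le> b \<Longrightarrow> wt \<rho>h b \<le> (b / a) powr (\<rho> + 1) * wt \<rho>h a"
    by (rule proximate_order_growth[OF po]) blast
  \<comment> \<open>The lower growth bound, with exponent \<open>\<rho> / 2\<close>, gains exactly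
    the factor \<open>m\<close> at the point \<open>S * m powr (2 / \<rho>)\<close>.\<close>
  define m where "m = max 1 (B / wt \<rho>h S)"
  have wS: "wt \<rho>h S > 0" using S(1) by (simp add: wt_pos)
  have m1: "m powr (2 / \<rho>) \<ge> 1" using order_pos by (simp add: m_def ge_one_powr_ge_zero)
  have "(S * m powr (2 / \<rho>) / S) powr (\<rho> / 2) * wt \<rho>h S \<le> wt \<rho>h (S * m powr (2 / \<rho>))"
    using S(1) m1 by (intro S(2)) auto
  moreover have "(S * m powr (2 / \<rho>) / S) powr (\<rho> / 2) = m"
    using S(1) order_pos by (simp add: powr_powr m_def)
  moreover have "m * wt \<rho>h S \<ge> B"
    using wS by (simp add: m_def field_simps max_def)
  moreover have "S * m powr (2 / \<rho>) > 0"
    using S(1) m1 by (intro mult_pos_pos) linarith+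
  ultimately show ?thesis
    by (intro exI[of _ "S * m powr (2 / \<rho>)"]) auto
qed

text \<open>Intermediate values: normalization makes the weight small near 0, and the growth
  estimate makes it unbounded.\<close>

lemma wt_surj:
  assumes "y > 0" shows "\<exists>s>0. wt \<rho>h s = y"
proof -
  have "((\<lambda>r. r powr \<rho>h r) \<longlongrightarrow> 0) (at_right 0)"
    using nrm by (simp add: normalized_def)
  then have "eventually (\<lambda>r. wt \<rho>h r < y) (at_right 0)"
    using assms order_tendstoD(2) unfolding wt_def by blast
  then obtain d where d: "d > 0" "\<And>r. 0 < r \<Longrightarrow> r < d \<Longrightarrow> wt \<rho>h r < y"
    by (auto simp: eventually_at_right_field)
  obtain b where b: "b > 0" "wt \<rho>h b \<ge> y" using wt_unbounded by blast
  define a where "a = min (d / 2) b"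
  have a: "0 < a" "a \<le> b" "a \<le> d / 2"
    using d(1) b(1) by (auto simp: a_def)
  then have ya: "wt \<rho>h a \<le> y"
    using d(1) d(2)[of "d / 2"] wt_mono[of a "d / 2"] by simp
  have "continuous_on {a..b} (\<lambda>r. exp (\<rho>h r * ln r))"
    using a(1) by (intro continuous_at_imp_continuous_on ballI continuous_intros)
      (auto intro: DERIV_isCont[OF proximate_order_DERIV[OF po]])
  then have "continuous_on {a..b} (wt \<rho>h)"
    by (rule continuous_on_eq) (use a(1) in \<open>auto simp: wt_exp\<close>)
  from IVT'[of "wt \<rho>h", OF ya b(2) a(2) this] obtain x where "a \<le> x" "wt \<rho>h x = y"
    by blast
  with a(1) show ?thesis by (intro exI[of _ x]) auto
qed

lemma phi:
  assumes "l > 0" shows "phi \<rho>h l > 0" "wt \<rho>h (phi \<rho>h l) = real l"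
proof -
  have inj: "inj_on (wt \<rho>h) {0<..}"
    by (rule linorder_inj_onI) (use wt_less in force)+
  obtain s where s: "s > 0" "wt \<rho>h s = real l" using wt_surj[of "real l"] assms by auto
  then have "phi \<rho>h l = s"
    unfolding phi_def using the_inv_into_f_eq[OF inj s(2)] by simp
  with s show "phi \<rho>h l > 0" "wt \<rho>h (phi \<rho>h l) = real l" by simp_all
qed

lemma phi_mono: "0 < j \<Longrightarrow> j \<le> l \<Longrightarrow> phi \<rho>h j \<le> phi \<rho>h l"
  using wt_le_cancel[of "phi \<rho>h j" "phi \<rho>h l"] phi[of j] phi[of l] by simp

text \<open>A single \<open>l\<close>-th power exposes the root by which a geometric rate has to be
  rescaled. At \<open>l = 0\<close> both sides are 1 whatever \<open>phi\<close> is there.\<close>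

lemma Gnum_eq: "Gnum \<rho>h \<rho> l = (phi \<rho>h l / (exp 1 * \<rho>) powr (1 / \<rho>)) ^ l"
  using order_pos by (simp add: Gnum_def phi_def wt_def[abs_def] power_divide powr_power)

text \<open>The sum is at most twice the larger argument, and doubling beyond \<open>S\<close> costs
  at most \<open>2 powr (\<rho> + 1)\<close>; smaller arguments go into \<open>c\<close>.\<close>

lemma wt_add_le:
  obtains K c where "K \<ge> 1" "c \<ge> 0"
    "\<And>r s. r \<ge> 0 \<Longrightarrow> s \<ge> 0 \<Longrightarrow> wt \<rho>h (r + s) \<le> K * (wt \<rho>h r + wt \<rho>h s) + c"
proof -
  obtain S where S: "S \<ge> 1"
    "\<And>a b. S \<le> a \<Longrightarrow> a \<le> b \<Longrightarrow> (b / a) powr (\<rho> / 2) * wt \<rho>h a \<le> wt \<rho>h b"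
    "\<And>a b. S \<le> a \<Longrightarrow> a \<le> b \<Longrightarrow> wt \<rho>h b \<le> (b / a) powr (\<rho> + 1) * wt \<rho>h a"
    by (rule proximate_order_growth[OF po]) blast
  define K where "K = 2 powr (\<rho> + 1)"
  have K: "K \<ge> 1" unfolding K_def using order_pos by (intro ge_one_powr_ge_zero) auto
  have double: "wt \<rho>h (2 * m) \<le> K * wt \<rho>h m + wt \<rho>h (2 * S)" if "m \<ge> 0" for m
  proof (cases "m \<ge> S")
    case True
    then show ?thesis using S(3)[of m "2 * m"] S(1) by (simp add: K_def add_increasing2)
  next
    case False
    then have "wt \<rho>h (2 * m) \<le> wt \<rho>h (2 * S)" using that by (intro wt_mono) auto
    then show ?thesis using K by (simp add: add_increasing)
  qed
  show ?thesis
  proof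
    fix r s :: real assume rs: "r \<ge> 0" "s \<ge> 0"
    have "wt \<rho>h (r + s) \<le> wt \<rho>h (2 * max r s)" using rs by (intro wt_mono) auto
    also have "\<dots> \<le> K * wt \<rho>h (max r s) + wt \<rho>h (2 * S)" using rs by (intro double) auto
    also have "\<dots> \<le> K * (wt \<rho>h r + wt \<rho>h s) + wt \<rho>h (2 * S)"
      using K by (intro add_right_mono mult_left_mono) (auto simp: max_def)
    finally show "wt \<rho>h (r + s) \<le> K * (wt \<rho>h r + wt \<rho>h s) + wt \<rho>h (2 * S)" .
  qed (use K in auto)
qed

text \<open>The maximum of \<open>j * ln r - \<tau> * wt \<rho>h r\<close> moves to smaller
  \<open>r\<close> as \<open>\<tau>\<close> grows, so an arbitrarily small \<open>\<delta>\<close>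
  is paid for with \<open>\<tau>\<close>. When \<open>r\<close> exceeds the radius by a factor
  \<open>t > 1\<close>, \<open>ln t\<close> is at most a multiple of
  \<open>t powr (\<rho> / 2)\<close>; as \<open>j\<close> is itself a value of the weight, the
  growth estimate then bounds \<open>j * ln t\<close> by a multiple of
  \<open>wt \<rho>h r\<close>.\<close>

lemma power_le_exp_wt_aux:
  assumes \<delta>: "0 < \<delta>" "\<delta> < 1"
  obtains \<tau> C where "\<tau> > 0" "C \<ge> 1"
    "\<And>s r j. s > 0 \<Longrightarrow> r \<ge> 0 \<Longrightarrow> j > 0 \<Longrightarrow> wt \<rho>h s = real j \<Longrightarrow>
       r ^ j \<le> C * (\<delta> * s) ^ j * exp (\<tau> * wt \<rho>h r)"
proof -
  obtain S where S: "S \<ge> 1"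
    "\<And>a b. S \<le> a \<Longrightarrow> a \<le> b \<Longrightarrow> (b / a) powr (\<rho> / 2) * wt \<rho>h a \<le> wt \<rho>h b"
    "\<And>a b. S \<le> a \<Longrightarrow> a \<le> b \<Longrightarrow> wt \<rho>h b \<le> (b / a) powr (\<rho> + 1) * wt \<rho>h a"
    by (rule proximate_order_growth[OF po]) blast
  obtain s1 where s1: "s1 > 0" "wt \<rho>h s1 = 1" using wt_surj[of 1] by auto
  \<comment> \<open>The factor \<open>2 / \<rho>\<close> comes from
    \<open>ln t \<le> 2 / \<rho> * t powr (\<rho> / 2)\<close>, the power of
    \<open>1 / \<delta>\<close> from comparing the weight at \<open>s'\<close> and at
    \<open>\<delta> * s'\<close>.\<close>
  define \<tau> where "\<tau> = 2 / \<rho> * (1 / \<delta>) powr (\<rho> + 1)"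
  \<comment> \<open>The growth estimates do not reach small \<open>j\<close>. There \<open>q\<close>
    bounds the ratio \<open>s' / s\<close>, with \<open>s1\<close> the least possible
    \<open>s\<close>, and \<open>j \<le> wt \<rho>h (S / \<delta>)\<close> keeps
    \<open>q ^ j\<close> below \<open>C\<close>.\<close>
  define q where "q = max 1 (S / (\<delta> * s1))"
  define C where "C = q powr wt \<rho>h (S / \<delta>)"
  have \<tau>: "\<tau> > 0" using order_pos \<delta> by (simp add: \<tau>_def)
  have C: "C \<ge> 1" unfolding C_def by (intro ge_one_powr_ge_zero) (auto simp: q_def)
  show ?thesis
  proof (rule that[OF \<tau> C])
    fix s r :: real and j :: nat
    assume s: "s > 0" and r: "r \<ge> 0" and j: "j > 0" "wt \<rho>h s = real j"
    \<comment> \<open>Enlarging \<open>s\<close> brings both \<open>s'\<close> and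
      \<open>\<delta> * s'\<close> into the range of the growth estimates.\<close>
    define s' where "s' = max s (S / \<delta>)"
    have s': "s' > 0" "s \<le> s'" "\<delta> * s' \<ge> S" "\<delta> * s' \<le> s'"
      using s S(1) \<delta> by (auto simp: s'_def max_def field_simps)
    have js': "real j \<le> wt \<rho>h s'" using wt_mono[of s s'] s s' j by simp
    have 1: "r ^ j \<le> (\<delta> * s') ^ j * exp (\<tau> * wt \<rho>h r)"
    proof (cases "r \<le> \<delta> * s'")
      case True
      then have "r ^ j * 1 \<le> (\<delta> * s') ^ j * exp (\<tau> * wt \<rho>h r)"
        using r \<tau> s' \<delta> by (intro mult_mono power_mono) auto
      then show ?thesis by simp
    next
      case False
      define t where "t = r / (\<delta> * s')"
      have t: "t > 1" "r = \<delta> * s' * t" using False s' \<delta> by (auto simp: t_def field_simps)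
      have "ln t * (\<rho> / 2) = ln (t powr (\<rho> / 2))" using t by (simp add: ln_powr)
      also have "\<dots> \<le> t powr (\<rho> / 2)"
        using ln_le_minus_one[of "t powr (\<rho> / 2)"] t by simp
      finally have lnt: "ln t \<le> 2 / \<rho> * t powr (\<rho> / 2)" using order_pos by (simp add: field_simps)
      have "real j * ln t \<le> wt \<rho>h s' * (2 / \<rho> * t powr (\<rho> / 2))"
        using js' lnt t by (intro mult_mono) auto
      also have "\<dots> \<le> ((1 / \<delta>) powr (\<rho> + 1) * wt \<rho>h (\<delta> * s')) * (2 / \<rho> * t powr (\<rho> / 2))"
        using S(3)[OF s'(3,4)] s' \<delta> order_pos by (intro mult_right_mono) (auto simp: field_simps)
      also have "\<dots> = \<tau> * (t powr (\<rho> / 2) * wt \<rho>h (\<delta> * s'))"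
        by (simp add: \<tau>_def)
      also have "\<dots> \<le> \<tau> * wt \<rho>h r"
        using S(2)[OF s'(3), of r] False \<tau> by (intro mult_left_mono) (auto simp: t_def)
      finally have "exp (real j * ln t) \<le> exp (\<tau> * wt \<rho>h r)" by simp
      then have "t ^ j \<le> exp (\<tau> * wt \<rho>h r)"
        using t by (simp add: exp_of_nat_mult)
      then show ?thesis
        unfolding t(2)[unfolded mult.assoc[symmetric]] power_mult_distrib
        using s' \<delta> by (intro mult_left_mono) (auto simp: t(2) power_mult_distrib)
    qed
    have 2: "(\<delta> * s') ^ j \<le> C * (\<delta> * s) ^ j"
    proof (cases "s \<ge> S / \<delta>")
      case True
      then have "s' = s" by (simp add: s'_def)
      then show ?thesis using C s \<delta> by (simp add: mult_right_mono)
    next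
      case False
      then have ss: "s' = S / \<delta>" by (simp add: s'_def)
      have "s1 \<le> s" using wt_le_cancel[of s1 s] s s1 j by simp
      have "(s' / s) ^ j \<le> q ^ j"
      proof (intro power_mono)
        have "s' / s \<le> s' / s1" using \<open>s1 \<le> s\<close> s1 s' by (intro divide_left_mono) auto
        also have "\<dots> \<le> q" by (simp add: q_def ss)
        finally show "s' / s \<le> q" .
      qed (use s s' in auto)
      also have "\<dots> = q powr real j" by (simp add: powr_realpow q_def)
      also have "\<dots> \<le> C" unfolding C_def
        using wt_mono[of s "S / \<delta>"] False s j by (intro powr_mono) (auto simp: q_def)
      finally have "(s' / s) ^ j \<le> C" .
      then have "(s' / s) ^ j * (\<delta> * s) ^ j \<le> C * (\<delta> * s) ^ j"
        using s \<delta> by (intro mult_right_mono) auto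
      moreover have "(s' / s) ^ j * (\<delta> * s) ^ j = (\<delta> * s') ^ j"
        using s by (simp add: mult.commute flip: power_mult_distrib)
      ultimately show ?thesis by simp
    qed
    have "(\<delta> * s') ^ j * exp (\<tau> * wt \<rho>h r) \<le> C * (\<delta> * s) ^ j * exp (\<tau> * wt \<rho>h r)"
      by (intro mult_right_mono 2) auto
    with 1 show "r ^ j \<le> C * (\<delta> * s) ^ j * exp (\<tau> * wt \<rho>h r)" by linarith
  qed
qed

text \<open>Since \<open>phi\<close> increases, degree \<open>j\<close> may be measured at the scale
  of any \<open>l \<ge> j\<close>. The binomial sums defining the coefficients mix all degrees up to
  \<open>l\<close> at the one scale \<open>phi \<rho>h l\<close>.\<close>

lemma power_le_exp_wt:
  assumes \<delta>: "0 < \<delta>" "\<delta> < 1"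
  obtains \<tau> C where "\<tau> > 0" "C \<ge> 1"
    "\<And>r j l. r \<ge> 0 \<Longrightarrow> j \<le> l \<Longrightarrow> r ^ j \<le> C * (\<delta> * phi \<rho>h l) ^ j * exp (\<tau> * wt \<rho>h r)"
proof -
  obtain \<tau> C where \<tau>C: "\<tau> > 0" "C \<ge> 1"
    and *: "\<And>s r j. s > 0 \<Longrightarrow> r \<ge> 0 \<Longrightarrow> j > 0 \<Longrightarrow> wt \<rho>h s = real j \<Longrightarrow>
       r ^ j \<le> C * (\<delta> * s) ^ j * exp (\<tau> * wt \<rho>h r)"
    by (rule power_le_exp_wt_aux[OF \<delta>]) blast
  show ?thesis
  proof (rule that[OF \<tau>C])
    fix r :: real and j l :: nat assume r: "r \<ge> 0" and jl: "j \<le> l"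
    show "r ^ j \<le> C * (\<delta> * phi \<rho>h l) ^ j * exp (\<tau> * wt \<rho>h r)"
    proof (cases "j = 0")
      case True
      have "1 * 1 \<le> C * exp (\<tau> * wt \<rho>h r)" using \<tau>C by (intro mult_mono) auto
      then show ?thesis using True by simp
    next
      case False
      then have j: "j > 0" by simp
      note p = phi[OF j]
      have "r ^ j \<le> C * (\<delta> * phi \<rho>h j) ^ j * exp (\<tau> * wt \<rho>h r)"
        by (rule *[OF p(1) r j p(2)])
      also have "\<dots> \<le> C * (\<delta> * phi \<rho>h l) ^ j * exp (\<tau> * wt \<rho>h r)"
        using phi_mono[OF j jl] p \<tau>C \<delta> by (intro mult_right_mono mult_left_mono power_mono) auto
      finally show ?thesis .
    qed
  qed
qed

end

section \<open>The weighted spaces and the inductive limit topology\<close>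

lemma stem_add: "stem H \<Longrightarrow> stem K \<Longrightarrow> stem (\<lambda>z. H z + K z)"
  unfolding stem_def by (auto intro!: holomorphic_intros)

lemma stem_scaleR: "stem H \<Longrightarrow> stem (\<lambda>z. r *\<^sub>R H z)"
  unfolding stem_def by (auto intro!: holomorphic_intros simp: scaleR_conv_of_real[where 'a = complex])

lemma stem_sum: "(\<And>l. l \<in> I \<Longrightarrow> stem (H l)) \<Longrightarrow> stem (\<lambda>z. \<Sum>l\<in>I. H l z)"
  unfolding stem_def by (auto intro!: holomorphic_intros)

lemma ext_add: "slice_ext (\<lambda>z. H z + K z) = (\<lambda>x. slice_ext H x + slice_ext K x)"
  by (simp add: slice_ext_def fun_eq_iff linear_add[OF linear_slice_val])

lemma ext_scaleR: "slice_ext (\<lambda>z. r *\<^sub>R H z) = (\<lambda>x. r *\<^sub>R slice_ext H x)"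
  by (simp add: slice_ext_def fun_eq_iff linear_scale[OF linear_slice_val])

lemma ext_sum: "slice_ext (\<lambda>z. \<Sum>l\<in>I. H l z) = (\<lambda>x. \<Sum>l\<in>I. slice_ext (H l) x)"
  by (simp add: slice_ext_def fun_eq_iff linear_sum[OF linear_slice_val])

lemma slice_monogenic_lincomb:
  assumes "slice_monogenic f" "slice_monogenic g"
  shows "slice_monogenic (\<lambda>x. a *\<^sub>R f x + b *\<^sub>R g x)"
proof -
  obtain H K where HK: "stem H" "f = slice_ext H" "stem K" "g = slice_ext K"
    using assms slice_monogenic_iff by metis
  then have "stem (\<lambda>z. a *\<^sub>R H z + b *\<^sub>R K z)" by (intro stem_add stem_scaleR)
  from slice_monogenic_ext[OF this] show ?thesis
    using ext_add[of "\<lambda>z. a *\<^sub>R H z" "\<lambda>z. b *\<^sub>R K z"] HK by (simp add: ext_scaleR)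
qed

lemma slice_monogenic_zero: "slice_monogenic (\<lambda>x. 0)"
proof -
  have "stem (\<lambda>z. 0)" by (auto simp: stem_def)
  from slice_monogenic_ext[OF this] show ?thesis
    by (simp add: slice_ext_def[abs_def] linear_0[OF linear_slice_val])
qed

text \<open>An explicit bound replaces \<open>wnorm\<close>, whose supremum carries no information
  unless the weighted function is bounded. Membership in a step and a norm estimate become one
  statement.\<close>

definition slice_bounded ::
  "(real \<Rightarrow> real) \<Rightarrow> real \<Rightarrow> real \<Rightarrow> (real \<times> (real ^ ('n::{finite,linorder})) \<Rightarrow> 'n clif) \<Rightarrow> bool"
  where "slice_bounded \<rho> \<sigma> M f \<longleftrightarrow>
    slice_monogenic f \<and> (\<forall>x. norm (f x) \<le> M * exp (\<sigma> * wt \<rho> (norm x)))"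

lemma slice_bounded_iff:
  "slice_bounded \<rho> \<sigma> M f \<longleftrightarrow>
    slice_monogenic f \<and> (\<forall>x. norm (f x) * exp (- \<sigma> * norm x powr \<rho> (norm x)) \<le> M)"
  by (simp add: slice_bounded_def wt_def exp_minus field_simps)

lemma slice_bounded_nonneg: "slice_bounded \<rho> \<sigma> M f \<Longrightarrow> M \<ge> 0"
  unfolding slice_bounded_def
  by (metis exp_gt_zero norm_ge_zero order_trans zero_le_mult_iff not_less)

lemma slice_boundedD: "slice_bounded \<rho> \<sigma> M f \<Longrightarrow> norm (f x) \<le> M * exp (\<sigma> * wt \<rho> (norm x))"
  unfolding slice_bounded_def by blast

lemma slice_bounded_slice_monogenic: "slice_bounded \<rho> \<sigma> M f \<Longrightarrow> slice_monogenic f"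
  unfolding slice_bounded_def by blast

lemma A_sig_iff: "f \<in> A_sig \<rho> \<sigma> \<longleftrightarrow> (\<exists>M. slice_bounded \<rho> \<sigma> M f)"
  by (auto simp: A_sig_def weight_bdd_def bdd_above_def slice_bounded_iff)

lemma wnorm_le: "slice_bounded \<rho> \<sigma> M f \<Longrightarrow> wnorm \<rho> \<sigma> f \<le> M"
  unfolding wnorm_def slice_bounded_iff by (intro cSUP_least) auto

lemma slice_bounded_wnorm: "f \<in> A_sig \<rho> \<sigma> \<Longrightarrow> slice_bounded \<rho> \<sigma> (wnorm \<rho> \<sigma> f) f"
  unfolding wnorm_def slice_bounded_iff A_sig_def weight_bdd_def by (auto intro!: cSUP_upper)

lemma slice_bounded_mono:
  assumes "slice_bounded \<rho> \<sigma> M f" "\<sigma> \<le> \<sigma>'" "M \<le> M'"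
  shows "slice_bounded \<rho> \<sigma>' M' f"
proof -
  have "M * exp (\<sigma> * wt \<rho> r) \<le> M' * exp (\<sigma>' * wt \<rho> r)" for r
    using assms slice_bounded_nonneg[OF assms(1)] by (intro mult_mono) (auto intro: mult_right_mono)
  with assms(1) show ?thesis unfolding slice_bounded_def using order_trans by blast
qed

lemma slice_bounded_lincomb:
  assumes "slice_bounded \<rho> \<sigma> M f" "slice_bounded \<rho> \<sigma> N g"
  shows "slice_bounded \<rho> \<sigma> (\<bar>a\<bar> * M + \<bar>b\<bar> * N) (\<lambda>x. a *\<^sub>R f x + b *\<^sub>R g x)"
  unfolding slice_bounded_def
proof (intro conjI allI)
  fix x
  have "norm (a *\<^sub>R f x + b *\<^sub>R g x) \<le> \<bar>a\<bar> * norm (f x) + \<bar>b\<bar> * norm (g x)"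
    using norm_triangle_ineq[of "a *\<^sub>R f x" "b *\<^sub>R g x"] by simp
  also have "\<dots> \<le> \<bar>a\<bar> * (M * exp (\<sigma> * wt \<rho> (norm x))) + \<bar>b\<bar> * (N * exp (\<sigma> * wt \<rho> (norm x)))"
    using assms by (intro add_mono mult_left_mono slice_boundedD) auto
  finally show "norm (a *\<^sub>R f x + b *\<^sub>R g x) \<le> (\<bar>a\<bar> * M + \<bar>b\<bar> * N) * exp (\<sigma> * wt \<rho> (norm x))"
    by (simp add: algebra_simps)
qed (use assms slice_monogenic_lincomb slice_bounded_slice_monogenic in blast)

lemma slice_bounded_scaleR:
  "slice_bounded \<rho> \<sigma> M f \<Longrightarrow> slice_bounded \<rho> \<sigma> (\<bar>a\<bar> * M) (\<lambda>x. a *\<^sub>R f x)"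
  using slice_bounded_lincomb[of \<rho> \<sigma> M f M f a 0] by simp

lemma slice_bounded_zero: "slice_bounded \<rho> \<sigma> 0 (\<lambda>x. 0)"
  by (simp add: slice_bounded_def slice_monogenic_zero)

lemma A_sp_iff: "f \<in> A_sp \<rho> \<longleftrightarrow> (\<exists>\<sigma>>0. \<exists>M. slice_bounded \<rho> \<sigma> M f)"
  by (auto simp: A_sp_def A_sig_iff)

lemma A_sp_slice_monogenic: "f \<in> A_sp \<rho> \<Longrightarrow> slice_monogenic f"
  by (auto simp: A_sp_iff slice_bounded_def)

lemma A_sp_lincomb:
  assumes "f \<in> A_sp \<rho>" "g \<in> A_sp \<rho>"
  shows "(\<lambda>x. a *\<^sub>R f x + b *\<^sub>R g x) \<in> A_sp \<rho>"
proof -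
  obtain \<sigma> M \<tau> N where *: "\<sigma> > 0" "slice_bounded \<rho> \<sigma> M f" "\<tau> > 0" "slice_bounded \<rho> \<tau> N g"
    using assms unfolding A_sp_iff by blast
  have "slice_bounded \<rho> (max \<sigma> \<tau>) M f" "slice_bounded \<rho> (max \<sigma> \<tau>) N g"
    by (rule slice_bounded_mono[OF *(2)] slice_bounded_mono[OF *(4)]; simp)+
  from slice_bounded_lincomb[OF this, of a b] show ?thesis
    unfolding A_sp_iff using *(1) by (intro exI[of _ "max \<sigma> \<tau>"]) auto
qed

lemma A_sp_add: "f \<in> A_sp \<rho> \<Longrightarrow> g \<in> A_sp \<rho> \<Longrightarrow> (\<lambda>x. f x + g x) \<in> A_sp \<rho>"
  using A_sp_lincomb[of f \<rho> g 1 1] by simp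

lemma A_sp_zero: "(\<lambda>x. 0) \<in> A_sp \<rho>"
  unfolding A_sp_iff using slice_bounded_zero zero_less_one by blast

section \<open>Neighbourhoods and open sets of the inductive limit\<close>

lemma lc_zero_nbhdE:
  assumes "lc_zero_nbhd \<rho> V" "\<sigma> > 0"
  obtains \<epsilon> where "\<epsilon> > 0" "{g \<in> A_sig \<rho> \<sigma>. wnorm \<rho> \<sigma> g < \<epsilon>} \<subseteq> V"
  using assms unfolding lc_zero_nbhd_def by blast

lemma lc_zero_nbhd_A_sp: "lc_zero_nbhd \<rho> (A_sp \<rho>)"
  unfolding lc_zero_nbhd_def
proof (intro conjI allI impI)
  fix \<sigma> :: real assume "\<sigma> > 0"
  then show "\<exists>\<epsilon>>0. {g \<in> A_sig \<rho> \<sigma>. wnorm \<rho> \<sigma> g < \<epsilon>} \<subseteq> A_sp \<rho>"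
    by (intro exI[of _ 1]) (auto simp: A_sp_def)
qed (auto intro: A_sp_lincomb)

lemma lc_zero_nbhd_Int:
  assumes "lc_zero_nbhd \<rho> V" "lc_zero_nbhd \<rho> W" shows "lc_zero_nbhd \<rho> (V \<inter> W)"
  unfolding lc_zero_nbhd_def
proof (intro conjI allI impI)
  fix \<sigma> :: real assume "\<sigma> > 0"
  obtain d where d: "d > 0" "{g \<in> A_sig \<rho> \<sigma>. wnorm \<rho> \<sigma> g < d} \<subseteq> V"
    by (rule lc_zero_nbhdE[OF assms(1) \<open>\<sigma> > 0\<close>])
  obtain e where e: "e > 0" "{g \<in> A_sig \<rho> \<sigma>. wnorm \<rho> \<sigma> g < e} \<subseteq> W"
    by (rule lc_zero_nbhdE[OF assms(2) \<open>\<sigma> > 0\<close>])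
  from d e show "\<exists>\<epsilon>>0. {g \<in> A_sig \<rho> \<sigma>. wnorm \<rho> \<sigma> g < \<epsilon>} \<subseteq> V \<inter> W"
    by (intro exI[of _ "min d e"]) auto
qed (use assms in \<open>auto simp: lc_zero_nbhd_def\<close>)

text \<open>The defining predicate can be recovered from \<open>topology\<close> once it satisfies
  the axioms; the one for intersections rests on intersecting basic neighbourhoods.\<close>

lemma openin_A_top:
  fixes U :: "(real \<times> (real ^ ('n::{finite,linorder})) \<Rightarrow> 'n clif) set"
  shows "openin (A_top \<rho>) U \<longleftrightarrow> U \<subseteq> A_sp \<rho> \<and>
    (\<forall>f\<in>U. \<exists>V. lc_zero_nbhd \<rho> V \<and> (\<lambda>g x. f x + g x) ` V \<subseteq> U)"
proof -
  let ?P = "\<lambda>U :: (real \<times> (real, 'n) vec \<Rightarrow> 'n clif) set. U \<subseteq> A_sp \<rho> \<and> (\<forall>f\<in>U. \<exists>V. lc_zero_nbhd \<rho> V \<and> (\<lambda>g x. f x + g x) ` V \<subseteq> U)"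
  have "istopology ?P"
    unfolding istopology_def
  proof (rule conjI; intro allI impI)
    fix S T assume S: "?P S" and T: "?P T"
    show "?P (S \<inter> T)"
    proof (intro conjI ballI)
      fix f assume "f \<in> S \<inter> T"
      then have f: "f \<in> S" "f \<in> T" by auto
      obtain V where V: "lc_zero_nbhd \<rho> V" "(\<lambda>g x. f x + g x) ` V \<subseteq> S"
        using conjunct2[OF S] f(1) by blast
      obtain W where W: "lc_zero_nbhd \<rho> W" "(\<lambda>g x. f x + g x) ` W \<subseteq> T"
        using conjunct2[OF T] f(2) by blast
      show "\<exists>V. lc_zero_nbhd \<rho> V \<and> (\<lambda>g x. f x + g x) ` V \<subseteq> S \<inter> T"
        by (intro exI[of _ "V \<inter> W"] conjI lc_zero_nbhd_Int V(1) W(1)) (use V(2) W(2) in auto)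
    qed (use S in auto)
  next
    fix K assume K: "\<forall>S\<in>K. ?P S"
    show "?P (\<Union>K)"
    proof (intro conjI ballI)
      fix f assume "f \<in> \<Union>K"
      then obtain S where S: "S \<in> K" "f \<in> S" by blast
      obtain V where V: "lc_zero_nbhd \<rho> V" "(\<lambda>g x. f x + g x) ` V \<subseteq> S"
        using conjunct2[OF bspec[OF K S(1)]] S(2) by blast
      show "\<exists>V. lc_zero_nbhd \<rho> V \<and> (\<lambda>g x. f x + g x) ` V \<subseteq> \<Union>K"
        by (rule exI[of _ V]) (use V S(1) in auto)
    qed (use K in auto)
  qed
  then show ?thesis unfolding A_top_def by (simp add: topology_inverse')
qed

lemma topspace_A_top [simp]: "topspace (A_top \<rho>) = A_sp \<rho>"
proof
  show "topspace (A_top \<rho>) \<subseteq> A_sp \<rho>"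
    using openin_topspace[of "A_top \<rho>"] unfolding openin_A_top by (rule conjunct1)
  have "openin (A_top \<rho>) (A_sp \<rho>)"
    unfolding openin_A_top by (auto intro!: exI[of _ "A_sp \<rho>"] lc_zero_nbhd_A_sp A_sp_add)
  then show "A_sp \<rho> \<subseteq> topspace (A_top \<rho>)" by (rule openin_subset)
qed

section \<open>Continuity of linear maps as boundedness between steps\<close>

definition real_linear_on ::
  "('a \<Rightarrow> 'b::real_vector) set \<Rightarrow> (('a \<Rightarrow> 'b) \<Rightarrow> ('c \<Rightarrow> 'd::real_vector)) \<Rightarrow> bool" where
  "real_linear_on S T \<longleftrightarrow> (\<forall>f\<in>S. \<forall>g\<in>S. \<forall>a b.
     T (\<lambda>x. a *\<^sub>R f x + b *\<^sub>R g x) = (\<lambda>x. a *\<^sub>R T f x + b *\<^sub>R T g x))"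

lemma real_linear_onD:
  "real_linear_on S T \<Longrightarrow> f \<in> S \<Longrightarrow> g \<in> S \<Longrightarrow>
    T (\<lambda>x. a *\<^sub>R f x + b *\<^sub>R g x) = (\<lambda>x. a *\<^sub>R T f x + b *\<^sub>R T g x)"
  by (simp add: real_linear_on_def)

lemma real_linear_on_add:
  "real_linear_on S T \<Longrightarrow> f \<in> S \<Longrightarrow> g \<in> S \<Longrightarrow> T (\<lambda>x. f x + g x) = (\<lambda>x. T f x + T g x)"
  using real_linear_onD[of S T f g 1 1] by simp

lemma real_linear_on_diff:
  "real_linear_on S T \<Longrightarrow> f \<in> S \<Longrightarrow> g \<in> S \<Longrightarrow> T (\<lambda>x. f x - g x) = (\<lambda>x. T f x - T g x)"
  using real_linear_onD[of S T f g 1 "- 1"] by simp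

lemma real_linear_on_scaleR:
  "real_linear_on S T \<Longrightarrow> f \<in> S \<Longrightarrow> T (\<lambda>x. a *\<^sub>R f x) = (\<lambda>x. a *\<^sub>R T f x)"
  using real_linear_onD[of S T f f a 0] by simp

text \<open>Boundedness between Banach steps, with one \<open>C\<close> for the whole step. For
  linear maps it is equivalent to continuity by the two results below, so all later estimates can be
  made in norms.\<close>

definition step_bounded ::
  "(real \<Rightarrow> real) \<Rightarrow> (real \<Rightarrow> real) \<Rightarrow> ((real \<times> (real ^ ('n::{finite,linorder})) \<Rightarrow> 'n clif) \<Rightarrow>
    (real \<times> (real ^ ('n::{finite,linorder})) \<Rightarrow> 'n clif)) \<Rightarrow> bool" where
  "step_bounded \<rho>1 \<rho>2 T \<longleftrightarrow> (\<forall>\<tau>>0. \<exists>\<sigma>>0. \<exists>C>0. \<forall>f M.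
     slice_bounded \<rho>1 \<tau> M f \<longrightarrow> slice_bounded \<rho>2 \<sigma> (C * M) (T f))"

lemma step_bounded_A_sp: "step_bounded \<rho>1 \<rho>2 T \<Longrightarrow> f \<in> A_sp \<rho>1 \<Longrightarrow> T f \<in> A_sp \<rho>2"
  unfolding step_bounded_def A_sp_iff by meson

text \<open>The preimage of a basic neighbourhood is again basic: real linearity preserves absolute
  convexity, and the ball of radius \<open>\<epsilon> / C\<close> in a step is mapped into the ball
  of radius \<open>\<epsilon>\<close> in its target step.\<close>

lemma step_bounded_imp_continuous_map:
  fixes T :: "(real \<times> (real ^ ('n::{finite,linorder})) \<Rightarrow> 'n clif) \<Rightarrow> (real \<times> (real ^ ('n::{finite,linorder})) \<Rightarrow> 'n clif)"
  assumes T: "step_bounded \<rho>1 \<rho>2 T" and lin: "real_linear_on (A_sp \<rho>1) T"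
  shows "continuous_map (A_top \<rho>1) (A_top \<rho>2) T"
  unfolding continuous_map_def
proof (intro conjI allI impI)
  show "T \<in> topspace (A_top \<rho>1) \<rightarrow> topspace (A_top \<rho>2)"
    using step_bounded_A_sp[OF T] by simp
  fix U :: "(real \<times> (real, 'n) vec \<Rightarrow> 'n clif) set" assume U: "openin (A_top \<rho>2) U"
  let ?T = "{f \<in> A_sp \<rho>1. T f \<in> U}"
  have "openin (A_top \<rho>1) ?T"
    unfolding openin_A_top
  proof (intro conjI ballI)
    fix f assume f: "f \<in> ?T"
    then obtain V where V: "lc_zero_nbhd \<rho>2 V" "(\<lambda>g x. T f x + g x) ` V \<subseteq> U"
      using U unfolding openin_A_top by blast
    let ?W = "{g \<in> A_sp \<rho>1. T g \<in> V}"
    have "lc_zero_nbhd \<rho>1 ?W"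
      unfolding lc_zero_nbhd_def
    proof (intro conjI allI impI ballI)
      fix f g and a b :: real assume "f \<in> ?W" "g \<in> ?W" "\<bar>a\<bar> + \<bar>b\<bar> \<le> 1"
      then show "(\<lambda>x. a *\<^sub>R f x + b *\<^sub>R g x) \<in> ?W"
        using V(1) by (auto simp: lc_zero_nbhd_def real_linear_onD[OF lin] A_sp_lincomb)
    next
      fix \<tau> :: real assume "\<tau> > 0"
      then obtain \<sigma> C where C: "\<sigma> > 0" "C > 0"
        "\<And>f M. slice_bounded \<rho>1 \<tau> M f \<Longrightarrow> slice_bounded \<rho>2 \<sigma> (C * M) (T f)"
        using T unfolding step_bounded_def by meson
      obtain \<epsilon> where \<epsilon>: "\<epsilon> > 0" "{g \<in> A_sig \<rho>2 \<sigma>. wnorm \<rho>2 \<sigma> g < \<epsilon>} \<subseteq> V"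
        by (rule lc_zero_nbhdE[OF V(1) C(1)])
      have "g \<in> ?W" if g: "g \<in> A_sig \<rho>1 \<tau>" "wnorm \<rho>1 \<tau> g < \<epsilon> / C" for g
      proof -
        note b = C(3)[OF slice_bounded_wnorm[OF g(1)]]
        have "C * wnorm \<rho>1 \<tau> g < \<epsilon>" using g(2) C(2) by (simp add: field_simps)
        then have "wnorm \<rho>2 \<sigma> (T g) < \<epsilon>" using wnorm_le[OF b] by linarith
        moreover have "T g \<in> A_sig \<rho>2 \<sigma>" using b A_sig_iff by blast
        ultimately show ?thesis using \<epsilon>(2) g(1) \<open>\<tau> > 0\<close> by (auto simp: A_sp_def)
      qed
      then show "\<exists>\<epsilon>>0. {g \<in> A_sig \<rho>1 \<tau>. wnorm \<rho>1 \<tau> g < \<epsilon>} \<subseteq> ?W"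
        using \<epsilon>(1) C(2) by (intro exI[of _ "\<epsilon> / C"]) auto
    qed auto
    moreover have "(\<lambda>g x. f x + g x) ` ?W \<subseteq> ?T"
      using f V(2) by (auto simp: real_linear_on_add[OF lin] A_sp_add)
    ultimately show "\<exists>V. lc_zero_nbhd \<rho>1 V \<and> (\<lambda>g x. f x + g x) ` V \<subseteq> ?T" by blast
  qed auto
  then show "openin (A_top \<rho>1) {f \<in> topspace (A_top \<rho>1). T f \<in> U}" by simp
qed

lemma slice_bounded_0_imp_zero: "slice_bounded \<rho> \<sigma> 0 f \<Longrightarrow> f = (\<lambda>x. 0)"
  by (auto simp: slice_bounded_def)

text \<open>Point evaluations weighted by \<open>exp (- (m + 1) * wt \<rho> (norm (x m)))\<close> give a seminorm that is
  finite on every step, since only finitely many \<open>m\<close> satisfy \<open>m + 1 < \<sigma>\<close>.\<close>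
lemma lc_zero_nbhd_point_evaluations:
  fixes x :: "nat \<Rightarrow> real \<times> (real ^ ('n::{finite,linorder}))"
  assumes "s > 0"
  shows "lc_zero_nbhd \<rho> {g \<in> A_sp \<rho>. \<forall>m. norm (g (x m)) * exp (- real (Suc m) * wt \<rho> (norm (x m))) \<le> s}"
    (is "lc_zero_nbhd \<rho> {g \<in> _. \<forall>m. norm (g (x m)) * ?q m \<le> s}")
  unfolding lc_zero_nbhd_def
proof (intro conjI allI impI ballI)
  let ?V = "{g \<in> A_sp \<rho>. \<forall>m. norm (g (x m)) * ?q m \<le> s}"
  show "?V \<subseteq> A_sp \<rho>" by auto
  fix f g and a b :: real assume f: "f \<in> ?V" and g: "g \<in> ?V" and ab: "\<bar>a\<bar> + \<bar>b\<bar> \<le> 1"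
  have "norm (a *\<^sub>R f (x m) + b *\<^sub>R g (x m)) * ?q m \<le> s" for m
  proof -
    have "norm (a *\<^sub>R f (x m) + b *\<^sub>R g (x m)) * ?q m \<le> (\<bar>a\<bar> * norm (f (x m)) + \<bar>b\<bar> * norm (g (x m))) * ?q m"
      using norm_triangle_ineq[of "a *\<^sub>R f (x m)" "b *\<^sub>R g (x m)"] by (intro mult_right_mono) auto
    also have "\<dots> = \<bar>a\<bar> * (norm (f (x m)) * ?q m) + \<bar>b\<bar> * (norm (g (x m)) * ?q m)"
      by (simp only: distrib_right mult.assoc)
    also have "\<dots> \<le> \<bar>a\<bar> * s + \<bar>b\<bar> * s"
      using f g by (intro add_mono mult_left_mono) auto
    also have "\<dots> = (\<bar>a\<bar> + \<bar>b\<bar>) * s" by (simp add: distrib_right)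
    also have "\<dots> \<le> 1 * s" using ab assms by (intro mult_right_mono) auto
    finally show ?thesis by simp
  qed
  then show "(\<lambda>y. a *\<^sub>R f y + b *\<^sub>R g y) \<in> ?V"
    using f g A_sp_lincomb by auto
next
  let ?V = "{g \<in> A_sp \<rho>. \<forall>m. norm (g (x m)) * ?q m \<le> s}"
  fix \<sigma> :: real assume \<sigma>: "\<sigma> > 0"
  \<comment> \<open>The sum dominates each of the finitely many exceptional indices; the summand 1
    covers the others, where the combined exponent is nonpositive.\<close>
  define B where "B = 1 + (\<Sum>m<nat \<lceil>\<sigma>\<rceil>. exp (\<sigma> * wt \<rho> (norm (x m))))"
  have B1: "B \<ge> 1" by (simp add: B_def sum_nonneg)
  have le: "exp (\<sigma> * wt \<rho> (norm (x m))) * ?q m \<le> B" for m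
  proof (cases "m < nat \<lceil>\<sigma>\<rceil>")
    case True
    have "exp (\<sigma> * wt \<rho> (norm (x m))) * ?q m \<le> exp (\<sigma> * wt \<rho> (norm (x m))) * 1"
      by (intro mult_left_mono) (auto intro: mult_nonpos_nonneg)
    also have "\<dots> \<le> (\<Sum>m<nat \<lceil>\<sigma>\<rceil>. exp (\<sigma> * wt \<rho> (norm (x m))))"
      using True by (auto intro!: member_le_sum)
    finally show ?thesis by (simp add: B_def)
  next
    case False
    then have "\<sigma> \<le> real (Suc m)" by linarith
    then have "\<sigma> * wt \<rho> (norm (x m)) \<le> real (Suc m) * wt \<rho> (norm (x m))"
      by (intro mult_right_mono) auto
    then have "\<sigma> * wt \<rho> (norm (x m)) + - real (Suc m) * wt \<rho> (norm (x m)) \<le> 0"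
      by (simp add: algebra_simps)
    then have "exp (\<sigma> * wt \<rho> (norm (x m))) * ?q m \<le> 1"
      unfolding exp_add[symmetric] exp_le_one_iff .
    then show ?thesis using B1 by linarith
  qed
  have "g \<in> ?V" if g: "g \<in> A_sig \<rho> \<sigma>" "wnorm \<rho> \<sigma> g < s / B" for g
  proof -
    have b: "slice_bounded \<rho> \<sigma> (s / B) g"
      using slice_bounded_mono[OF slice_bounded_wnorm[OF g(1)]] g(2) by simp
    have "norm (g (x m)) * ?q m \<le> s" for m
    proof -
      have "norm (g (x m)) * ?q m \<le> s / B * exp (\<sigma> * wt \<rho> (norm (x m))) * ?q m"
        by (intro mult_right_mono slice_boundedD[OF b]) auto
      also have "\<dots> \<le> s / B * B"
        unfolding mult.assoc using le assms B1 by (intro mult_left_mono) auto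
      finally show ?thesis using B1 by simp
    qed
    then show ?thesis using g(1) \<sigma> by (auto simp: A_sp_def)
  qed
  then show "\<exists>\<epsilon>>0. {g \<in> A_sig \<rho> \<sigma>. wnorm \<rho> \<sigma> g < \<epsilon>} \<subseteq> ?V"
    using assms B1 by (intro exI[of _ "s / B"]) auto
qed

text \<open>Otherwise there are \<open>f\<^sub>m\<close> in the unit ball of one step and points \<open>x\<^sub>m\<close> such that \<open>T f\<^sub>m (x\<^sub>m)\<close>
  violates the \<open>m\<close>-th bound, and the neighbourhood of point evaluations at the \<open>x\<^sub>m\<close> does not absorb
  the sequence \<open>T f\<^sub>m\<close>.\<close>
lemma continuous_map_imp_step_bounded:
  fixes T :: "(real \<times> (real ^ ('n::{finite,linorder})) \<Rightarrow> 'n clif) \<Rightarrow> (real \<times> (real ^ ('n::{finite,linorder})) \<Rightarrow> 'n clif)"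
  assumes T: "continuous_map (A_top \<rho>1) (A_top \<rho>2) T" and lin: "real_linear_on (A_sp \<rho>1) T"
  shows "step_bounded \<rho>1 \<rho>2 T"
proof (rule ccontr)
  assume "\<not> step_bounded \<rho>1 \<rho>2 T"
  then obtain \<tau> where \<tau>: "\<tau> > 0" and n: "\<not> (\<exists>\<sigma>>0. \<exists>C>0. \<forall>f M.
      slice_bounded \<rho>1 \<tau> M f \<longrightarrow> slice_bounded \<rho>2 \<sigma> (C * M) (T f))"
    unfolding step_bounded_def not_all not_imp by (elim exE conjE)
  have ex: "\<exists>f M. slice_bounded \<rho>1 \<tau> M f \<and> \<not> slice_bounded \<rho>2 \<sigma> (C * M) (T f)"
    if "\<sigma> > 0" "C > 0" for \<sigma> C
  proof (rule ccontr)
    assume "\<not> ?thesis"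
    then have "\<forall>f M. slice_bounded \<rho>1 \<tau> M f \<longrightarrow> slice_bounded \<rho>2 \<sigma> (C * M) (T f)" by simp
    with n that show False by blast
  qed
  have TA: "T f \<in> A_sp \<rho>2" if "f \<in> A_sp \<rho>1" for f
    using T that by (auto simp: continuous_map_def)
  have T0: "T (\<lambda>x. 0) = (\<lambda>x. 0)"
    using real_linear_on_scaleR[OF lin A_sp_zero, of 0] by simp
  have "\<forall>m. \<exists>f M x. slice_bounded \<rho>1 \<tau> M f \<and> M > 0 \<and>
      norm (T f x) > real (Suc m) * M * exp (real (Suc m) * wt \<rho>2 (norm x))"
  proof
    fix m
    obtain f M where f: "slice_bounded \<rho>1 \<tau> M f" "\<not> slice_bounded \<rho>2 (real (Suc m)) (real (Suc m) * M) (T f)"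
      using ex[of "real (Suc m)" "real (Suc m)"] by auto
    have "f \<in> A_sp \<rho>1" using f(1) \<tau> A_sp_iff by blast
    then have "slice_monogenic (T f)" using TA A_sp_slice_monogenic by blast
    \<comment> \<open>A zero bound would force \<open>f = 0\<close>, whose image satisfies every
      bound. Positivity of \<open>M\<close> allows the counterexample to be rescaled later.\<close>
    moreover have "M \<noteq> 0"
    proof
      assume "M = 0"
      then show False using f slice_bounded_0_imp_zero[of \<rho>1 \<tau> f] T0 by (simp add: slice_bounded_zero)
    qed
    ultimately have "M > 0"
      "\<not> (\<forall>x. norm (T f x) \<le> real (Suc m) * M * exp (real (Suc m) * wt \<rho>2 (norm x)))"
      using f(2) slice_bounded_nonneg[OF f(1)] unfolding slice_bounded_def[of \<rho>2] by (simp, blast)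
    then show "\<exists>f M x. slice_bounded \<rho>1 \<tau> M f \<and> M > 0 \<and>
      norm (T f x) > real (Suc m) * M * exp (real (Suc m) * wt \<rho>2 (norm x))"
      using f(1) unfolding not_all not_le by blast
  qed
  then obtain f M x where f: "\<And>m. slice_bounded \<rho>1 \<tau> (M m) (f m)" and M: "\<And>m. M m > 0"
    and x: "\<And>m. norm (T (f m) (x m)) > real (Suc m) * M m * exp (real (Suc m) * wt \<rho>2 (norm (x m)))"
    by metis
  define q where "q m = exp (- real (Suc m) * wt \<rho>2 (norm (x m)))" for m
  \<comment> \<open>The uniform margin \<open>s < 1\<close>, instead of a strict inequality at each
    \<open>m\<close>, is what makes the set open: a perturbation of size \<open>(1 - s) / 2\<close>
    still leaves a margin.\<close>
  define U where "U = {g \<in> A_sp \<rho>2. \<exists>s<1. \<forall>m. norm (g (x m)) * q m \<le> s}"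
  have "openin (A_top \<rho>2) U"
    unfolding openin_A_top
  proof (intro conjI ballI)
    fix h assume "h \<in> U"
    then obtain s where h: "h \<in> A_sp \<rho>2" "s < 1" "\<And>m. norm (h (x m)) * q m \<le> s"
      by (auto simp: U_def)
    let ?V = "{g \<in> A_sp \<rho>2. \<forall>m. norm (g (x m)) * q m \<le> (1 - s) / 2}"
    have "lc_zero_nbhd \<rho>2 ?V"
      unfolding q_def using h(2) by (intro lc_zero_nbhd_point_evaluations) auto
    moreover have "(\<lambda>y. h y + g y) \<in> U" if g: "g \<in> ?V" for g
    proof -
      have "norm (h (x m) + g (x m)) * q m \<le> (1 + s) / 2" for m
      proof -
        have "norm (h (x m) + g (x m)) * q m \<le> (norm (h (x m)) + norm (g (x m))) * q m"
          by (intro mult_right_mono norm_triangle_ineq) (simp add: q_def)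
        also have "\<dots> \<le> s + (1 - s) / 2"
          using h(3)[of m] g unfolding distrib_right by (intro add_mono) auto
        finally show ?thesis by (simp add: field_simps)
      qed
      moreover have "(1 + s) / 2 < 1" using h(2) by simp
      moreover have "(\<lambda>y. h y + g y) \<in> A_sp \<rho>2"
        by (rule A_sp_add[OF h(1)]) (use g in simp)
      ultimately show ?thesis
        unfolding U_def mem_Collect_eq by (intro conjI exI[of _ "(1 + s) / 2"] allI)
    qed
    ultimately show "\<exists>V. lc_zero_nbhd \<rho>2 V \<and> (\<lambda>g x. h x + g x) ` V \<subseteq> U"
      by (intro exI[of _ ?V]) blast
  qed (auto simp: U_def)
  then have op: "openin (A_top \<rho>1) {f \<in> A_sp \<rho>1. T f \<in> U}"
    using T by (simp add: continuous_map_def)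
  have mem: "(\<lambda>x. 0) \<in> {f \<in> A_sp \<rho>1. T f \<in> U}"
    using A_sp_zero by (auto simp: U_def T0 intro!: exI[of _ 0])
  obtain W where W: "lc_zero_nbhd \<rho>1 W" "(\<lambda>g x. 0 + g x) ` W \<subseteq> {f \<in> A_sp \<rho>1. T f \<in> U}"
    using bspec[OF conjunct2[OF iffD1[OF openin_A_top op]] mem] by (elim exE conjE)
  obtain \<epsilon> where \<epsilon>: "\<epsilon> > 0" "{g \<in> A_sig \<rho>1 \<tau>. wnorm \<rho>1 \<tau> g < \<epsilon>} \<subseteq> W"
    by (rule lc_zero_nbhdE[OF W(1) \<tau>])
  have "\<epsilon> / 2 * real (Suc m) < 1" for m
  proof -
    \<comment> \<open>Rescaling to norm at most \<open>\<epsilon> / 2\<close> puts every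
      counterexample into the ball contained in \<open>W\<close>, while its violation still grows
      linearly in \<open>m\<close>.\<close>
    define c where "c = \<epsilon> / (2 * M m)"
    have c: "c > 0" "c * M m = \<epsilon> / 2" using \<epsilon>(1) M[of m] by (simp_all add: c_def)
    have b: "slice_bounded \<rho>1 \<tau> (\<epsilon> / 2) (\<lambda>x. c *\<^sub>R f m x)"
      using slice_bounded_scaleR[OF f[of m], of c] c by simp
    then have "(\<lambda>x. c *\<^sub>R f m x) \<in> A_sig \<rho>1 \<tau>" using A_sig_iff by blast
    moreover have "wnorm \<rho>1 \<tau> (\<lambda>x. c *\<^sub>R f m x) < \<epsilon>" using wnorm_le[OF b] \<epsilon>(1) by linarith
    ultimately have cW: "(\<lambda>x. c *\<^sub>R f m x) \<in> W" using \<epsilon>(2) by blast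
    have "T (\<lambda>x. c *\<^sub>R f m x) \<in> U"
      using subsetD[OF W(2) imageI[OF cW]] by simp
    moreover have "f m \<in> A_sp \<rho>1" using f[of m] \<tau> A_sp_iff by blast
    ultimately have "(\<lambda>x. c *\<^sub>R T (f m) x) \<in> U" using real_linear_on_scaleR[OF lin] by simp
    then obtain s where "s < 1" "norm (c *\<^sub>R T (f m) (x m)) * q m \<le> s"
      unfolding U_def by blast
    then have "c * (norm (T (f m) (x m)) * q m) < 1" using c(1) by simp
    moreover have "norm (T (f m) (x m)) * q m > real (Suc m) * M m"
    proof -
      have "real (Suc m) * M m = real (Suc m) * M m * exp (real (Suc m) * wt \<rho>2 (norm (x m))) * q m"
        by (simp only: q_def mult.assoc exp_add[symmetric] mult_minus_left add.right_inverse exp_zero mult_1_right)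
      also have "\<dots> < norm (T (f m) (x m)) * q m"
        using x[of m] by (intro mult_strict_right_mono) (auto simp: q_def)
      finally show ?thesis .
    qed
    then have "c * (real (Suc m) * M m) < c * (norm (T (f m) (x m)) * q m)"
      using c(1) by (rule mult_strict_left_mono)
    moreover have "c * (real (Suc m) * M m) = \<epsilon> / 2 * real (Suc m)"
      unfolding c(2)[symmetric] by (simp only: mult_ac)
    ultimately show ?thesis by linarith
  qed
  moreover obtain m where "real m > 2 / \<epsilon>" using reals_Archimedean2 by blast
  ultimately have "\<epsilon> / 2 * real (Suc m) < 1" "real m > 2 / \<epsilon>" by auto
  then show False using \<epsilon>(1) by (simp add: field_simps)
qed

text \<open>Norm convergence in a step controls each point evaluation. Limits are thus determined
  pointwise, which later identifies a given operator with the sum of its series.\<close>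

lemma conv_in_pointwise:
  assumes "conv_in \<rho> s g" shows "(\<lambda>N. s N x) \<longlonglongrightarrow> g x"
proof -
  obtain \<sigma> where \<sigma>: "\<sigma> > 0" "g \<in> A_sig \<rho> \<sigma>" "\<And>N. s N \<in> A_sig \<rho> \<sigma>"
    and lim: "(\<lambda>N. wnorm \<rho> \<sigma> (\<lambda>x. s N x - g x)) \<longlonglongrightarrow> 0"
    using assms by (auto simp: conv_in_def)
  have "norm (s N x - g x) \<le> wnorm \<rho> \<sigma> (\<lambda>x. s N x - g x) * exp (\<sigma> * wt \<rho> (norm x))" for N
  proof -
    from slice_bounded_lincomb[OF slice_bounded_wnorm[OF \<sigma>(3)] slice_bounded_wnorm[OF \<sigma>(2)], of 1 N "- 1"] have "(\<lambda>x. s N x - g x) \<in> A_sig \<rho> \<sigma>"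
      by (auto simp: A_sig_iff)
    from slice_bounded_wnorm[OF this] show ?thesis by (rule slice_boundedD)
  qed
  then have "(\<lambda>N. s N x - g x) \<longlonglongrightarrow> 0"
    by (intro Lim_null_comparison[OF always_eventually tendsto_mult_left_zero[OF lim]] allI)
  then show ?thesis by (simp add: LIM_zero_iff)
qed

section \<open>Series of slice monogenic functions and Cauchy estimates\<close>

text \<open>The constant is fixed before weight, exponent and function, so it is the same for all
  terms of a series.\<close>

lemma slice_bounded_ext:
  obtains K where "K > 0" "\<And>\<rho> \<sigma> N (H :: complex \<Rightarrow> complex ^ ('n::{finite,linorder} set)).
    stem H \<Longrightarrow> (\<And>z. norm (H z) \<le> N * exp (\<sigma> * wt \<rho> (norm z))) \<Longrightarrow> slice_bounded \<rho> \<sigma> (K * N) (slice_ext H)"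
proof -
  obtain K where K: "K > 0" "\<And>(H :: complex \<Rightarrow> complex ^ ('n set)) x.
      norm (slice_ext H x) \<le> K * norm (H (Complex (fst x) (norm (snd x))))"
    using norm_ext_le by blast
  show ?thesis
  proof (rule that[OF K(1)])
    fix \<rho> \<sigma> N and H :: "complex \<Rightarrow> complex ^ ('n set)"
    assume H: "stem H" and b: "\<And>z. norm (H z) \<le> N * exp (\<sigma> * wt \<rho> (norm z))"
    have "norm (slice_ext H x) \<le> K * N * exp (\<sigma> * wt \<rho> (norm x))" for x
    proof -
      have "norm (slice_ext H x) \<le> K * norm (H (Complex (fst x) (norm (snd x))))" by (rule K(2))
      also have "\<dots> \<le> K * (N * exp (\<sigma> * wt \<rho> (norm x)))"
        unfolding norm_prod_Complex[of x] using K(1) by (intro mult_left_mono b) auto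
      finally show ?thesis by (simp only: mult.assoc)
    qed
    then show "slice_bounded \<rho> \<sigma> (K * N) (slice_ext H)"
      unfolding slice_bounded_def using slice_monogenic_ext[OF H] by blast
  qed
qed

lemma stem_bound:
  obtains K where "K > 0" "\<And>\<rho> \<sigma> N (H :: complex \<Rightarrow> complex ^ ('n::{finite,linorder} set)) z.
    stem H \<Longrightarrow> slice_bounded \<rho> \<sigma> N (slice_ext H) \<Longrightarrow> norm (H z) \<le> K * N * exp (\<sigma> * wt \<rho> (norm z))"
proof -
  obtain K where K: "K > 0" and *: "\<forall>(H :: complex \<Rightarrow> complex ^ ('n set)) B z. stem H \<longrightarrow>
    (\<forall>x. norm (slice_ext H x) \<le> B (norm x)) \<longrightarrow> norm (H z) \<le> K * B (norm z)"
    using norm_stem_le by blast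
  show ?thesis
  proof (rule that[OF K])
    fix \<rho> \<sigma> N z and H :: "complex \<Rightarrow> complex ^ ('n set)"
    assume H: "stem H" and b: "slice_bounded \<rho> \<sigma> N (slice_ext H)"
    have "norm (H z) \<le> K * (N * exp (\<sigma> * wt \<rho> (norm z)))"
      using *[rule_format, of H "\<lambda>r. N * exp (\<sigma> * wt \<rho> r)", OF H] slice_boundedD[OF b] by blast
    then show "norm (H z) \<le> K * N * exp (\<sigma> * wt \<rho> (norm z))" by (simp only: mult.assoc)
  qed
qed

lemma suminf_half: "(\<Sum>l. K * (1 / 2) ^ l :: real) = 2 * K" and summable_half: "summable (\<lambda>l. K * (1 / 2 :: real) ^ l)"
  by (simp_all add: suminf_mult suminf_geometric summable_mult summable_geometric)

text \<open>Holomorphy passes to the limit at the level of stem functions: the weight is bounded on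
  discs, so the geometric factor gives uniform convergence there.\<close>

lemma slice_bounded_suminf:
  fixes F :: "nat \<Rightarrow> real \<times> (real ^ ('n::{finite,linorder})) \<Rightarrow> 'n clif"
  assumes po: "proximate_order \<rho> p" and \<sigma>: "\<sigma> > 0"
    and F: "\<And>l. slice_bounded \<rho> \<sigma> (K * (1 / 2) ^ l) (F l)"
  shows "summable (\<lambda>l. F l x)" and "slice_bounded \<rho> \<sigma> (2 * K) (\<lambda>x. \<Sum>l. F l x)"
proof -
  have nF: "norm (F l x) \<le> K * exp (\<sigma> * wt \<rho> (norm x)) * (1 / 2) ^ l" for l x
    using slice_boundedD[OF F, of l x] by (simp add: mult_ac)
  show sF: "summable (\<lambda>l. F l x)" for x
    by (rule summable_comparison_test'[OF summable_half nF])
  obtain C where C: "C > 0" "\<And>\<rho> \<sigma> N (H :: complex \<Rightarrow> complex ^ ('n set)) z.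
    stem H \<Longrightarrow> slice_bounded \<rho> \<sigma> N (slice_ext H) \<Longrightarrow> norm (H z) \<le> C * N * exp (\<sigma> * wt \<rho> (norm z))"
    by (rule stem_bound) blast
  have "\<forall>l. \<exists>H. stem H \<and> F l = slice_ext H"
    unfolding slice_monogenic_iff[symmetric] using slice_bounded_slice_monogenic[OF F] by (rule allI)
  from choice[OF this] obtain H where H: "\<And>l. stem (H l)" "\<And>l. F l = slice_ext (H l)" by blast
  have nH: "norm (H l z) \<le> C * K * exp (\<sigma> * wt \<rho> (norm z)) * (1 / 2) ^ l" for l z
    using C(2)[OF H(1) F[of l, unfolded H(2)], of z] by (simp add: mult_ac)
  have sH: "summable (\<lambda>l. H l z)" for z
    by (rule summable_comparison_test'[OF summable_half nH])
  define G where "G z = (\<Sum>l. H l z)" for z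
  have G: "G z $ A = (\<Sum>l. H l z $ A)" for z A
    unfolding G_def by (rule bounded_linear.suminf[OF bounded_linear_vec_nth sH])
  have "stem G"
    unfolding stem_def
  proof (intro conjI allI)
    fix A
    show "(\<lambda>z. G z $ A) holomorphic_on UNIV"
    proof (rule holomorphic_uniform_sequence[of _ "\<lambda>N z. \<Sum>l<N. H l z $ A"])
      show "(\<lambda>z. \<Sum>l<N. H l z $ A) holomorphic_on UNIV" for N
        by (intro holomorphic_intros stem_holomorphic H)
      fix z :: complex
      obtain B where B: "\<And>r. 0 \<le> r \<Longrightarrow> r \<le> norm z + 1 \<Longrightarrow> wt \<rho> r \<le> B"
        by (rule proximate_order_wt_bounded[OF po, of "norm z + 1"]) blast
      have "uniform_limit (cball z 1) (\<lambda>N w. \<Sum>l<N. H l w $ A) (\<lambda>w. \<Sum>l. H l w $ A) sequentially"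
      proof (rule Weierstrass_m_test)
        show "summable (\<lambda>l. C * K * exp (\<sigma> * B) * (1 / 2) ^ l)" by (rule summable_half)
        fix l w assume "w \<in> cball z 1"
        then have "norm w \<le> norm z + 1"
          using norm_triangle_ineq2[of w z] by (simp add: dist_norm norm_minus_commute)
        then have "\<sigma> * wt \<rho> (norm w) \<le> \<sigma> * B" using B \<sigma> by (intro mult_left_mono) auto
        moreover have "C * K \<ge> 0" using C(1) slice_bounded_nonneg[OF F[of 0]] by simp
        ultimately have "C * K * exp (\<sigma> * wt \<rho> (norm w)) * (1 / 2) ^ l \<le> C * K * exp (\<sigma> * B) * (1 / 2) ^ l"
          by (intro mult_right_mono mult_left_mono) auto
        then show "norm (H l w $ A) \<le> C * K * exp (\<sigma> * B) * (1 / 2) ^ l"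
          using nH[of l w] Finite_Cartesian_Product.norm_nth_le[of "H l w" A] by linarith
      qed
      then show "\<exists>d>0. cball z d \<subseteq> UNIV \<and>
          uniform_limit (cball z d) (\<lambda>N z. \<Sum>l<N. H l z $ A) (\<lambda>z. G z $ A) sequentially"
        unfolding G by (intro exI[of _ 1]) auto
    qed auto
  next
    fix z A
    have "summable (\<lambda>l. H l z $ A)" by (rule bounded_linear.summable[OF bounded_linear_vec_nth sH])
    from bounded_linear.suminf[OF bounded_linear_cnj this]
    show "G (cnj z) $ A = cnj (G z $ A)" unfolding G by (simp add: stem_cnj[OF H(1)])
  qed
  moreover have "(\<lambda>x. \<Sum>l. F l x) = slice_ext G"
    unfolding slice_ext_def G_def H(2) bounded_linear.suminf[OF bounded_linear_slice_val sH] ..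
  ultimately have "slice_monogenic (\<lambda>x. \<Sum>l. F l x)"
    by (simp only: slice_monogenic_ext)
  moreover have "norm (\<Sum>l. F l x) \<le> 2 * K * exp (\<sigma> * wt \<rho> (norm x))" for x
  proof -
    have sn: "summable (\<lambda>l. norm (F l x))"
      by (rule summable_comparison_test'[OF summable_half[of "K * exp (\<sigma> * wt \<rho> (norm x))"]]) (use nF in simp)
    have "norm (\<Sum>l. F l x) \<le> (\<Sum>l. norm (F l x))" by (rule summable_norm[OF sn])
    also have "\<dots> \<le> (\<Sum>l. K * exp (\<sigma> * wt \<rho> (norm x)) * (1 / 2) ^ l)"
      by (rule suminf_le[OF nF sn summable_half])
    finally show ?thesis unfolding suminf_half by (simp only: mult.assoc)
  qed
  ultimately show "slice_bounded \<rho> \<sigma> (2 * K) (\<lambda>x. \<Sum>l. F l x)"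
    unfolding slice_bounded_def by blast
qed

text \<open>The tail is a series of the same kind, with \<open>K\<close> replaced by
  \<open>K * (1 / 2) ^ N\<close>.\<close>

lemma slice_bounded_suminf_tail:
  fixes F :: "nat \<Rightarrow> real \<times> (real ^ ('n::{finite,linorder})) \<Rightarrow> 'n clif"
  assumes po: "proximate_order \<rho> p" and \<sigma>: "\<sigma> > 0"
    and F: "\<And>l. slice_bounded \<rho> \<sigma> (K * (1 / 2) ^ l) (F l)"
  shows "slice_bounded \<rho> \<sigma> (2 * K * (1 / 2) ^ N) (\<lambda>x. (\<Sum>l. F l x) - (\<Sum>l<N. F l x))"
proof -
  have "(\<Sum>l. F l x) - (\<Sum>l<N. F l x) = (\<Sum>l. F (l + N) x)" for x
    using suminf_split_initial_segment[OF slice_bounded_suminf(1)[OF assms], of x N] by simp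
  moreover have "slice_bounded \<rho> \<sigma> (K * (1 / 2) ^ N * (1 / 2) ^ l) (F (l + N))" for l
    using F[of "l + N"] by (simp add: power_add mult_ac)
  from slice_bounded_suminf(2)[OF po \<sigma> this]
  have "slice_bounded \<rho> \<sigma> (2 * (K * (1 / 2) ^ N)) (\<lambda>x. \<Sum>l. F (l + N) x)" .
  ultimately show ?thesis by (simp add: mult.assoc)
qed

lemma conv_in_suminf:
  fixes F :: "nat \<Rightarrow> real \<times> (real ^ ('n::{finite,linorder})) \<Rightarrow> 'n clif"
  assumes po: "proximate_order \<rho> p" and \<sigma>: "\<sigma> > 0"
    and F: "\<And>l. slice_bounded \<rho> \<sigma> (K * (1 / 2) ^ l) (F l)"
  shows "conv_in \<rho> (\<lambda>N x. \<Sum>l<N. F l x) (\<lambda>x. \<Sum>l. F l x)"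
proof -
  note G = slice_bounded_suminf(2)[OF assms] and tail = slice_bounded_suminf_tail[OF assms]
  have tail': "slice_bounded \<rho> \<sigma> (2 * K * (1 / 2) ^ N) (\<lambda>x. (\<Sum>l<N. F l x) - (\<Sum>l. F l x))" for N
    using slice_bounded_scaleR[OF tail, of "- 1" N] by simp
  have part: "(\<lambda>x. \<Sum>l<N. F l x) \<in> A_sig \<rho> \<sigma>" for N
  proof -
    have "slice_bounded \<rho> \<sigma> (\<bar>1\<bar> * (2 * K) + \<bar>- 1\<bar> * (2 * K * (1 / 2) ^ N))
      (\<lambda>x. 1 *\<^sub>R (\<Sum>l. F l x) + - 1 *\<^sub>R ((\<Sum>l. F l x) - (\<Sum>l<N. F l x)))"
      by (rule slice_bounded_lincomb[OF G tail])
    then have "slice_bounded \<rho> \<sigma> (2 * K + 2 * K * (1 / 2) ^ N) (\<lambda>x. \<Sum>l<N. F l x)" by simp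
    then show ?thesis unfolding A_sig_iff by (rule exI)
  qed
  have le: "norm (wnorm \<rho> \<sigma> (\<lambda>x. (\<Sum>l<N. F l x) - (\<Sum>l. F l x))) \<le> 2 * K * (1 / 2) ^ N" for N
  proof -
    have "(\<lambda>x. (\<Sum>l<N. F l x) - (\<Sum>l. F l x)) \<in> A_sig \<rho> \<sigma>"
      using tail' unfolding A_sig_iff by (rule exI)
    from slice_bounded_nonneg[OF slice_bounded_wnorm[OF this]] wnorm_le[OF tail', of N]
    show ?thesis by simp
  qed
  have "(\<lambda>N. 2 * K * (1 / 2) ^ N) \<longlonglongrightarrow> 0"
    by (intro tendsto_mult_right_zero LIMSEQ_power_zero) simp
  then have "(\<lambda>N. wnorm \<rho> \<sigma> (\<lambda>x. (\<Sum>l<N. F l x) - (\<Sum>l. F l x))) \<longlonglongrightarrow> 0"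
    by (rule Lim_null_comparison[OF always_eventually[OF allI[OF le]]])
  moreover have "(\<lambda>x. \<Sum>l. F l x) \<in> A_sig \<rho> \<sigma>"
    unfolding A_sig_iff using G by (rule exI)
  ultimately show ?thesis
    unfolding conv_in_def by (intro exI[of _ \<sigma>] conjI allI \<sigma> part)
qed

section \<open>Linearity of the operator series in its argument\<close>

lemma stem_deriv_lincomb:
  assumes "stem H" "stem K"
  shows "stem_deriv (\<lambda>z. a *\<^sub>R H z + b *\<^sub>R K z) = (\<lambda>z. a *\<^sub>R stem_deriv H z + b *\<^sub>R stem_deriv K z)"
proof (intro HOL.ext vec_eq_iff[THEN iffD2] allI)
  fix z A
  have "((\<lambda>w. of_real a * H w $ A + of_real b * K w $ A) has_field_derivative
      of_real a * stem_deriv H z $ A + of_real b * stem_deriv K z $ A) (at z)"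
    by (intro DERIV_add DERIV_cmult stem_has_field_derivative assms)
  from DERIV_imp_deriv[OF this]
  show "stem_deriv (\<lambda>z. a *\<^sub>R H z + b *\<^sub>R K z) z $ A = (a *\<^sub>R stem_deriv H z + b *\<^sub>R stem_deriv K z) $ A"
    by (simp add: stem_deriv_def[of "\<lambda>z. a *\<^sub>R H z + b *\<^sub>R K z"] scaleR_conv_of_real[where 'a = complex])
qed

lemma iter_stem_deriv_lincomb:
  assumes "stem H" "stem K"
  shows "(stem_deriv ^^ l) (\<lambda>z. a *\<^sub>R H z + b *\<^sub>R K z)
    = (\<lambda>z. a *\<^sub>R (stem_deriv ^^ l) H z + b *\<^sub>R (stem_deriv ^^ l) K z)"
  by (induction l) (simp_all add: stem_deriv_lincomb stem_iter_deriv assms)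

lemma ext_lincomb: "slice_ext (\<lambda>z. a *\<^sub>R H z + b *\<^sub>R K z) = (\<lambda>x. a *\<^sub>R slice_ext H x + b *\<^sub>R slice_ext K x)"
  using ext_add[of "\<lambda>z. a *\<^sub>R H z" "\<lambda>z. b *\<^sub>R K z"] by (simp add: ext_scaleR)

lemma star_iter_dx0_ext:
  "stem U \<Longrightarrow> stem H \<Longrightarrow>
    star (slice_ext U) ((dx0 ^^ l) (slice_ext H)) = slice_ext (\<lambda>z. cxmult (U z) ((stem_deriv ^^ l) H z))"
  by (simp add: iter_dx0_ext star_ext stem_iter_deriv)

lemma star_iter_dx0_lincomb:
  assumes "slice_monogenic u" "slice_monogenic f" "slice_monogenic g"
  shows "star u ((dx0 ^^ l) (\<lambda>x. a *\<^sub>R f x + b *\<^sub>R g x)) x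
    = a *\<^sub>R star u ((dx0 ^^ l) f) x + b *\<^sub>R star u ((dx0 ^^ l) g) x"
proof -
  obtain U where U: "stem U" "u = slice_ext U" using assms(1) slice_monogenic_iff by blast
  obtain H where H: "stem H" "f = slice_ext H" using assms(2) slice_monogenic_iff by blast
  obtain K where K: "stem K" "g = slice_ext K" using assms(3) slice_monogenic_iff by blast
  have HK: "stem (\<lambda>z. a *\<^sub>R H z + b *\<^sub>R K z)" by (intro stem_add stem_scaleR H K)
  have "star u ((dx0 ^^ l) (\<lambda>x. a *\<^sub>R f x + b *\<^sub>R g x))
      = slice_ext (\<lambda>z. a *\<^sub>R cxmult (U z) ((stem_deriv ^^ l) H z) + b *\<^sub>R cxmult (U z) ((stem_deriv ^^ l) K z))"
    unfolding U(2) H(2) K(2) ext_lincomb[symmetric] star_iter_dx0_ext[OF U(1) HK]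
      iter_stem_deriv_lincomb[OF H(1) K(1)]
    by (simp add: cxmult.add_right cxmult.scaleR_right)
  then show ?thesis
    unfolding ext_lincomb U(2) H(2) K(2) star_iter_dx0_ext[OF U(1) H(1)] star_iter_dx0_ext[OF U(1) K(1)]
    by simp
qed

text \<open>\<open>T\<close> is given only through its limits; linearity is inherited pointwise from
  the partial sums.\<close>

lemma real_linear_on_op_series_limit:
  fixes T :: "(real \<times> (real ^ ('n::{finite,linorder})) \<Rightarrow> 'n clif) \<Rightarrow> (real \<times> (real ^ ('n::{finite,linorder})) \<Rightarrow> 'n clif)"
  assumes u: "\<And>l. slice_monogenic (u l)"
    and T: "\<And>f. f \<in> A_sp \<rho>1 \<Longrightarrow> conv_in \<rho>2 (op_series u f) (T f)"
  shows "real_linear_on (A_sp \<rho>1) T"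
  unfolding real_linear_on_def
proof (intro ballI allI HOL.ext)
  fix f g :: "real \<times> (real, 'n) vec \<Rightarrow> 'n clif" and a b x
  assume f: "f \<in> A_sp \<rho>1" and g: "g \<in> A_sp \<rho>1"
  let ?h = "\<lambda>x. a *\<^sub>R f x + b *\<^sub>R g x"
  have "op_series u ?h N x = a *\<^sub>R op_series u f N x + b *\<^sub>R op_series u g N x" for N
    unfolding op_series_def
    by (simp add: star_iter_dx0_lincomb[OF u A_sp_slice_monogenic[OF f] A_sp_slice_monogenic[OF g]]
        sum.distrib scaleR_sum_right)
  moreover have "(\<lambda>N. a *\<^sub>R op_series u f N x + b *\<^sub>R op_series u g N x) \<longlonglongrightarrow> a *\<^sub>R T f x + b *\<^sub>R T g x"
    by (intro tendsto_intros conv_in_pointwise[OF T] f g)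
  moreover have "(\<lambda>N. op_series u ?h N x) \<longlonglongrightarrow> T ?h x"
    by (rule conv_in_pointwise[OF T[OF A_sp_lincomb[OF f g]]])
  ultimately show "T ?h x = a *\<^sub>R T f x + b *\<^sub>R T g x"
    using LIMSEQ_unique by simp
qed

section \<open>Cauchy estimates for iterated derivatives\<close>

lemma norm_vec_le_sum: "norm (v :: 'b::real_normed_vector ^ 'm) \<le> (\<Sum>A\<in>UNIV. norm (v $ A))"
  unfolding norm_vec_def by (rule L2_set_le_sum) simp

context normalized_order
begin

text \<open>Because \<open>wt \<rho>h (phi \<rho>h l) = l\<close>, the weight on the circle
  contributes a factor geometric in \<open>l\<close>, with a ratio \<open>B\<close> depending on
  \<open>\<tau>\<close>. The power of \<open>phi\<close> stays on the left, where it matches the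
  numerator of \<open>Gnum\<close>.\<close>

lemma iter_stem_deriv_bound:
  assumes \<tau>: "\<tau> > 0"
  obtains \<sigma> B C where "\<sigma> > 0" "B > 0" "C > 0"
    "\<And>(H :: complex \<Rightarrow> complex ^ 'm) N l z. stem H \<Longrightarrow>
      (\<And>z. norm (H z) \<le> N * exp (\<tau> * wt \<rho>h (norm z))) \<Longrightarrow>
      phi \<rho>h l ^ l * norm ((stem_deriv ^^ l) H z) \<le> C * N * fact l * B ^ l * exp (\<sigma> * wt \<rho>h (norm z))"
proof -
  obtain K c where K: "K \<ge> 1" "c \<ge> 0"
    and add: "\<And>r s. r \<ge> 0 \<Longrightarrow> s \<ge> 0 \<Longrightarrow> wt \<rho>h (r + s) \<le> K * (wt \<rho>h r + wt \<rho>h s) + c"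
    by (rule wt_add_le) blast
  define B where "B = exp (\<tau> * K)"
  \<comment> \<open>Cauchy's inequality is applied to each coordinate, whence their number; the
    exponential is the additive constant of \<open>wt_add_le\<close>.\<close>
  define C where "C = real CARD('m) * exp (\<tau> * c)"
  have "CARD('m) \<ge> 1" using zero_less_card_finite[where 'a = 'm] by linarith
  then have "real CARD('m) * exp (\<tau> * c) \<ge> 1 * 1"
    using \<tau> K(2) by (intro mult_mono) auto
  then have C: "C \<ge> 1" by (simp add: C_def)
  show ?thesis
  proof (rule that[of "\<tau> * K" B C])
    show "\<tau> * K > 0" "B > 0" "C > 0" using \<tau> K C by (simp_all add: B_def)
    fix H :: "complex \<Rightarrow> complex ^ 'm" and N l z
    assume H: "stem H" and b: "\<And>z. norm (H z) \<le> N * exp (\<tau> * wt \<rho>h (norm z))"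
    have N: "N \<ge> 0"
      using order_trans[OF norm_ge_zero b[of 0]] by simp
    show "phi \<rho>h l ^ l * norm ((stem_deriv ^^ l) H z)
        \<le> C * N * fact l * B ^ l * exp (\<tau> * K * wt \<rho>h (norm z))"
    \<comment> \<open>\<open>phi \<rho>h 0\<close> is unspecified and offers no circle, so order 0
      uses the bound on \<open>H\<close> itself.\<close>
    proof (cases "l = 0")
      case True
      have "norm (H z) \<le> N * exp (\<tau> * wt \<rho>h (norm z))" by (rule b)
      also have "\<dots> \<le> (C * N) * exp (\<tau> * K * wt \<rho>h (norm z))"
      proof (intro mult_mono)
        show "N \<le> C * N" using mult_right_mono[OF C N] by simp
        have "\<tau> * 1 * wt \<rho>h (norm z) \<le> \<tau> * K * wt \<rho>h (norm z)"
          using \<tau> K by (intro mult_right_mono mult_left_mono) auto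
        then show "exp (\<tau> * wt \<rho>h (norm z)) \<le> exp (\<tau> * K * wt \<rho>h (norm z))" by simp
      qed (use N C in auto)
      finally show ?thesis using True by simp
    next
      case False
      then have l: "l > 0" by simp
      note s = phi[OF l]
      define D where "D = N * exp (\<tau> * (K * (wt \<rho>h (norm z) + real l) + c))"
      have comp: "norm ((stem_deriv ^^ l) H z $ A) \<le> fact l * D / phi \<rho>h l ^ l" for A
        unfolding iter_stem_deriv_nth
      proof (rule Cauchy_inequality[OF stem_holomorphic[OF H] _ s(1)])
        show "continuous_on (cball z (phi \<rho>h l)) (\<lambda>w. H w $ A)"
          by (rule holomorphic_on_imp_continuous_on[OF stem_holomorphic[OF H]])
        fix x assume "norm (z - x) = phi \<rho>h l"
        then have "norm x \<le> norm z + phi \<rho>h l"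
          using norm_triangle_ineq2[of x z] by (simp add: norm_minus_commute)
        then have "wt \<rho>h (norm x) \<le> wt \<rho>h (norm z + phi \<rho>h l)" by (intro wt_mono) auto
        also have "\<dots> \<le> K * (wt \<rho>h (norm z) + real l) + c"
          using add[of "norm z" "phi \<rho>h l"] s by simp
        finally have "\<tau> * wt \<rho>h (norm x) \<le> \<tau> * (K * (wt \<rho>h (norm z) + real l) + c)"
          using \<tau> by (intro mult_left_mono) auto
        then have "N * exp (\<tau> * wt \<rho>h (norm x)) \<le> D"
          unfolding D_def using N by (intro mult_left_mono) auto
        then show "norm (H x $ A) \<le> D"
          using b[of x] Finite_Cartesian_Product.norm_nth_le[of "H x" A] by linarith
      qed
      have "norm ((stem_deriv ^^ l) H z) \<le> (\<Sum>A\<in>(UNIV :: 'm set). fact l * D / phi \<rho>h l ^ l)"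
        by (rule order_trans[OF norm_vec_le_sum sum_mono[OF comp]])
      then have "phi \<rho>h l ^ l * norm ((stem_deriv ^^ l) H z)
          \<le> phi \<rho>h l ^ l * (real CARD('m) * (fact l * D / phi \<rho>h l ^ l))"
        using s by (intro mult_left_mono) auto
      also have "\<dots> = real CARD('m) * fact l * D" using s by simp
      also have "D = N * exp (\<tau> * c) * B ^ l * exp (\<tau> * K * wt \<rho>h (norm z))"
        unfolding D_def B_def exp_of_nat_mult[symmetric] mult.assoc exp_add[symmetric]
        by (simp add: algebra_simps)
      finally show ?thesis by (simp add: C_def mult_ac)
    qed
  qed
qed

end

section \<open>Operators from symbols\<close>

text \<open>The form in which weight comparisons enter the estimates: the additive constant leaves
  the exponent and becomes a factor.\<close>

lemma exp_mult_le_exp: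
  fixes t :: real
  assumes "t \<ge> 0" "a \<le> m * b + c"
  shows "exp (t * a) \<le> exp (t * c) * exp (t * m * b)"
proof -
  have "t * a \<le> t * (m * b + c)" using assms by (intro mult_left_mono)
  then show ?thesis unfolding exp_add[symmetric] exp_le_cancel_iff by (simp add: algebra_simps)
qed

text \<open>The weights of \<open>\<rho>1\<close> and \<open>\<rho>h\<close> are interchangeable up
  to \<open>c\<close>; the third comparison carries the growth hypothesis relating the two orders.
  The factors \<open>1\<close> keep all three in the shape required by
  \<open>exp_mult_le_exp\<close>.\<close>

locale order_pair = normalized_order \<rho>h \<rho> for \<rho>h \<rho> +
  fixes \<rho>1 \<rho>2 :: "real \<Rightarrow> real" and p1 p2 c M :: real
  assumes po1: "proximate_order \<rho>1 p1" and po2: "proximate_order \<rho>2 p2"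
    and c: "c \<ge> 0" and M: "M > 0"
    and le1: "\<And>r. r \<ge> 0 \<Longrightarrow> wt \<rho>1 r \<le> 1 * wt \<rho>h r + c"
    and le2: "\<And>r. r \<ge> 0 \<Longrightarrow> wt \<rho>h r \<le> 1 * wt \<rho>1 r + c"
    and le3: "\<And>r. r \<ge> 0 \<Longrightarrow> wt \<rho>h r \<le> M * wt \<rho>2 r + c"
begin

lemma stem_bound_normalized:
  assumes "\<tau> > 0"
  obtains K where "K > 0" "\<And>N (H :: complex \<Rightarrow> complex ^ ('n::{finite,linorder} set)) z.
    stem H \<Longrightarrow> slice_bounded \<rho>1 \<tau> N (slice_ext H) \<Longrightarrow> norm (H z) \<le> K * N * exp (\<tau> * wt \<rho>h (norm z))"
proof -
  obtain K where K: "K > 0" "\<And>\<rho> \<sigma> N (H :: complex \<Rightarrow> complex ^ ('n set)) z.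
    stem H \<Longrightarrow> slice_bounded \<rho> \<sigma> N (slice_ext H) \<Longrightarrow> norm (H z) \<le> K * N * exp (\<sigma> * wt \<rho> (norm z))"
    by (rule stem_bound) blast
  show ?thesis
  proof (rule that[of "K * exp (\<tau> * c)"])
    show "K * exp (\<tau> * c) > 0" using K(1) by simp
    fix N z and H :: "complex \<Rightarrow> complex ^ ('n set)"
    assume H: "stem H" "slice_bounded \<rho>1 \<tau> N (slice_ext H)"
    have "norm (H z) \<le> K * N * exp (\<tau> * wt \<rho>1 (norm z))" by (rule K(2)[OF H])
    also have "\<dots> \<le> K * N * (exp (\<tau> * c) * exp (\<tau> * 1 * wt \<rho>h (norm z)))"
      using K(1) slice_bounded_nonneg[OF H(2)] assms
      by (intro mult_left_mono exp_mult_le_exp le1) auto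
    finally show "norm (H z) \<le> K * exp (\<tau> * c) * N * exp (\<tau> * wt \<rho>h (norm z))"
      by (simp add: mult_ac)
  qed
qed

lemma op_term_bound:
  fixes u :: "nat \<Rightarrow> real \<times> (real ^ ('n::{finite,linorder})) \<Rightarrow> 'n clif"
  assumes cc: "coeff_cond \<rho>h \<rho> \<rho>2 u" and \<tau>: "\<tau> > 0"
  obtains \<sigma> C where "\<sigma> > 0" "C > 0"
    "\<And>f N l. slice_bounded \<rho>1 \<tau> N f \<Longrightarrow>
      slice_bounded \<rho>2 \<sigma> (C * N * (1 / 2) ^ l) (star (u l) ((dx0 ^^ l) f))"
proof -
  define Q where "Q = (exp 1 * \<rho>) powr (1 / \<rho>)"
  have Q: "Q > 0" using order_pos by (simp add: Q_def)
  obtain \<sigma>1 B C1 where B: "\<sigma>1 > 0" "B > 0" "C1 > 0"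
    and der: "\<And>(H :: complex \<Rightarrow> complex ^ ('n set)) N l z. stem H \<Longrightarrow>
      (\<And>z. norm (H z) \<le> N * exp (\<tau> * wt \<rho>h (norm z))) \<Longrightarrow>
      phi \<rho>h l ^ l * norm ((stem_deriv ^^ l) H z) \<le> C1 * N * fact l * B ^ l * exp (\<sigma>1 * wt \<rho>h (norm z))"
    by (rule iter_stem_deriv_bound[OF \<tau>]) blast
  obtain Ks where Ks: "Ks > 0" "\<And>\<rho> \<sigma> N (H :: complex \<Rightarrow> complex ^ ('n set)) z.
    stem H \<Longrightarrow> slice_bounded \<rho> \<sigma> N (slice_ext H) \<Longrightarrow> norm (H z) \<le> Ks * N * exp (\<sigma> * wt \<rho> (norm z))"
    by (rule stem_bound) blast
  obtain Kn where Kn: "Kn > 0" "\<And>N (H :: complex \<Rightarrow> complex ^ ('n set)) z.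
    stem H \<Longrightarrow> slice_bounded \<rho>1 \<tau> N (slice_ext H) \<Longrightarrow> norm (H z) \<le> Kn * N * exp (\<tau> * wt \<rho>h (norm z))"
    by (rule stem_bound_normalized[OF \<tau>]) blast
  obtain Ke where Ke: "Ke > 0" "\<And>\<rho> \<sigma> N (H :: complex \<Rightarrow> complex ^ ('n set)).
    stem H \<Longrightarrow> (\<And>z. norm (H z) \<le> N * exp (\<sigma> * wt \<rho> (norm z))) \<Longrightarrow> slice_bounded \<rho> \<sigma> (Ke * N) (slice_ext H)"
    by (rule slice_bounded_ext) blast
  obtain Kb where Kb: "Kb > 0" "\<And>a b :: complex ^ ('n set). norm (cxmult a b) \<le> norm a * norm b * Kb"
    using cxmult.pos_bounded by blast
  \<comment> \<open>This is the \<open>\<epsilon>\<close> used: \<open>Q\<close> cancels the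
    normalizing root in \<open>Gnum_eq\<close>, \<open>B\<close> the geometric growth of the
    derivatives, and 2 leaves the ratio \<open>1 / 2\<close>. It depends on \<open>\<tau>\<close>
    through \<open>B\<close>.\<close>
  have "Q / (2 * B) > 0" using Q B by simp
  then obtain \<sigma>2 C2 where C2: "\<sigma>2 > 0" "C2 > 0"
    and u: "\<And>l. u l \<in> A_sig \<rho>2 \<sigma>2"
    and wu: "\<And>l. wnorm \<rho>2 \<sigma>2 (u l) \<le> C2 * Gnum \<rho>h \<rho> l / fact l * (Q / (2 * B)) ^ l"
    using cc unfolding coeff_cond_def by blast
  \<comment> \<open>The derivative is bounded in the weight of \<open>\<rho>h\<close>; passing to
    \<open>\<rho>2\<close> multiplies its exponent by \<open>M\<close>.\<close>
  define \<sigma> where "\<sigma> = \<sigma>2 + \<sigma>1 * M"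
  define C where "C = Ke * (Kb * Ks * C2 * C1 * Kn * exp (\<sigma>1 * c))"
  show ?thesis
  proof (rule that[of \<sigma> C])
    show "\<sigma> > 0" "C > 0"
      using B C2 M Ks Kn Ke Kb by (simp_all add: \<sigma>_def C_def add_pos_pos)
    fix f :: "real \<times> (real, 'n) vec \<Rightarrow> 'n clif" and N l
    assume f: "slice_bounded \<rho>1 \<tau> N f"
    have N: "N \<ge> 0" using slice_bounded_nonneg[OF f] .
    obtain H where H: "stem H" "f = slice_ext H"
      using slice_bounded_slice_monogenic[OF f] unfolding slice_monogenic_iff by blast
    obtain U where U: "stem U" "u l = slice_ext U"
      using slice_bounded_slice_monogenic[OF slice_bounded_wnorm[OF u[of l]]]
      unfolding slice_monogenic_iff by blast
    have uph: "slice_bounded \<rho>2 \<sigma>2 (C2 * phi \<rho>h l ^ l / fact l * (1 / (2 * B)) ^ l) (slice_ext U)"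
    proof (rule slice_bounded_mono[OF slice_bounded_wnorm[OF u[of l], unfolded U(2)] order_refl])
      show "wnorm \<rho>2 \<sigma>2 (slice_ext U) \<le> C2 * phi \<rho>h l ^ l / fact l * (1 / (2 * B)) ^ l"
        using wu[of l] Q unfolding U(2) Gnum_eq Q_def[symmetric]
        by (simp add: power_divide power_mult_distrib)
    qed
    let ?d = "\<lambda>z. norm ((stem_deriv ^^ l) H z)"
    have prod: "norm (cxmult (U z) ((stem_deriv ^^ l) H z))
        \<le> Kb * Ks * C2 * C1 * Kn * exp (\<sigma>1 * c) * N * (1 / 2) ^ l * exp (\<sigma> * wt \<rho>2 (norm z))" for z
    proof -
      have nU: "norm (U z) \<le> Ks * (C2 * phi \<rho>h l ^ l / fact l * (1 / (2 * B)) ^ l) * exp (\<sigma>2 * wt \<rho>2 (norm z))"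
        by (rule Ks(2)[OF U(1) uph])
      have nH: "phi \<rho>h l ^ l * ?d z \<le> C1 * (Kn * N) * fact l * B ^ l * exp (\<sigma>1 * wt \<rho>h (norm z))"
        using der[OF H(1) Kn(2)[OF H(1) f[unfolded H(2)]]] .
      have "norm (cxmult (U z) ((stem_deriv ^^ l) H z)) \<le> norm (U z) * ?d z * Kb" by (rule Kb(2))
      also have "\<dots> \<le> Ks * (C2 * phi \<rho>h l ^ l / fact l * (1 / (2 * B)) ^ l) * exp (\<sigma>2 * wt \<rho>2 (norm z)) * ?d z * Kb"
        using Kb(1) by (intro mult_right_mono nU) auto
      also have "\<dots> = Kb * Ks * C2 / fact l * (1 / (2 * B)) ^ l * exp (\<sigma>2 * wt \<rho>2 (norm z)) * (phi \<rho>h l ^ l * ?d z)"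
        by simp
      also have "\<dots> \<le> Kb * Ks * C2 / fact l * (1 / (2 * B)) ^ l * exp (\<sigma>2 * wt \<rho>2 (norm z))
          * (C1 * (Kn * N) * fact l * B ^ l * exp (\<sigma>1 * wt \<rho>h (norm z)))"
        using Kb(1) Ks(1) C2 B by (intro mult_left_mono nH) auto
      also have "\<dots> = Kb * Ks * C2 * C1 * Kn * N * ((1 / (2 * B)) ^ l * B ^ l)
          * exp (\<sigma>2 * wt \<rho>2 (norm z)) * exp (\<sigma>1 * wt \<rho>h (norm z))"
        by simp
      also have "(1 / (2 * B)) ^ l * B ^ l = (1 / 2) ^ l"
        using B by (simp flip: power_mult_distrib)
      also have "Kb * Ks * C2 * C1 * Kn * N * (1 / 2) ^ l * exp (\<sigma>2 * wt \<rho>2 (norm z)) * exp (\<sigma>1 * wt \<rho>h (norm z))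
          \<le> Kb * Ks * C2 * C1 * Kn * N * (1 / 2) ^ l * exp (\<sigma>2 * wt \<rho>2 (norm z))
            * (exp (\<sigma>1 * c) * exp (\<sigma>1 * M * wt \<rho>2 (norm z)))"
        using Kb(1) Ks(1) Kn(1) C2 B N by (intro mult_left_mono exp_mult_le_exp le3) auto
      also have "\<dots> = Kb * Ks * C2 * C1 * Kn * exp (\<sigma>1 * c) * N * (1 / 2) ^ l
          * (exp (\<sigma>2 * wt \<rho>2 (norm z)) * exp (\<sigma>1 * M * wt \<rho>2 (norm z)))"
        by (simp only: mult_ac)
      finally show ?thesis
        unfolding exp_add[symmetric] \<sigma>_def distrib_right .
    qed
    have "slice_bounded \<rho>2 \<sigma> (Ke * (Kb * Ks * C2 * C1 * Kn * exp (\<sigma>1 * c) * N * (1 / 2) ^ l))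
        (slice_ext (\<lambda>z. cxmult (U z) ((stem_deriv ^^ l) H z)))"
      by (rule Ke(2)[OF stem_cxmult[OF U(1) stem_iter_deriv[OF H(1)]] prod])
    then show "slice_bounded \<rho>2 \<sigma> (C * N * (1 / 2) ^ l) (star (u l) ((dx0 ^^ l) f))"
      unfolding U(2) H(2) star_iter_dx0_ext[OF U(1) H(1)] C_def by (simp only: mult.assoc)
  qed
qed

lemma coeff_cond_slice_monogenic:
  assumes "coeff_cond \<rho>h \<rho> \<rho>2 u" shows "slice_monogenic (u l)"
proof -
  obtain \<sigma> where "u l \<in> A_sig \<rho>2 \<sigma>"
    using assms zero_less_one unfolding coeff_cond_def by blast
  then show ?thesis by (simp add: A_sig_def)
qed

text \<open>A concrete sum against which any operator given by limits of the series is
  compared.\<close>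

definition op_limit ::
  "(nat \<Rightarrow> real \<times> (real ^ ('n::{finite,linorder})) \<Rightarrow> 'n clif) \<Rightarrow> (real \<times> (real ^ ('n::{finite,linorder})) \<Rightarrow> 'n clif) \<Rightarrow> real \<times> (real ^ ('n::{finite,linorder})) \<Rightarrow> 'n clif"
  where "op_limit u f = (\<lambda>x. \<Sum>l. star (u l) ((dx0 ^^ l) f) x)"

lemma conv_in_op_limit:
  assumes cc: "coeff_cond \<rho>h \<rho> \<rho>2 u" and f: "f \<in> A_sp \<rho>1"
  shows "conv_in \<rho>2 (op_series u f) (op_limit u f)"
proof -
  obtain \<tau> N where \<tau>: "\<tau> > 0" "slice_bounded \<rho>1 \<tau> N f" using f unfolding A_sp_iff by blast
  obtain \<sigma> C where \<sigma>: "\<sigma> > 0" and b: "\<And>f N l. slice_bounded \<rho>1 \<tau> N f \<Longrightarrow>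
      slice_bounded \<rho>2 \<sigma> (C * N * (1 / 2) ^ l) (star (u l) ((dx0 ^^ l) f))"
    by (rule op_term_bound[OF cc \<tau>(1)]) blast
  show ?thesis
    unfolding op_series_def[abs_def] op_limit_def by (rule conv_in_suminf[OF po2 \<sigma> b[OF \<tau>(2)]])
qed

lemma step_bounded_op_limit:
  assumes cc: "coeff_cond \<rho>h \<rho> \<rho>2 u"
  shows "step_bounded \<rho>1 \<rho>2 (op_limit u)"
  unfolding step_bounded_def
proof (intro allI impI)
  fix \<tau> :: real assume \<tau>: "\<tau> > 0"
  obtain \<sigma> C where \<sigma>: "\<sigma> > 0" "C > 0" and b: "\<And>f N l. slice_bounded \<rho>1 \<tau> N f \<Longrightarrow>
      slice_bounded \<rho>2 \<sigma> (C * N * (1 / 2) ^ l) (star (u l) ((dx0 ^^ l) f))"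
    by (rule op_term_bound[OF cc \<tau>]) blast
  have "slice_bounded \<rho>2 \<sigma> (2 * C * N) (op_limit u f)" if "slice_bounded \<rho>1 \<tau> N f" for f N
    using slice_bounded_suminf(2)[OF po2 \<sigma>(1) b[OF that]] by (simp add: op_limit_def mult.assoc)
  then show "\<exists>\<sigma>>0. \<exists>C>0. \<forall>f N. slice_bounded \<rho>1 \<tau> N f \<longrightarrow> slice_bounded \<rho>2 \<sigma> (C * N) (op_limit u f)"
    using \<sigma> by (intro exI[of _ \<sigma>] exI[of _ "2 * C"] conjI allI impI) auto
qed

text \<open>Only the values of \<open>T\<close> on the space are prescribed. There uniqueness of
  pointwise limits gives \<open>T f = op_limit u f\<close>, and boundedness is inherited.\<close>

lemma continuous_map_op_series_limit:
  fixes T :: "(real \<times> (real ^ ('n::{finite,linorder})) \<Rightarrow> 'n clif) \<Rightarrow> (real \<times> (real ^ ('n::{finite,linorder})) \<Rightarrow> 'n clif)"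
  assumes cc: "coeff_cond \<rho>h \<rho> \<rho>2 u"
    and T: "\<And>f. f \<in> A_sp \<rho>1 \<Longrightarrow> conv_in \<rho>2 (op_series u f) (T f)"
  shows "continuous_map (A_top \<rho>1) (A_top \<rho>2) T"
proof (rule step_bounded_imp_continuous_map)
  show "real_linear_on (A_sp \<rho>1) T"
    by (rule real_linear_on_op_series_limit[OF coeff_cond_slice_monogenic[OF cc] T])
  have eq: "T f = op_limit u f" if "f \<in> A_sp \<rho>1" for f
    using LIMSEQ_unique[OF conv_in_pointwise[OF T[OF that]] conv_in_pointwise[OF conv_in_op_limit[OF cc that]]]
    by (rule HOL.ext)
  show "step_bounded \<rho>1 \<rho>2 T"
    unfolding step_bounded_def
  proof (intro allI impI)
    fix \<tau> :: real assume \<tau>: "\<tau> > 0"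
    then obtain \<sigma> C where \<sigma>: "\<sigma> > 0" "C > 0"
      and b: "\<forall>f N. slice_bounded \<rho>1 \<tau> N f \<longrightarrow> slice_bounded \<rho>2 \<sigma> (C * N) (op_limit u f)"
      using step_bounded_op_limit[OF cc] unfolding step_bounded_def by blast
    have "slice_bounded \<rho>2 \<sigma> (C * N) (T f)" if f: "slice_bounded \<rho>1 \<tau> N f" for f N
    proof -
      have "f \<in> A_sp \<rho>1" unfolding A_sp_iff using f \<tau> by blast
      then show ?thesis using eq b f by simp
    qed
    then show "\<exists>\<sigma>>0. \<exists>C>0. \<forall>f N. slice_bounded \<rho>1 \<tau> N f \<longrightarrow> slice_bounded \<rho>2 \<sigma> (C * N) (T f)"
      using \<sigma> by (intro exI[of _ \<sigma>] exI[of _ C] conjI allI impI)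
  qed
qed

end

section \<open>Symbols from operators\<close>

lemma cxmult_scale_left: "cxmult (k *s a) b = k *s cxmult a b"
  by (simp add: vec_eq_iff cxmult_nth sum_distrib_left mult_ac)

lemma cxmult_scale_right: "cxmult a (k *s b) = k *s cxmult a b"
  by (simp add: vec_eq_iff cxmult_nth sum_distrib_left mult_ac)

lemma cxmult_vcomplex_clif_one [simp]: "cxmult (vcomplex clif_one 0) a = a"
  by (simp add: cxmult_def cmult.zero_left)

lemma scale_scaleR: "k *s (r *\<^sub>R v) = r *\<^sub>R (k *s (v :: complex ^ 'm))"
  by (simp add: vec_eq_iff)

lemma norm_scale: "norm (k *s v) = norm k * norm (v :: complex ^ 'm)"
  by (simp add: norm_vec_def norm_mult L2_set_right_distrib)

lemma norm_vcomplex_real: "norm (vcomplex a 0) = norm a"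
  by (simp add: norm_vec_def Complex_eq)

text \<open>Right multiplication by a constant commutes with left multiplication by
  \<open>para (0, j)\<close> and so acts on the stem directly.\<close>

lemma slice_val_cmult_right: "slice_val j b \<odot> a = slice_val j (cxmult b (vcomplex a 0))"
  by (simp add: slice_val_def cxmult_def cmult.add_left cmult_assoc cmult.zero_right)

lemma ext_cmult_right: "slice_ext H x \<odot> a = slice_ext (\<lambda>z. cxmult (H z) (vcomplex a 0)) x"
  by (simp add: slice_ext_def slice_val_cmult_right)

section \<open>Monomials, their derivatives and binomial inversion\<close>

definition mono_stem :: "nat \<Rightarrow> real ^ 'm \<Rightarrow> complex \<Rightarrow> complex ^ 'm" where
  "mono_stem k a z = z ^ k *s vcomplex a 0"

lemma mono_stem_nth: "mono_stem k a z $ A = z ^ k * of_real (a $ A)"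
  by (simp add: mono_stem_def Complex_eq)

lemma stem_mono_stem: "stem (mono_stem k a)"
  unfolding stem_def mono_stem_nth by (auto intro!: holomorphic_intros)

definition mono_slice :: "nat \<Rightarrow> 'n::{finite,linorder} clif \<Rightarrow> real \<times> (real ^ ('n::{finite,linorder})) \<Rightarrow> 'n clif" where
  "mono_slice k a = slice_ext (mono_stem k a)"

lemma mono_slice_cmult: "mono_slice k clif_one x \<odot> a = mono_slice k a x"
  by (simp add: mono_slice_def ext_cmult_right mono_stem_def[abs_def] cxmult_scale_left)

lemma stem_deriv_mono_stem: "stem_deriv (mono_stem k a) = (\<lambda>z. real k *\<^sub>R mono_stem (k - 1) a z)"
proof (intro HOL.ext vec_eq_iff[THEN iffD2] allI)
  fix z :: complex and A
  have "((\<lambda>w. w ^ k * of_real (a $ A)) has_field_derivative of_nat k * z ^ (k - 1) * of_real (a $ A)) (at z)"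
    by (auto intro!: derivative_eq_intros)
  from DERIV_imp_deriv[OF this]
  show "stem_deriv (mono_stem k a) z $ A = (real k *\<^sub>R mono_stem (k - 1) a z) $ A"
    by (simp add: stem_deriv_def mono_stem_nth scaleR_conv_of_real[where 'a = complex])
qed

text \<open>For \<open>l > k\<close> the truncated difference \<open>k - l\<close> is 0, and the
  vanishing coefficient removes the term.\<close>

lemma iter_stem_deriv_mono_stem:
  "(stem_deriv ^^ l) (mono_stem k a)
    = (\<lambda>z. (if l \<le> k then fact k / fact (k - l) else 0) *\<^sub>R mono_stem (k - l) a z)"
proof (induction l)
  case (Suc l)
  let ?r = "if l \<le> k then fact k / fact (k - l) else 0 :: real"
  have "stem_deriv (\<lambda>z. ?r *\<^sub>R mono_stem (k - l) a z)
      = (\<lambda>z. ?r *\<^sub>R stem_deriv (mono_stem (k - l) a) z)"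
    using stem_deriv_lincomb[OF stem_mono_stem stem_mono_stem, of ?r "k - l" a 0 0 a] by simp
  then have step: "(stem_deriv ^^ Suc l) (mono_stem k a)
      = (\<lambda>z. (?r * real (k - l)) *\<^sub>R mono_stem (k - Suc l) a z)"
    by (simp add: Suc.IH stem_deriv_mono_stem)
  have "?r * real (k - l) = (if Suc l \<le> k then fact k / fact (k - Suc l) else 0)"
  proof (cases "Suc l \<le> k")
    case True
    then have "fact (k - l) = real (k - l) * fact (k - Suc l)"
      by (metis Suc_diff_Suc Suc_le_lessD fact_Suc of_nat_fact of_nat_mult)
    moreover have "fact k / (d * e) * d = fact k / e" if "d \<noteq> 0" for d e :: real
      using that by simp
    moreover have "real (k - l) \<noteq> 0" using True by simp
    ultimately show ?thesis using True by (simp only: if_True Suc_leD)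
  qed auto
  then show ?case using step by simp
qed simp

text \<open>After exchanging the sums, the sum over \<open>l\<close> equals
  \<open>(k choose j) * (- z + z) ^ (k - j)\<close>, which is 1 for \<open>j = k\<close> and 0 for
  \<open>j < k\<close>.\<close>

lemma binomial_inversion:
  fixes q :: "nat \<Rightarrow> complex"
  shows "(\<Sum>l\<le>k. \<Sum>j\<le>l. of_nat (k choose l) * of_nat (l choose j) * z ^ (k - l) * (- z) ^ (l - j) * q j) = q k"
proof -
  let ?f = "\<lambda>l j. of_nat (k choose l) * of_nat (l choose j) * z ^ (k - l) * (- z) ^ (l - j) :: complex"
  have inner: "(\<Sum>l\<le>k. ?f l j) = (if j = k then 1 else 0)" if "j \<le> k" for j
  proof -
    have "(\<Sum>l\<le>k. ?f l j) = (\<Sum>l = j..k. ?f l j)"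
      by (rule sum.mono_neutral_right) auto
    also have "\<dots> = (\<Sum>i = 0..k - j. ?f (j + i) j)"
      using sum.atLeastAtMost_shift_0[OF that, of "\<lambda>l. ?f l j"] by simp
    also have "\<dots> = (\<Sum>i\<le>k - j. of_nat (k choose j) * (of_nat ((k - j) choose i) * (- z) ^ i * z ^ (k - j - i)))"
    proof (rule sum.cong)
      fix i assume "i \<in> {..k - j}"
      then have i: "j \<le> j + i" "j + i \<le> k" using that by auto
      have "of_nat (k choose (j + i)) * of_nat ((j + i) choose j)
          = (of_nat (k choose j) * of_nat ((k - j) choose i) :: complex)"
        using choose_mult[OF i] by (simp flip: of_nat_mult)
      then show "?f (j + i) j = of_nat (k choose j) * (of_nat ((k - j) choose i) * (- z) ^ i * z ^ (k - j - i))"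
        by (simp add: mult_ac)
    qed auto
    also have "\<dots> = of_nat (k choose j) * (- z + z) ^ (k - j)"
      unfolding binomial_ring[of "- z" z] by (simp only: sum_distrib_left)
    finally show ?thesis using that by auto
  qed
  have "(\<Sum>l\<le>k. \<Sum>j\<le>l. ?f l j * q j) = (\<Sum>l\<le>k. \<Sum>j\<le>k. ?f l j * q j)"
    by (intro sum.cong refl sum.mono_neutral_left) auto
  also have "\<dots> = (\<Sum>j\<le>k. \<Sum>l\<le>k. ?f l j * q j)" by (rule sum.swap)
  also have "\<dots> = (\<Sum>j\<le>k. (\<Sum>l\<le>k. ?f l j) * q j)" by (simp only: sum_distrib_right)
  also have "\<dots> = (\<Sum>j\<le>k. if j = k then q j else 0)" by (intro sum.cong refl) (simp add: inner)
  also have "\<dots> = q k" by simp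
  finally show ?thesis .
qed

context order_pair
begin

text \<open>The step \<open>\<tau>\<close> depends on \<open>\<delta>\<close> but on neither
  \<open>j\<close> nor \<open>l\<close>, so a single bound for an operator on that step serves all
  monomials.\<close>

lemma slice_bounded_mono_slice:
  assumes "0 < \<delta>" "\<delta> < 1"
  obtains \<tau> C where "\<tau> > 0" "C > 0"
    "\<And>j l (a :: 'n::{finite,linorder} clif). j \<le> l \<Longrightarrow>
      slice_bounded \<rho>1 \<tau> (C * norm a * (\<delta> * phi \<rho>h l) ^ j) (mono_slice j a)"
proof -
  obtain Ke where Ke: "Ke > 0" "\<And>\<rho> \<sigma> N (H :: complex \<Rightarrow> complex ^ ('n set)).
    stem H \<Longrightarrow> (\<And>z. norm (H z) \<le> N * exp (\<sigma> * wt \<rho> (norm z))) \<Longrightarrow> slice_bounded \<rho> \<sigma> (Ke * N) (slice_ext H)"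
    by (rule slice_bounded_ext) blast
  obtain \<tau> C where \<tau>: "\<tau> > 0" "C \<ge> 1"
    and pow: "\<And>r j l. r \<ge> 0 \<Longrightarrow> j \<le> l \<Longrightarrow> r ^ j \<le> C * (\<delta> * phi \<rho>h l) ^ j * exp (\<tau> * wt \<rho>h r)"
    by (rule power_le_exp_wt[OF assms]) blast
  show ?thesis
  proof (rule that[of \<tau> "Ke * (C * exp (\<tau> * c))"])
    show "\<tau> > 0" "Ke * (C * exp (\<tau> * c)) > 0" using \<tau> Ke(1) by simp_all
    fix j l :: nat and a :: "'n clif" assume jl: "j \<le> l"
    have nonneg: "(\<delta> * phi \<rho>h l) ^ j \<ge> 0"
      using jl assms phi(1)[of l] by (cases "l = 0") auto
    have "norm (mono_stem j a z) \<le> C * exp (\<tau> * c) * norm a * (\<delta> * phi \<rho>h l) ^ j * exp (\<tau> * wt \<rho>1 (norm z))" for z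
    proof -
      have "norm (mono_stem j a z) = norm z ^ j * norm a"
        by (simp add: mono_stem_def norm_scale norm_vcomplex_real norm_power)
      also have "\<dots> \<le> C * (\<delta> * phi \<rho>h l) ^ j * exp (\<tau> * wt \<rho>h (norm z)) * norm a"
        by (intro mult_right_mono pow jl) auto
      also have "\<dots> \<le> C * (\<delta> * phi \<rho>h l) ^ j * (exp (\<tau> * c) * exp (\<tau> * 1 * wt \<rho>1 (norm z))) * norm a"
        using \<tau> nonneg by (intro mult_right_mono mult_left_mono exp_mult_le_exp le2) auto
      finally show ?thesis by (simp add: mult_ac)
    qed
    from Ke(2)[OF stem_mono_stem this]
    show "slice_bounded \<rho>1 \<tau> (Ke * (C * exp (\<tau> * c)) * norm a * (\<delta> * phi \<rho>h l) ^ j) (mono_slice j a)"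
      unfolding mono_slice_def by (simp only: mult.assoc)
  qed
qed

lemma mono_slice_A_sp:
  fixes a :: "'n::{finite,linorder} clif"
  shows "mono_slice j a \<in> A_sp \<rho>1"
proof -
  obtain \<tau> C where "\<tau> > 0" and b: "\<And>j l (a :: 'n clif). j \<le> l \<Longrightarrow>
      slice_bounded \<rho>1 \<tau> (C * norm a * (1 / 2 * phi \<rho>h l) ^ j) (mono_slice j a)"
    by (rule slice_bounded_mono_slice[of "1 / 2"]) auto
  with b[OF order_refl, of a j] show ?thesis unfolding A_sp_iff by blast
qed

text \<open>Cauchy's estimates give coefficients of size \<open>B ^ l / phi \<rho>h l ^ l\<close>,
  while monomials have size \<open>(\<delta> * phi \<rho>h l) ^ l\<close> in a step depending on
  \<open>\<delta>\<close>. Choosing \<open>\<delta> * B \<le> 1 / 2\<close> makes the series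
  geometric, at the price of exchanging the step of \<open>f\<close> for that one.\<close>

lemma taylor_expansion:
  fixes f :: "real \<times> (real ^ ('n::{finite,linorder})) \<Rightarrow> 'n clif"
  assumes f: "f \<in> A_sp \<rho>1"
  obtains \<tau> K a where "\<tau> > 0" "\<And>l. slice_bounded \<rho>1 \<tau> (K * (1 / 2) ^ l) (mono_slice l (a l))"
    "f = (\<lambda>x. \<Sum>l. mono_slice l (a l) x)"
proof -
  obtain \<tau> N where \<tau>: "\<tau> > 0" "slice_bounded \<rho>1 \<tau> N f" using f unfolding A_sp_iff by blast
  obtain H where H: "stem H" "f = slice_ext H"
    using slice_bounded_slice_monogenic[OF \<tau>(2)] unfolding slice_monogenic_iff by blast
  obtain \<sigma>1 B C1 where B: "\<sigma>1 > 0" "B > 0" "C1 > 0"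
    and der: "\<And>(H :: complex \<Rightarrow> complex ^ ('n set)) N l z. stem H \<Longrightarrow>
      (\<And>z. norm (H z) \<le> N * exp (\<tau> * wt \<rho>h (norm z))) \<Longrightarrow>
      phi \<rho>h l ^ l * norm ((stem_deriv ^^ l) H z) \<le> C1 * N * fact l * B ^ l * exp (\<sigma>1 * wt \<rho>h (norm z))"
    by (rule iter_stem_deriv_bound[OF \<tau>(1)]) blast
  obtain Kn where Kn: "Kn > 0" "\<And>N (H :: complex \<Rightarrow> complex ^ ('n set)) z.
    stem H \<Longrightarrow> slice_bounded \<rho>1 \<tau> N (slice_ext H) \<Longrightarrow> norm (H z) \<le> Kn * N * exp (\<tau> * wt \<rho>h (norm z))"
    by (rule stem_bound_normalized[OF \<tau>(1)]) blast
  define \<delta> where "\<delta> = min (1 / 2) (1 / (2 * B))"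
  have \<delta>: "0 < \<delta>" "\<delta> < 1" "\<delta> * B \<le> 1 / 2"
    using B by (auto simp: \<delta>_def min_def field_simps)
  obtain \<tau>' C where \<tau>': "\<tau>' > 0" "C > 0" and mb: "\<And>j l (a :: 'n clif). j \<le> l \<Longrightarrow>
      slice_bounded \<rho>1 \<tau>' (C * norm a * (\<delta> * phi \<rho>h l) ^ j) (mono_slice j a)"
    by (rule slice_bounded_mono_slice[OF \<delta>(1,2)]) blast
  \<comment> \<open>Conjugation symmetry makes the derivatives at 0 real, so passing to
    \<open>vre\<close> loses nothing and the coefficients lie in the real algebra.\<close>
  define a where "a l = (1 / fact l) *\<^sub>R vre ((stem_deriv ^^ l) H 0)" for l
  have real0: "(stem_deriv ^^ l) H 0 = vcomplex (vre ((stem_deriv ^^ l) H 0)) 0" for l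
    using stem_vim_0[OF stem_iter_deriv[OF H(1)], of 0 l] vcomplex_vre_vim by (metis zero_complex.simps(2))
  have na: "norm (a l) = norm ((stem_deriv ^^ l) H 0) / fact l" for l
    by (subst real0) (simp add: a_def norm_vcomplex_real)
  have N: "N \<ge> 0" by (rule slice_bounded_nonneg[OF \<tau>(2)])
  show ?thesis
  proof (rule that[of \<tau>' "C * C1 * Kn * N" a])
    show "\<tau>' > 0" by (rule \<tau>'(1))
    show "slice_bounded \<rho>1 \<tau>' (C * C1 * Kn * N * (1 / 2) ^ l) (mono_slice l (a l))" for l
    proof (rule slice_bounded_mono[OF mb[OF order_refl] order_refl])
      have "phi \<rho>h l ^ l * norm ((stem_deriv ^^ l) H 0) \<le> C1 * (Kn * N) * fact l * B ^ l * exp (\<sigma>1 * wt \<rho>h (norm (0 :: complex)))"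
        by (rule der[OF H(1) Kn(2)[OF H(1) \<tau>(2)[unfolded H(2)]]])
      then have "phi \<rho>h l ^ l * norm (a l) \<le> C1 * Kn * N * B ^ l"
        unfolding na by (simp add: field_simps)
      then have "C * \<delta> ^ l * (phi \<rho>h l ^ l * norm (a l)) \<le> C * \<delta> ^ l * (C1 * Kn * N * B ^ l)"
        using \<tau>' \<delta> by (intro mult_left_mono) auto
      also have "\<dots> = C * C1 * Kn * N * (\<delta> * B) ^ l" by (simp add: power_mult_distrib)
      also have "\<dots> \<le> C * C1 * Kn * N * (1 / 2) ^ l"
        using \<tau>' \<delta> B Kn(1) N by (intro mult_left_mono power_mono) auto
      finally show "C * norm (a l) * (\<delta> * phi \<rho>h l) ^ l \<le> C * C1 * Kn * N * (1 / 2) ^ l"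
        by (simp add: power_mult_distrib mult_ac)
    qed
    have series: "(\<lambda>l. mono_stem l (a l) z) sums H z" for z
    proof -
      have "(\<lambda>l. mono_stem l (a l) z $ A) sums (H z $ A)" for A
      proof -
        have "(\<lambda>l. (deriv ^^ l) (\<lambda>w. H w $ A) 0 / fact l * (z - 0) ^ l) sums (H z $ A)"
          by (rule holomorphic_power_series[OF stem_holomorphic[OF H(1)], of _ _ "norm z + 1"]) simp
        moreover have "(deriv ^^ l) (\<lambda>w. H w $ A) 0 / fact l * (z - 0) ^ l = mono_stem l (a l) z $ A" for l
        proof -
          have "(deriv ^^ l) (\<lambda>w. H w $ A) 0 = of_real (vre ((stem_deriv ^^ l) H 0) $ A)"
            unfolding iter_stem_deriv_nth[symmetric] by (subst real0) (simp add: Complex_eq)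
          then show ?thesis by (simp add: mono_stem_nth a_def)
        qed
        ultimately show ?thesis by simp
      qed
      then show ?thesis
        unfolding sums_def by (intro vec_tendstoI) (simp add: sum_component)
    qed
    show "f = (\<lambda>x. \<Sum>l. mono_slice l (a l) x)"
      unfolding H(2) mono_slice_def slice_ext_def
      by (intro HOL.ext sums_unique bounded_linear.sums[OF bounded_linear_slice_val series])
  qed
qed

text \<open>Both operators are bounded on the step where Taylor remainders decay like
  \<open>(1 / 2) ^ n\<close>. Their target steps may differ, so values are compared at a fixed
  point.\<close>

lemma step_bounded_eqI:
  fixes S T :: "(real \<times> (real ^ ('n::{finite,linorder})) \<Rightarrow> 'n clif) \<Rightarrow> (real \<times> (real ^ ('n::{finite,linorder})) \<Rightarrow> 'n clif)"
  assumes S: "step_bounded \<rho>1 \<rho>2 S" "real_linear_on (A_sp \<rho>1) S"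
    and T: "step_bounded \<rho>1 \<rho>2 T" "real_linear_on (A_sp \<rho>1) T"
    and eq: "\<And>k a. S (mono_slice k a) = T (mono_slice k a)"
    and f: "f \<in> A_sp \<rho>1"
  shows "S f = T f"
proof
  fix x :: "real \<times> (real, 'n) vec"
  obtain \<tau> K a where \<tau>: "\<tau> > 0" and b: "\<And>l. slice_bounded \<rho>1 \<tau> (K * (1 / 2) ^ l) (mono_slice l (a l))"
    and fs: "f = (\<lambda>x. \<Sum>l. mono_slice l (a l) x)"
    by (rule taylor_expansion[OF f]) blast
  define P where "P n x = (\<Sum>l<n. mono_slice l (a l) x)" for n x
  have tail: "slice_bounded \<rho>1 \<tau> (2 * K * (1 / 2) ^ n) (\<lambda>x. f x - P n x)" for n
    unfolding fs P_def by (rule slice_bounded_suminf_tail[OF po1 \<tau> b])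
  have PA: "P n \<in> A_sp \<rho>1" and ST: "S (P n) = T (P n)" for n
  proof (induction n)
    case 0
    have P0: "P 0 = (\<lambda>x. 0)" by (simp add: P_def fun_eq_iff)
    {
      case 1 show ?case unfolding P0 by (rule A_sp_zero)
    next
      case 2
      have "S (\<lambda>x. 0) = (\<lambda>x. 0)" "T (\<lambda>x. 0) = (\<lambda>x. 0)"
        using real_linear_on_scaleR[OF S(2) A_sp_zero, of 0] real_linear_on_scaleR[OF T(2) A_sp_zero, of 0]
        by simp_all
      then show ?case unfolding P0 by simp
    }
  next
    case (Suc n)
    have PS: "P (Suc n) = (\<lambda>x. P n x + mono_slice n (a n) x)" by (simp add: P_def fun_eq_iff)
    {
      case 1 show ?case unfolding PS by (rule A_sp_add[OF Suc(1) mono_slice_A_sp])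
    next
      case 2 show ?case
        unfolding PS real_linear_on_add[OF S(2) Suc(1) mono_slice_A_sp]
          real_linear_on_add[OF T(2) Suc(1) mono_slice_A_sp] Suc(2) eq ..
    }
  qed
  obtain \<sigma> C where \<sigma>: "C > 0" and CS: "\<And>f M. slice_bounded \<rho>1 \<tau> M f \<Longrightarrow> slice_bounded \<rho>2 \<sigma> (C * M) (S f)"
    using S(1) \<tau> unfolding step_bounded_def by blast
  obtain \<sigma>' C' where \<sigma>': "C' > 0" and CT: "\<And>f M. slice_bounded \<rho>1 \<tau> M f \<Longrightarrow> slice_bounded \<rho>2 \<sigma>' (C' * M) (T f)"
    using T(1) \<tau> unfolding step_bounded_def by blast
  let ?e = "C * (2 * K) * exp (\<sigma> * wt \<rho>2 (norm x)) + C' * (2 * K) * exp (\<sigma>' * wt \<rho>2 (norm x))"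
  have le: "norm (S f x - T f x) \<le> ?e * (1 / 2) ^ n" for n
  proof -
    have "norm (S f x - S (P n) x) \<le> C * (2 * K * (1 / 2) ^ n) * exp (\<sigma> * wt \<rho>2 (norm x))"
      using slice_boundedD[OF CS[OF tail[of n]], of x] unfolding real_linear_on_diff[OF S(2) f PA] .
    moreover have "norm (T f x - T (P n) x) \<le> C' * (2 * K * (1 / 2) ^ n) * exp (\<sigma>' * wt \<rho>2 (norm x))"
      using slice_boundedD[OF CT[OF tail[of n]], of x] unfolding real_linear_on_diff[OF T(2) f PA] .
    moreover have "norm (S f x - T f x) \<le> norm (S f x - S (P n) x) + norm (T f x - T (P n) x)"
      using norm_triangle_ineq4[of "S f x - S (P n) x" "T f x - T (P n) x"] ST[of n] by simp
    ultimately show ?thesis by (simp add: algebra_simps)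
  qed
  have "(\<lambda>n. ?e * (1 / 2) ^ n) \<longlonglongrightarrow> 0"
    by (intro tendsto_mult_right_zero LIMSEQ_power_zero) simp
  then have "norm (S f x - T f x) \<le> 0"
    by (rule LIMSEQ_le_const) (use le in blast)
  then show "S f x = T f x" by simp
qed

lemma exists_coefficients:
  fixes T :: "(real \<times> (real ^ ('n::{finite,linorder})) \<Rightarrow> 'n clif) \<Rightarrow> (real \<times> (real ^ ('n::{finite,linorder})) \<Rightarrow> 'n clif)"
  assumes rl: "right_linear_on (A_sp \<rho>1) T" and cont: "continuous_map (A_top \<rho>1) (A_top \<rho>2) T"
  shows "\<exists>u. (\<forall>l. slice_monogenic (u l)) \<and> coeff_cond \<rho>h \<rho> \<rho>2 u \<and>
    (\<forall>f\<in>A_sp \<rho>1. conv_in \<rho>2 (op_series u f) (T f))"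
proof -
  have rlD: "T (\<lambda>x. f x \<odot> a + g x \<odot> b) = (\<lambda>x. T f x \<odot> a + T g x \<odot> b)"
    if "f \<in> A_sp \<rho>1" "g \<in> A_sp \<rho>1" for f g a b
    using rl that unfolding right_linear_on_def by blast
  have lin: "real_linear_on (A_sp \<rho>1) T"
    unfolding real_linear_on_def
  proof (intro ballI allI)
    fix f g :: "real \<times> (real, 'n) vec \<Rightarrow> 'n clif" and a b :: real
    assume "f \<in> A_sp \<rho>1" "g \<in> A_sp \<rho>1"
    \<comment> \<open>A real scalar acts as right multiplication by a multiple of
      \<open>clif_one\<close>.\<close>
    from rlD[OF this, of "a *\<^sub>R clif_one" "b *\<^sub>R clif_one"]
    show "T (\<lambda>x. a *\<^sub>R f x + b *\<^sub>R g x) = (\<lambda>x. a *\<^sub>R T f x + b *\<^sub>R T g x)"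
      by (simp add: cmult.scaleR_right)
  qed
  have sb: "step_bounded \<rho>1 \<rho>2 T" by (rule continuous_map_imp_step_bounded[OF cont lin])
  have "\<forall>j. \<exists>P. stem P \<and> T (mono_slice j clif_one) = slice_ext P"
    unfolding slice_monogenic_iff[symmetric]
    by (intro allI A_sp_slice_monogenic[OF step_bounded_A_sp[OF sb mono_slice_A_sp]])
  from choice[OF this] obtain P where P: "\<And>j. stem (P j)" "\<And>j. T (mono_slice j clif_one) = slice_ext (P j)" by blast
  \<comment> \<open>Here right linearity enters beyond real scalars: the coefficient
    \<open>a\<close> moves outside, so the images of the pure powers determine \<open>T\<close> on
    all monomials.\<close>
  have Tmono: "T (mono_slice k a) = slice_ext (\<lambda>z. cxmult (P k z) (vcomplex a 0))" for k a
    using rlD[OF mono_slice_A_sp mono_slice_A_sp, of k clif_one a k clif_one 0]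
    by (simp add: cmult.zero_right mono_slice_cmult P(2) ext_cmult_right fun_eq_iff)
  text \<open>The coefficients are forced by \<open>T x\<^sup>k = \<Sum>\<^bsub>l\<le>k\<^esub> u\<^sub>l \<star> \<partial>\<^sup>l x\<^sup>k\<close>, solved for \<open>u\<^sub>l\<close> by binomial inversion.\<close>
  define U where "U l z = (1 / fact l) *\<^sub>R (\<Sum>j\<le>l. (of_nat (l choose j) * (- z) ^ (l - j)) *s P j z)" for l z
  have U: "stem (U l)" for l
  proof -
    have "stem (\<lambda>z. (of_nat (l choose j) * (- z) ^ (l - j)) *s P j z)" for j
      using P(1)[of j] unfolding stem_def by (auto intro!: holomorphic_intros)
    then show ?thesis unfolding U_def[abs_def] by (intro stem_scaleR stem_sum)
  qed
  define u where "u l = slice_ext (U l)" for l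
  have cc: "coeff_cond \<rho>h \<rho> \<rho>2 u"
    unfolding coeff_cond_def
  proof (intro allI impI)
    fix \<epsilon> :: real assume \<epsilon>: "\<epsilon> > 0"
    define Q where "Q = (exp 1 * \<rho>) powr (1 / \<rho>)"
    have Q: "Q > 0" using order_pos by (simp add: Q_def)
    \<comment> \<open>\<open>Q\<close> is the normalizing root in \<open>Gnum_eq\<close>, and the 2
      next to it absorbs the sum \<open>2 ^ l\<close> of the binomial coefficients; the minimum with
      \<open>1 / 2\<close> keeps \<open>\<delta>\<close> below 1.\<close>
    define \<delta> where "\<delta> = min (1 / 2) (\<epsilon> / (2 * Q))"
    have \<delta>: "0 < \<delta>" "\<delta> < 1" "2 * \<delta> * Q \<le> \<epsilon>"
      using \<epsilon> Q by (auto simp: \<delta>_def min_def field_simps)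
    obtain \<tau> C where \<tau>: "\<tau> > 0" "C > 0" and mb: "\<And>j l (a :: 'n clif). j \<le> l \<Longrightarrow>
        slice_bounded \<rho>1 \<tau> (C * norm a * (\<delta> * phi \<rho>h l) ^ j) (mono_slice j a)"
      by (rule slice_bounded_mono_slice[OF \<delta>(1,2)]) blast
    obtain \<sigma> C' where \<sigma>: "\<sigma> > 0" "C' > 0"
      and TC: "\<And>f M. slice_bounded \<rho>1 \<tau> M f \<Longrightarrow> slice_bounded \<rho>2 \<sigma> (C' * M) (T f)"
      using sb \<tau>(1) unfolding step_bounded_def by blast
    obtain \<tau>' D where \<tau>': "\<tau>' > 0" "D \<ge> 1"
      and pow: "\<And>r j l. r \<ge> 0 \<Longrightarrow> j \<le> l \<Longrightarrow> r ^ j \<le> D * (\<delta> * phi \<rho>h l) ^ j * exp (\<tau>' * wt \<rho>h r)"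
      by (rule power_le_exp_wt[OF \<delta>(1,2)]) blast
    obtain Ks where Ks: "Ks > 0" "\<And>\<rho> \<sigma> N (H :: complex \<Rightarrow> complex ^ ('n set)) z.
      stem H \<Longrightarrow> slice_bounded \<rho> \<sigma> N (slice_ext H) \<Longrightarrow> norm (H z) \<le> Ks * N * exp (\<sigma> * wt \<rho> (norm z))"
      by (rule stem_bound) blast
    obtain Ke where Ke: "Ke > 0" "\<And>\<rho> \<sigma> N (H :: complex \<Rightarrow> complex ^ ('n set)).
      stem H \<Longrightarrow> (\<And>z. norm (H z) \<le> N * exp (\<sigma> * wt \<rho> (norm z))) \<Longrightarrow> slice_bounded \<rho> \<sigma> (Ke * N) (slice_ext H)"
      by (rule slice_bounded_ext) blast
    define L where "L = Ks * C' * C * norm (clif_one :: 'n clif) * D * exp (\<tau>' * c)"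
    have L: "L \<ge> 0" using Ks(1) \<sigma> \<tau> \<tau>' by (simp add: L_def)
    \<comment> \<open>\<open>\<sigma>\<close> comes from the images under \<open>T\<close>, and
      \<open>\<tau>' * M\<close> from the powers of \<open>z\<close> in \<open>U l\<close> after
      passing to the weight of \<open>\<rho>2\<close>.\<close>
    define \<sigma>t where "\<sigma>t = \<sigma> + \<tau>' * M"
    have nonneg: "\<delta> * phi \<rho>h l \<ge> 0 \<or> l = 0" for l
      using \<delta> phi(1)[of l] by auto
    have nU: "norm (U l z) \<le> L * (2 * \<delta> * phi \<rho>h l) ^ l / fact l * exp (\<sigma>t * wt \<rho>2 (norm z))" for l z
    proof -
      let ?X = "exp (\<sigma>t * wt \<rho>2 (norm z))" and ?p = "\<delta> * phi \<rho>h l"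
      have p0: "?p ^ j \<ge> 0" if "j \<le> l" for j
        using nonneg[of l] that by auto
      have E: "exp (\<tau>' * wt \<rho>h (norm z)) \<le> exp (\<tau>' * c) * exp (\<tau>' * M * wt \<rho>2 (norm z))"
        using \<tau>' by (intro exp_mult_le_exp le3) auto
      \<comment> \<open>Both factors are measured at the scale of \<open>l\<close>: the power of
        \<open>z\<close> gives \<open>?p ^ (l - j)\<close> and \<open>P j\<close> gives
        \<open>?p ^ j\<close>, so the product does not depend on \<open>j\<close>.\<close>
      have summand: "norm ((of_nat (l choose j) * (- z) ^ (l - j)) *s P j z) \<le> of_nat (l choose j) * (L * ?p ^ l * ?X)"
        if j: "j \<le> l" for j
      proof -
        have "norm (P j z) \<le> Ks * (C' * (C * norm (clif_one :: 'n clif) * ?p ^ j)) * exp (\<sigma> * wt \<rho>2 (norm z))"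
          by (rule Ks(2)[OF P(1) TC[OF mb[OF j, of clif_one], unfolded P(2)]])
        moreover have "norm z ^ (l - j) \<le> D * ?p ^ (l - j) * (exp (\<tau>' * c) * exp (\<tau>' * M * wt \<rho>2 (norm z)))"
          by (rule order_trans[OF pow mult_left_mono[OF E]]) (use p0[of "l - j"] \<tau>' in auto)
        ultimately have "norm z ^ (l - j) * norm (P j z)
            \<le> (D * ?p ^ (l - j) * (exp (\<tau>' * c) * exp (\<tau>' * M * wt \<rho>2 (norm z))))
              * (Ks * (C' * (C * norm (clif_one :: 'n clif) * ?p ^ j)) * exp (\<sigma> * wt \<rho>2 (norm z)))"
          using p0[of "l - j"] \<tau>' by (intro mult_mono) auto
        also have "\<dots> = L * (?p ^ (l - j) * ?p ^ j) * (exp (\<sigma> * wt \<rho>2 (norm z)) * exp (\<tau>' * M * wt \<rho>2 (norm z)))"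
          by (simp only: L_def mult_ac)
        also have "\<dots> = L * ?p ^ l * ?X"
          unfolding \<sigma>t_def distrib_right exp_add power_add[symmetric] using j by simp
        finally have "of_nat (l choose j) * (norm z ^ (l - j) * norm (P j z)) \<le> of_nat (l choose j) * (L * ?p ^ l * ?X)"
          by (rule mult_left_mono) simp
        then show ?thesis by (simp add: norm_scale norm_mult norm_power mult.assoc)
      qed
      have "norm (\<Sum>j\<le>l. (of_nat (l choose j) * (- z) ^ (l - j)) *s P j z)
          \<le> (\<Sum>j\<le>l. of_nat (l choose j) * (L * ?p ^ l * ?X))"
        by (rule order_trans[OF norm_sum sum_mono]) (use summand in auto)
      also have "\<dots> = (\<Sum>j\<le>l. real (l choose j)) * (L * ?p ^ l * ?X)"
        by (simp only: sum_distrib_right)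
      also have "(\<Sum>j\<le>l. real (l choose j)) = 2 ^ l"
        using choose_row_sum[of l] by (simp flip: of_nat_sum)
      finally have "norm (\<Sum>j\<le>l. (of_nat (l choose j) * (- z) ^ (l - j)) *s P j z) / fact l
          \<le> 2 ^ l * (L * ?p ^ l * ?X) / fact l"
        by (rule divide_right_mono) simp
      then show ?thesis
        unfolding U_def by (simp add: power_mult_distrib mult_ac)
    qed
    \<comment> \<open>The added 1 yields the strict positivity demanded by
      \<open>coeff_cond\<close>.\<close>
    define K where "K = Ke * L + 1"
    have K: "K > 0" using Ke(1) L by (simp add: K_def add_nonneg_pos)
    have ub: "slice_bounded \<rho>2 \<sigma>t (K * Gnum \<rho>h \<rho> l / fact l * \<epsilon> ^ l) (u l)" for l
    proof -
      have "phi \<rho>h l / Q \<ge> 0 \<or> l = 0" using Q phi(1)[of l] by auto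
      then have G0: "(phi \<rho>h l / Q) ^ l \<ge> 0" by auto
      have "(2 * \<delta> * phi \<rho>h l) ^ l = (phi \<rho>h l / Q) ^ l * (2 * \<delta> * Q) ^ l"
        using Q by (simp add: mult.commute flip: power_mult_distrib)
      also have "\<dots> \<le> (phi \<rho>h l / Q) ^ l * \<epsilon> ^ l"
        using G0 \<delta> Q by (intro mult_left_mono power_mono) auto
      finally have A: "(2 * \<delta> * phi \<rho>h l) ^ l \<le> Gnum \<rho>h \<rho> l * \<epsilon> ^ l"
        unfolding Gnum_eq Q_def[symmetric] .
      have "Gnum \<rho>h \<rho> l * \<epsilon> ^ l \<ge> 0" using G0 \<epsilon> unfolding Gnum_eq Q_def[symmetric] by simp
      moreover have "Ke * L \<ge> 0" using Ke(1) L by simp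
      ultimately have "Ke * L * (2 * \<delta> * phi \<rho>h l) ^ l \<le> Ke * L * (Gnum \<rho>h \<rho> l * \<epsilon> ^ l) + 1 * (Gnum \<rho>h \<rho> l * \<epsilon> ^ l)"
        using mult_left_mono[OF A] by (intro add_increasing2) simp_all
      then have "Ke * L * (2 * \<delta> * phi \<rho>h l) ^ l \<le> K * (Gnum \<rho>h \<rho> l * \<epsilon> ^ l)"
        unfolding K_def distrib_right .
      then have "Ke * L * (2 * \<delta> * phi \<rho>h l) ^ l / fact l \<le> K * (Gnum \<rho>h \<rho> l * \<epsilon> ^ l) / fact l"
        by (rule divide_right_mono) simp
      then have le: "Ke * (L * (2 * \<delta> * phi \<rho>h l) ^ l / fact l) \<le> K * Gnum \<rho>h \<rho> l / fact l * \<epsilon> ^ l"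
        by (simp add: mult_ac)
      show ?thesis
        unfolding u_def by (rule slice_bounded_mono[OF Ke(2)[OF U nU] order_refl le])
    qed
    have "\<sigma>t > 0" using \<sigma> \<tau>' M by (simp add: \<sigma>t_def add_pos_pos)
    moreover have "u l \<in> A_sig \<rho>2 \<sigma>t" for l
      unfolding A_sig_iff using ub[of l] by (rule exI)
    ultimately show "\<exists>\<sigma>>0. \<exists>C>0. \<forall>l. u l \<in> A_sig \<rho>2 \<sigma> \<and> wnorm \<rho>2 \<sigma> (u l) \<le> C * Gnum \<rho>h \<rho> l / fact l * \<epsilon> ^ l"
      using K wnorm_le[OF ub] by blast
  qed
  have agree: "op_limit u (mono_slice k a) = T (mono_slice k a)" for k a
  proof
    fix x :: "real \<times> (real, 'n) vec"
    let ?t = "\<lambda>l z. cxmult (U l z) ((stem_deriv ^^ l) (mono_stem k a) z)"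
    have "star (u l) ((dx0 ^^ l) (mono_slice k a)) = slice_ext (?t l)" for l
      unfolding u_def mono_slice_def by (rule star_iter_dx0_ext[OF U stem_mono_stem])
    then have "op_limit u (mono_slice k a) x = (\<Sum>l. slice_ext (?t l) x)" by (simp add: op_limit_def)
    \<comment> \<open>Derivatives of order \<open>l > k\<close> annihilate the monomial.\<close>
    also have "\<dots> = (\<Sum>l\<le>k. slice_ext (?t l) x)"
      by (rule suminf_finite)
        (auto simp: iter_stem_deriv_mono_stem cxmult.zero_right slice_ext_def linear_0[OF linear_slice_val])
    also have "\<dots> = slice_ext (\<lambda>z. \<Sum>l\<le>k. ?t l z) x" by (simp only: ext_sum)
    also have "(\<lambda>z. \<Sum>l\<le>k. ?t l z) = (\<lambda>z. cxmult (P k z) (vcomplex a 0))"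
    proof (intro HOL.ext vec_eq_iff[THEN iffD2] allI)
      fix z :: complex and A
      let ?q = "\<lambda>j. cxmult (P j z) (vcomplex a 0) $ A"
      have "?t l z $ A = (\<Sum>j\<le>l. of_nat (k choose l) * of_nat (l choose j) * z ^ (k - l) * (- z) ^ (l - j) * ?q j)"
        if l: "l \<le> k" for l
      proof -
        have "?t l z = (fact k / fact (k - l)) *\<^sub>R (1 / fact l) *\<^sub>R
            (z ^ (k - l) *s (\<Sum>j\<le>l. (of_nat (l choose j) * (- z) ^ (l - j)) *s cxmult (P j z) (vcomplex a 0)))"
          using l by (simp add: iter_stem_deriv_mono_stem mono_stem_def U_def cxmult.scaleR_left cxmult.scaleR_right
              cxmult_scale_left cxmult_scale_right cxmult.sum_left scale_scaleR)
        also have "\<dots> $ A = of_real (fact k / fact (k - l) * (1 / fact l)) *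
            (z ^ (k - l) * (\<Sum>j\<le>l. of_nat (l choose j) * (- z) ^ (l - j) * ?q j))"
          by (simp add: scaleR_conv_of_real[where 'a = complex] sum_component)
        also have "fact k / fact (k - l) * (1 / fact l) = real (k choose l)"
          using l by (simp add: binomial_fact mult.commute)
        finally show ?thesis
          by (simp add: sum_distrib_left mult_ac)
      qed
      then have "(\<Sum>l\<le>k. ?t l z) $ A
          = (\<Sum>l\<le>k. \<Sum>j\<le>l. of_nat (k choose l) * of_nat (l choose j) * z ^ (k - l) * (- z) ^ (l - j) * ?q j)"
        by (simp add: sum_component)
      also have "\<dots> = ?q k" by (rule binomial_inversion)
      finally show "(\<Sum>l\<le>k. ?t l z) $ A = cxmult (P k z) (vcomplex a 0) $ A" .
    qed
    finally show "op_limit u (mono_slice k a) x = T (mono_slice k a) x" by (simp only: Tmono)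
  qed
  have um: "slice_monogenic (u l)" for l by (rule coeff_cond_slice_monogenic[OF cc])
  have "real_linear_on (A_sp \<rho>1) (op_limit u)"
    by (rule real_linear_on_op_series_limit[OF um conv_in_op_limit[OF cc]])
  then have "op_limit u f = T f" if "f \<in> A_sp \<rho>1" for f
    by (rule step_bounded_eqI[OF step_bounded_op_limit[OF cc] _ sb lin agree that])
  then have "conv_in \<rho>2 (op_series u f) (T f)" if "f \<in> A_sp \<rho>1" for f
    using conv_in_op_limit[OF cc that] that by simp
  then show ?thesis using um cc by blast
qed

end

theorem theorem4p3:
  fixes \<rho>1' \<rho>2' \<rho>1h :: "real \<Rightarrow> real" and \<rho>1 \<rho>2 :: real
  assumes "proximate_order \<rho>1' \<rho>1" and "proximate_order \<rho>2' \<rho>2"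
    and "(\<lambda>r. r powr \<rho>1' r) \<in> O(\<lambda>r. r powr \<rho>2' r)"
    and "proximate_order \<rho>1h \<rho>1" and "normalized \<rho>1h"
    and "\<forall>\<^sub>F r in at_top. \<rho>1h r = \<rho>1' r"
  shows
    "(\<forall>u :: nat \<Rightarrow> real \<times> (real ^ ('n::{finite,linorder})) \<Rightarrow> 'n clif.
        (\<forall>l. slice_monogenic (u l)) \<and> coeff_cond \<rho>1h \<rho>1 \<rho>2' u \<longrightarrow>
          (\<forall>f\<in>A_sp \<rho>1'. \<exists>g. conv_in \<rho>2' (op_series u f) g) \<and>
          (\<forall>T. (\<forall>f\<in>A_sp \<rho>1'. conv_in \<rho>2' (op_series u f) (T f)) \<longrightarrow>
                continuous_map (A_top \<rho>1') (A_top \<rho>2') T))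
     \<and>
     (\<forall>T :: (real \<times> (real ^ ('n::{finite,linorder})) \<Rightarrow> 'n clif) \<Rightarrow> (real \<times> (real ^ ('n::{finite,linorder})) \<Rightarrow> 'n clif).
        right_linear_on (A_sp \<rho>1') T \<and> continuous_map (A_top \<rho>1') (A_top \<rho>2') T \<longrightarrow>
        (\<exists>u. (\<forall>l. slice_monogenic (u l)) \<and> coeff_cond \<rho>1h \<rho>1 \<rho>2' u \<and>
             (\<forall>f\<in>A_sp \<rho>1'. conv_in \<rho>2' (op_series u f) (T f))))"
proof -
  \<comment> \<open>Eventual equality of the orders gives comparisons with factor 1 in both
    directions, which \<open>wt_compare\<close> makes global.\<close>
  have e1: "eventually (\<lambda>r. wt \<rho>1' r \<le> 1 * wt \<rho>1h r) at_top"
    and e2: "eventually (\<lambda>r. wt \<rho>1h r \<le> 1 * wt \<rho>1' r) at_top"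
    using assms(6) by (auto elim!: eventually_mono simp: wt_def)
  obtain c1 where c1: "c1 \<ge> 0" "\<And>r. r \<ge> 0 \<Longrightarrow> wt \<rho>1' r \<le> 1 * wt \<rho>1h r + c1"
    by (rule wt_compare[OF assms(1) e1]) auto
  obtain c2 where c2: "c2 \<ge> 0" "\<And>r. r \<ge> 0 \<Longrightarrow> wt \<rho>1h r \<le> 1 * wt \<rho>1' r + c2"
    by (rule wt_compare[OF assms(4) e2]) auto
  obtain M where M: "M > 0" and ev: "eventually (\<lambda>r. norm (wt \<rho>1' r) \<le> M * norm (wt \<rho>2' r)) at_top"
    using landau_o.bigE[OF assms(3)] unfolding wt_def by blast
  from ev e2 have "eventually (\<lambda>r. wt \<rho>1h r \<le> M * wt \<rho>2' r) at_top"
    by eventually_elim simp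
  then obtain c3 where c3: "c3 \<ge> 0" "\<And>r. r \<ge> 0 \<Longrightarrow> wt \<rho>1h r \<le> M * wt \<rho>2' r + c3"
    by (rule wt_compare[OF assms(4)]) (use M in auto)
  interpret order_pair \<rho>1h \<rho>1 \<rho>1' \<rho>2' \<rho>1 \<rho>2 "max c1 (max c2 c3)" M
  proof
    show "wt \<rho>1' r \<le> 1 * wt \<rho>1h r + max c1 (max c2 c3)" if "r \<ge> 0" for r
      using c1(2)[OF that] by simp
    show "wt \<rho>1h r \<le> 1 * wt \<rho>1' r + max c1 (max c2 c3)" if "r \<ge> 0" for r
      using c2(2)[OF that] by simp
    show "wt \<rho>1h r \<le> M * wt \<rho>2' r + max c1 (max c2 c3)" if "r \<ge> 0" for r
      using c3(2)[OF that] by simp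
  qed (use assms M c1(1) in auto)
  show ?thesis
  proof (intro conjI allI impI ballI; (elim conjE)?)
    fix u :: "nat \<Rightarrow> real \<times> (real ^ ('n::{finite,linorder})) \<Rightarrow> 'n clif"
      and f :: "real \<times> (real ^ ('n::{finite,linorder})) \<Rightarrow> 'n clif"
    assume cc: "coeff_cond \<rho>1h \<rho>1 \<rho>2' u" and f: "f \<in> A_sp \<rho>1'"
    show "\<exists>g. conv_in \<rho>2' (op_series u f) g"
      by (rule exI[of _ "op_limit u f"]) (rule conv_in_op_limit[OF cc f])
  next
    fix u :: "nat \<Rightarrow> real \<times> (real ^ ('n::{finite,linorder})) \<Rightarrow> 'n clif"
      and T :: "(real \<times> (real ^ ('n::{finite,linorder})) \<Rightarrow> 'n clif) \<Rightarrow> (real \<times> (real ^ ('n::{finite,linorder})) \<Rightarrow> 'n clif)"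
    assume "coeff_cond \<rho>1h \<rho>1 \<rho>2' u" "\<forall>f\<in>A_sp \<rho>1'. conv_in \<rho>2' (op_series u f) (T f)"
    then show "continuous_map (A_top \<rho>1') (A_top \<rho>2') T"
      by (intro continuous_map_op_series_limit) auto
  next
    fix T :: "(real \<times> (real ^ ('n::{finite,linorder})) \<Rightarrow> 'n clif) \<Rightarrow> (real \<times> (real ^ ('n::{finite,linorder})) \<Rightarrow> 'n clif)"
    assume "right_linear_on (A_sp \<rho>1') T" "continuous_map (A_top \<rho>1') (A_top \<rho>2') T"
    then show "\<exists>u. (\<forall>l. slice_monogenic (u l)) \<and> coeff_cond \<rho>1h \<rho>1 \<rho>2' u \<and>
        (\<forall>f\<in>A_sp \<rho>1'. conv_in \<rho>2' (op_series u f) (T f))"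
      by (rule exists_coefficients)
  qed
qed

end
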